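(* Let $\mathbb{F}$ be a subfield of $\mathbb{C}$ such that $\bar x\in\mathbb{F}$ for all $x\in\mathbb{F}$ and $\sqrt{y}\in\mathbb{F}$ for all $y\in\mathbb{F}$ with $y>0$. Let $1\le r\le s$ be integers and let $P$ be an $r\times s$ matrix of Laurent polynomials with coefficients in $\mathbb{F}$. Then $P(z)P^*(z)=I_r$ for all $z\in\mathbb{C}\setminus\{0\}$ and the symmetry of $P$ is compatible, $\mathcal{S}P=(\mathcal{S}\theta_1)^*\mathcal{S}\theta_2$ for some $1\times r$ and $1\times s$ row vectors $\theta_1,\theta_2$ of Laurent polynomials with symmetry, if and only if there exist $s\times s$ matrices $P_0,\ldots,P_{J+1}$ of Laurent polynomials with coefficients in $\mathbb{F}$ such that (1) $P$ can be represented as a product of $P_0,\ldots,P_{J+1}$: $$P(z)=[I_r,\mathbf{0}]\,P_{J+1}(z)P_J(z)\cdots P_1(z)P_0(z);$$ (2) $P_j$, $1\le j\le J$, are elementary: $P_j(z)P_j^*(z)=I_s$ and $\mathrm{coeffsupp}(P_j)\subseteq[-1,1]$; (3) $(P_{j+1},P_j)$ has mutually compatible symmetry for all $0\le j\le J$; (4) $P_0=U_{\mathcal{S}\theta_2}^*$ and $P_{J+1}=\mathrm{diag}(U_{\mathcal{S}\theta_1},I_{s-r})$, where $U_{\mathcal{S}\theta_1}$, $U_{\mathcal{S}\theta_2}$ are the products of a permutation matrix with a diagonal matrix of monomials defined in the context; (5) $J\le \displaystyle\max_{1\le m\le r,\,1\le n\le s}\lceil |\mathrm{coeffsupp}([P]_{m,n})|/2\rceil$,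 where $\lceil\cdot\rceil$ is the ceiling function.
   Context: $[P]_{j,k}$ denotes the $(j,k)$-entry of $P$, $I_r$ the $r\times r$ identity matrix, $\mathbf{0}$ a zero matrix of appropriate size. Adjoint: for $P(z)=\sum_{k\in\mathbb{Z}}P_kz^k$, $P^*(z):=\sum_{k\in\mathbb{Z}}\overline{P_k}^{T}z^{-k}$. Symmetry: a Laurent polynomial $p(z)=\sum_k p_kz^k$ has symmetry if there are $\varepsilon\in\{-1,1\}$, $c\in\mathbb{Z}$ with $p_{c-k}=\varepsilon p_k$ for all $k\in\mathbb{Z}$. The symmetry operator is $\mathcal{S}p(z):=p(z)/p(1/z)$; for $p\ne0$, $p$ has this symmetry iff $\mathcal{S}p(z)=\varepsilon z^c$. For the zero polynomial, $\mathcal{S}0$ is understood to take an appropriate choice of $\varepsilon z^c$ so that the identity in which it occurs holds. $\mathcal{S}$ acts entrywise on matrices. Compatible symmetry: an $r\times s$ matrix $P$ has compatible symmetry if $\mathcal{S}P=(\mathcal{S}\theta_1)^*\mathcal{S}\theta_2$ for some $1\times r$ and $1\times s$ row vectors $\theta_1,\theta_2$ of Laurent polynomials with symmetry. For an $r\times s$ matrix $P$ and an $s\times t$ matrix $Q$, $(P,Q)$ has mutually compatible symmetry if $\mathcal{S}P=(\mathcal{S}\theta_1)^*\mathcal{S}\theta$ and $\mathcal{S}Q=(\mathcal{S}\theta)^*\mathcal{S}\theta_2$ for some $1\times r$, $1\times s$, $1\times t$ row vectors $\theta_1,\theta,\theta_2$ of Laurent polynomials with symmetry. Coefficient support: for $P=\sum_kP_kz^k$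 with $P_k=\mathbf{0}$ for $k\notin[m,n]$, $P_m\ne\mathbf{0}$, $P_n\ne\mathbf{0}$, $\mathrm{coeffsupp}(P):=[m,n]$ and $|\mathrm{coeffsupp}(P)|:=n-m$; $\mathrm{coeffsupp}(\mathbf{0}):=\emptyset$, $|\mathrm{coeffsupp}(\mathbf{0})|:=-\infty$. The matrices $U_{\mathcal{S}\theta}$: let $\theta$ be a $1\times n$ row vector of Laurent polynomials with symmetry, $\mathcal{S}\theta=[\varepsilon_1z^{c_1},\ldots,\varepsilon_nz^{c_n}]$. The symmetry of every entry of $\theta\,\mathrm{diag}(z^{-\lceil c_1/2\rceil},\ldots,z^{-\lceil c_n/2\rceil})$ belongs to $\{\pm1,\pm z^{-1}\}$. Define $U_{\mathcal{S}\theta}:=\mathrm{diag}(z^{-\lceil c_1/2\rceil},\ldots,z^{-\lceil c_n/2\rceil})E_\theta$, where $E_\theta$ is a permutation matrix regrouping these four types of symmetry together so that $\mathcal{S}(\theta U_{\mathcal{S}\theta})=[\mathbf{1}_{n_1},-\mathbf{1}_{n_2},z^{-1}\mathbf{1}_{n_3},-z^{-1}\mathbf{1}_{n_4}]$, with $\mathbf{1}_m$ the $1\times m$ row vector $[1,\ldots,1]$ and $n_1,\dots,n_4$ nonnegative integers uniquely determined by $\mathcal{S}\theta$.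
   Formalization: In (5) the bound is the maximum of 1 and the stated one, since P=[-1] has no factorization with J=0; in (3) the symmetry chosen for zero entries of each P_j is the same in both pairs containing P_j, since otherwise the "if" direction fails. *)

theory Defs
  imports
    Complex_Main
    "HOL-Library.Poly_Mapping"
    "HOL-Library.Extended_Real"
    "HOL-Combinatorics.Permutations"
    "Jordan_Normal_Form.Matrix"
begin

text \<open>Multiplication of finitely supported functions on the integers is convolution, so this
  type is the ring of Laurent polynomials; \<open>Poly_Mapping.single k a\<close> is \<open>a z^k\<close>.\<close>

type_synonym laurent = "int \<Rightarrow>\<^sub>0 complex"

definition laurent_eval :: "laurent \<Rightarrow> complex \<Rightarrow> complex" where
  "laurent_eval p z = (\<Sum>k\<in>Poly_Mapping.keys p. Poly_Mapping.lookup p k * z powi k)"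

definition laurent_adj :: "laurent \<Rightarrow> laurent" where
  "laurent_adj p =
     (\<Sum>k\<in>Poly_Mapping.keys p. Poly_Mapping.single (- k) (cnj (Poly_Mapping.lookup p k)))"

definition laurent_reflect :: "laurent \<Rightarrow> laurent" where
  "laurent_reflect p =
     (\<Sum>k\<in>Poly_Mapping.keys p. Poly_Mapping.single (- k) (Poly_Mapping.lookup p k))"

definition mat_adj :: "laurent mat \<Rightarrow> laurent mat" where
  "mat_adj P = mat (dim_col P) (dim_row P) (\<lambda>(i,j). laurent_adj (P $$ (j,i)))"

definition mat_eval :: "laurent mat \<Rightarrow> complex \<Rightarrow> complex mat" where
  "mat_eval P z = map_mat (\<lambda>p. laurent_eval p z) P"

definition paraunitary :: "laurent mat \<Rightarrow> bool" where
  "paraunitary P \<longleftrightarrow>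
     (\<forall>z. z \<noteq> 0 \<longrightarrow> mat_eval P z * mat_eval (mat_adj P) z = 1\<^sub>m (dim_row P))"

definition coeffs_in :: "complex set \<Rightarrow> laurent mat \<Rightarrow> bool" where
  "coeffs_in F P \<longleftrightarrow>
     (\<forall>i<dim_row P. \<forall>j<dim_col P. \<forall>k. Poly_Mapping.lookup (P $$ (i,j)) k \<in> F)"

definition complex_subfield :: "complex set \<Rightarrow> bool" where
  "complex_subfield F \<longleftrightarrow> 0 \<in> F \<and> 1 \<in> F \<and>
     (\<forall>x\<in>F. \<forall>y\<in>F. x + y \<in> F \<and> x * y \<in> F) \<and> (\<forall>x\<in>F. - x \<in> F \<and> inverse x \<in> F)"


subsection \<open>Symmetry\<close>

definition has_symmetry :: "laurent \<Rightarrow> bool" where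
  "has_symmetry p \<longleftrightarrow> (\<exists>\<epsilon>\<in>{-1, 1}. \<exists>c. \<forall>k.
     Poly_Mapping.lookup p (c - k) = \<epsilon> * Poly_Mapping.lookup p k)"

text \<open>\<open>sym_value p \<sigma>\<close> says that \<open>\<sigma>\<close> is a monomial \<open>\<epsilon> z^c\<close> with \<open>p(z) / p(1/z) = \<sigma>(z)\<close>, with the
  denominator cleared. For \<open>p \<noteq> 0\<close> it determines \<open>\<sigma>\<close>; for \<open>p = 0\<close> every \<open>\<epsilon> z^c\<close> is admissible,
  which is the convention for the symmetry of the zero polynomial.\<close>

definition sym_value :: "laurent \<Rightarrow> laurent \<Rightarrow> bool" where
  "sym_value p \<sigma> \<longleftrightarrow>
     (\<exists>\<epsilon>\<in>{-1, 1}. \<exists>c. \<sigma> = Poly_Mapping.single c \<epsilon>) \<and> p = \<sigma> * laurent_reflect p"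

definition mat_sym_value :: "laurent mat \<Rightarrow> laurent mat \<Rightarrow> bool" where
  "mat_sym_value P S \<longleftrightarrow> S \<in> carrier_mat (dim_row P) (dim_col P) \<and>
     (\<forall>i<dim_row P. \<forall>j<dim_col P. sym_value (P $$ (i,j)) (S $$ (i,j)))"

text \<open>\<open>\<theta>\<close> is a row vector of Laurent polynomials with symmetry and \<open>T\<close> is (a value of) its
  symmetry row.\<close>

definition sym_row :: "nat \<Rightarrow> laurent mat \<Rightarrow> laurent mat \<Rightarrow> bool" where
  "sym_row n \<theta> T \<longleftrightarrow> \<theta> \<in> carrier_mat 1 n \<and> (\<forall>j<n. has_symmetry (\<theta> $$ (0,j))) \<and>
     mat_sym_value \<theta> T"

definition compatible_via ::
    "laurent mat \<Rightarrow> laurent mat \<Rightarrow> laurent mat \<Rightarrow> laurent mat \<Rightarrow> laurent mat \<Rightarrow> bool" where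
  "compatible_via P \<theta>\<^sub>1 T\<^sub>1 \<theta>\<^sub>2 T\<^sub>2 \<longleftrightarrow>
     sym_row (dim_row P) \<theta>\<^sub>1 T\<^sub>1 \<and> sym_row (dim_col P) \<theta>\<^sub>2 T\<^sub>2 \<and>
     mat_sym_value P (mat_adj T\<^sub>1 * T\<^sub>2)"

text \<open>Mutual compatibility of a pair of matrices, in terms of the values \<open>S\<close> and \<open>S'\<close> taken by
  their symmetries.\<close>

definition mutually_compatible :: "laurent mat \<Rightarrow> laurent mat \<Rightarrow> bool" where
  "mutually_compatible S S' \<longleftrightarrow> (\<exists>\<theta>\<^sub>1 T\<^sub>1 \<theta> T \<theta>\<^sub>2 T\<^sub>2.
     sym_row (dim_row S) \<theta>\<^sub>1 T\<^sub>1 \<and> sym_row (dim_col S) \<theta> T \<and> sym_row (dim_col S') \<theta>\<^sub>2 T\<^sub>2 \<and>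
     S = mat_adj T\<^sub>1 * T \<and> S' = mat_adj T * T\<^sub>2)"

text \<open>The value of the symmetry of a factor \<open>P j\<close> is chosen once, and this one value is used both
  with \<open>P (j + 1)\<close> and with \<open>P (j - 1)\<close>. For factors without zero entries there is no choice. If
  the symmetry of a zero entry could be chosen anew for each pair, then a product of factors with
  pairwise mutually compatible symmetry need not have compatible symmetry: an identity block is
  pairwise mutually compatible with every compatible block to its left and to its right.\<close>

definition mutually_compatible_upto :: "nat \<Rightarrow> (nat \<Rightarrow> laurent mat) \<Rightarrow> bool" where
  "mutually_compatible_upto J P \<longleftrightarrow> (\<exists>S.
     (\<forall>j\<le>J + 1. mat_sym_value (P j) (S j)) \<and>
     (\<forall>j\<le>J. mutually_compatible (S (j + 1)) (S j)))"


subsection \<open>Coefficient support\<close>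

definition coeffsupp :: "laurent mat \<Rightarrow> int set" where
  "coeffsupp P =
     (let K = {k. map_mat (\<lambda>p. Poly_Mapping.lookup p k) P \<noteq> 0\<^sub>m (dim_row P) (dim_col P)}
      in if K = {} then {} else {Min K..Max K})"

definition supp_length :: "int set \<Rightarrow> ereal" where
  "supp_length I = (if I = {} then - \<infinity> else ereal (real_of_int (Max I - Min I)))"

definition entry_supp_length :: "laurent mat \<Rightarrow> nat \<Rightarrow> nat \<Rightarrow> ereal" where
  "entry_supp_length P m n = supp_length (coeffsupp (mat 1 1 (\<lambda>_. P $$ (m,n))))"

definition ereal_ceiling :: "ereal \<Rightarrow> ereal" where
  "ereal_ceiling x = (case x of ereal y \<Rightarrow> ereal (real_of_int \<lceil>y\<rceil>) | _ \<Rightarrow> x)"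


subsection \<open>The matrix regrouping a symmetry row\<close>

text \<open>The row \<open>[1, \<dots>, 1, -1, \<dots>, -1, 1/z, \<dots>, 1/z, -1/z, \<dots>, -1/z]\<close>.\<close>

definition grouped_row :: "nat \<Rightarrow> nat \<Rightarrow> nat \<Rightarrow> nat \<Rightarrow> laurent mat" where
  "grouped_row n\<^sub>1 n\<^sub>2 n\<^sub>3 n\<^sub>4 = mat 1 (n\<^sub>1 + n\<^sub>2 + n\<^sub>3 + n\<^sub>4) (\<lambda>(_,j).
     if j < n\<^sub>1 then 1
     else if j < n\<^sub>1 + n\<^sub>2 then - 1
     else if j < n\<^sub>1 + n\<^sub>2 + n\<^sub>3 then Poly_Mapping.single (- 1) 1
     else Poly_Mapping.single (- 1) (- 1))"

definition permutation_matrix :: "nat \<Rightarrow> laurent mat \<Rightarrow> bool" where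
  "permutation_matrix n E \<longleftrightarrow> (\<exists>\<pi>. \<pi> permutes {..<n} \<and>
     E = mat n n (\<lambda>(i,j). if i = \<pi> j then 1 else 0))"

text \<open>Multiplying an entry with symmetry \<open>\<epsilon> z^c\<close> by \<open>z^(-d)\<close> changes its symmetry to
  \<open>\<epsilon> z^(c - 2 d)\<close>, and here \<open>d = \<lceil>c/2\<rceil>\<close>.\<close>

definition regroups :: "laurent mat \<Rightarrow> laurent mat \<Rightarrow> bool" where
  "regroups T U \<longleftrightarrow> (\<exists>\<epsilon> c E n\<^sub>1 n\<^sub>2 n\<^sub>3 n\<^sub>4. let n = dim_col T; d = (\<lambda>j. \<lceil>real_of_int (c j) / 2\<rceil>) in
     (\<forall>j<n. \<epsilon> j \<in> {-1, 1}) \<and>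
     T = mat 1 n (\<lambda>(_,j). Poly_Mapping.single (c j) (\<epsilon> j)) \<and>
     permutation_matrix n E \<and>
     U = mat_diag n (\<lambda>j. Poly_Mapping.single (- d j) 1) * E \<and>
     mat 1 n (\<lambda>(_,j). Poly_Mapping.single (c j - 2 * d j) (\<epsilon> j)) * E = grouped_row n\<^sub>1 n\<^sub>2 n\<^sub>3 n\<^sub>4)"

definition regrouping_matrix :: "laurent mat \<Rightarrow> laurent mat" where
  "regrouping_matrix T = (SOME U. regroups T U)"


subsection \<open>Factorizations\<close>

text \<open>\<open>mat_chain P n\<close> is \<open>P n * \<dots> * P 1 * P 0\<close>.\<close>

primrec mat_chain :: "(nat \<Rightarrow> laurent mat) \<Rightarrow> nat \<Rightarrow> laurent mat" where
  "mat_chain P 0 = P 0"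
| "mat_chain P (Suc n) = P (Suc n) * mat_chain P n"

definition elementary :: "laurent mat \<Rightarrow> bool" where
  "elementary A \<longleftrightarrow> paraunitary A \<and> coeffsupp A \<subseteq> {-1..1}"

text \<open>The bound on \<open>J\<close> is the ceiling of half the largest support length of an entry, except that
  one elementary factor is allowed when this number is zero, that is, when every entry of \<open>P\<close> is a
  monomial or zero. Without an elementary factor the product only produces generalized permutation
  matrices with entries \<open>z^k\<close>, so neither the constant matrix \<open>[-1]\<close> nor \<open>[3/5, 4/5]\<close> would
  factor.\<close>

definition symmetric_factorization ::
    "complex set \<Rightarrow> nat \<Rightarrow> nat \<Rightarrow> laurent mat \<Rightarrow> laurent mat \<Rightarrow> laurent mat \<Rightarrow> bool" where
  "symmetric_factorization F r s P T\<^sub>1 T\<^sub>2 \<longleftrightarrow> (\<exists>J Q.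
     (\<forall>j\<le>J + 1. Q j \<in> carrier_mat s s \<and> coeffs_in F (Q j)) \<and>
     P = mat r s (\<lambda>(i,j). if i = j then 1 else 0) * mat_chain Q (J + 1) \<and>
     (\<forall>j. 1 \<le> j \<and> j \<le> J \<longrightarrow> elementary (Q j)) \<and>
     mutually_compatible_upto J Q \<and>
     Q 0 = mat_adj (regrouping_matrix T\<^sub>2) \<and>
     Q (J + 1) = diag_block_mat [regrouping_matrix T\<^sub>1, 1\<^sub>m (s - r)] \<and>
     ereal (real J) \<le>
       max 1 (MAX (m,n)\<in>{..<r} \<times> {..<s}. ereal_ceiling (entry_supp_length P m n / 2)))"

end

theory Submission
  imports Defs "HOL-Library.Function_Algebras" "HOL-Computational_Algebra.Polynomial"
begin

text \<open>
  Regrouping reduces the problem to symmetry rows with entries \<open>\<plusminus>1\<close> and \<open>\<plusminus>1/z\<close>. Put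
  \<open>(\<sigma> v)\<^sub>j(z) = \<epsilon>\<^sub>j z\<^bsup>-t\<^sub>j\<^esup> v\<^sub>j(1/z)\<close> on row vectors, where \<open>\<epsilon>\<^sub>j z\<^bsup>-t\<^sub>j\<^esup>\<close> are the symmetries of the
  columns and \<open>t\<^sub>j \<in> {0, 1}\<close>. An orthonormal basis with symmetry is the same thing as a
  \<open>1/z\<close>-invariant lattice \<open>L\<close> with \<open>L \<bottom> z \<sigma> L\<close> and \<open>(\<sigma> L)\<^sup>\<bottom> \<subseteq> L\<close>: the basis vectors are eigenvectors of \<open>\<sigma>\<close>
  in \<open>L \<inter> \<sigma> L\<close> and of \<open>z \<sigma>\<close> in \<open>L\<^sup>\<bottom> \<inter> z \<sigma> L\<^sup>\<bottom>\<close>. The standard basis belongs to the lattice \<open>L\<^sub>0\<close> of vectors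
  supported on exponents \<open>k \<le> -t\<^sub>j\<close>, and the change of basis is elementary as soon as
  \<open>L\<^sub>0 / z \<subseteq> L \<subseteq> z L\<^sub>0\<close>.

  Let \<open>v\<^sub>i\<close> be the rows of the given matrix, shifted so that \<open>\<sigma> v\<^sub>i = \<plusminus>z\<^bsup>d\<^sub>i\<^esup> v\<^sub>i\<close> with \<open>d\<^sub>i \<in> {0, 1}\<close> and
  of extent \<open>K \<ge> 1\<close>. The lattice
  \<open>L = {y \<in> L\<^sub>0 + span {z\<^bsup>1-K\<^esup> v\<^sub>i} | y \<bottom> z\<^sup>n v\<^sub>i for all n \<ge> K}\<close> has all these properties, contains
  \<open>z\<^bsup>1-K\<^esup> v\<^sub>i\<close> and is orthogonal to \<open>z\<^sup>K v\<^sub>i\<close>, so in its basis the rows have extent \<open>K - 1\<close>. After \<open>K\<close>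
  such steps the rows are constant and are completed to a constant unitary matrix, which is absorbed
  into the last elementary factor.
\<close>

section \<open>Laurent polynomials\<close>

text \<open>A row with symmetry cannot be shortened at one end only, so each factor has to remove
  the top and the bottom of all rows at once. The conditions on the lattice read \<open>(\<sigma>
  L)\<^sup>\<bottom> \<subseteq> L \<subseteq> (z \<sigma> L)\<^sup>\<bottom>\<close>. With
  \<open>W\<^sub>0 = L \<inter> \<sigma> L\<close> and \<open>W\<^sub>1 = L\<^sup>\<bottom> \<inter>
  z \<sigma> L\<^sup>\<bottom>\<close> they make the whole space the orthogonal sum of all
  \<open>z\<^sup>n W\<^sub>0\<close> and \<open>z\<^sup>n W\<^sub>1\<close>, of which
  \<open>L\<close> collects \<open>n \<le> 0\<close> in the first family and \<open>n < 0\<close> in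
  the second. The lattice of the rows imitates the standard way of making a Lagrangian subspace
  contain a given isotropic one: enlarge it, then keep what is orthogonal to the mirror image of the
  added vectors. Containing the lowered rows cuts their top, orthogonality to the raised rows cuts
  their bottom. All spaces are linear over the field only and in general infinite-dimensional; the
  inclusions between \<open>L\<^sub>0 / z\<close> and \<open>z L\<^sub>0\<close> leave finitely many
  positions open, which is why orthogonal projections exist.\<close>

abbreviation coef :: "laurent \<Rightarrow> int \<Rightarrow> complex" where
  "coef \<equiv> Poly_Mapping.lookup"

abbreviation mon :: "int \<Rightarrow> complex \<Rightarrow> laurent" where
  "mon \<equiv> Poly_Mapping.single"

text \<open>A Laurent polynomial is the sum of its monomials, so additive maps need to be compared
  on monomials only. The product formulas and the sums over supports below are all obtained this
  way.\<close>

lemma laurent_additive_eqI: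
  fixes f g :: "laurent \<Rightarrow> 'a::comm_monoid_add"
  assumes f: "f 0 = 0" "\<And>p q. f (p + q) = f p + f q"
    and g: "g 0 = 0" "\<And>p q. g (p + q) = g p + g q"
    and eq: "\<And>k a. f (mon k a) = g (mon k a)"
  shows "f p = g p"
proof -
  have p: "p = (\<Sum>k\<in>Poly_Mapping.keys p. mon k (coef p k))"
    by (rule poly_mapping_eqI) (simp add: lookup_sum lookup_single when_def in_keys_iff)
  have "f (\<Sum>k\<in>A. h k) = g (\<Sum>k\<in>A. h k)"
    if "finite A" "\<And>k. k \<in> A \<Longrightarrow> f (h k) = g (h k)" for A :: "int set" and h
    using that by (induction A rule: finite_induct) (simp_all add: f g)
  from this[OF finite_keys[of p], of "\<lambda>k. mon k (coef p k)"] show ?thesis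
    unfolding p[symmetric] by (simp add: eq)
qed

section \<open>Adjoint and reflection as involutive ring homomorphisms\<close>

lemma coef_adj [simp]: "coef (laurent_adj p) k = cnj (coef p (- k))"
proof -
  have "(\<Sum>x\<in>Poly_Mapping.keys p. coef (mon (- x) (cnj (coef p x))) k)
      = (\<Sum>x\<in>Poly_Mapping.keys p. if x = - k then cnj (coef p x) else 0)"
    by (rule sum.cong) (auto simp: lookup_single when_def)
  then show ?thesis
    by (simp add: laurent_adj_def lookup_sum in_keys_iff)
qed

lemma coef_reflect [simp]: "coef (laurent_reflect p) k = coef p (- k)"
proof -
  have "(\<Sum>x\<in>Poly_Mapping.keys p. coef (mon (- x) (coef p x)) k)
      = (\<Sum>x\<in>Poly_Mapping.keys p. if x = - k then coef p x else 0)"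
    by (rule sum.cong) (auto simp: lookup_single when_def)
  then show ?thesis
    by (simp add: laurent_reflect_def lookup_sum in_keys_iff)
qed

lemma adj_add [simp]: "laurent_adj (p + q) = laurent_adj p + laurent_adj q"
  and adj_zero [simp]: "laurent_adj 0 = 0"
  and adj_single [simp]: "laurent_adj (mon k a) = mon (- k) (cnj a)"
  and adj_adj [simp]: "laurent_adj (laurent_adj p) = p"
  and adj_diff [simp]: "laurent_adj (p - q) = laurent_adj p - laurent_adj q"
  and adj_reflect: "laurent_adj (laurent_reflect p) = laurent_reflect (laurent_adj p)"
  by (rule poly_mapping_eqI; auto simp: lookup_add lookup_minus lookup_single when_def)+

lemma reflect_add [simp]: "laurent_reflect (p + q) = laurent_reflect p + laurent_reflect q"
  and reflect_zero [simp]: "laurent_reflect 0 = 0"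
  and reflect_single [simp]: "laurent_reflect (mon k a) = mon (- k) a"
  and reflect_reflect [simp]: "laurent_reflect (laurent_reflect p) = p"
  by (rule poly_mapping_eqI; auto simp: lookup_add lookup_single when_def)+

lemma reflect_diff [simp]: "laurent_reflect (p - q) = laurent_reflect p - laurent_reflect q"
  by (rule poly_mapping_eqI) (simp add: lookup_minus)

lemma adj_one [simp]: "laurent_adj 1 = 1"
  and reflect_one [simp]: "laurent_reflect 1 = 1"
  by (simp_all flip: single_one)

text \<open>Additivity in each of the two factors reduces multiplicativity to products of two
  monomials. Adjoint, reflection and evaluation at a nonzero point are the instances.\<close>

lemma laurent_mult_hom:
  fixes f :: "laurent \<Rightarrow> 'a::semiring_0"
  assumes f: "f 0 = 0" "\<And>p q. f (p + q) = f p + f q"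
    and m: "\<And>j k a b. f (mon j a * mon k b) = f (mon j a) * f (mon k b)"
  shows "f (p * q) = f p * f q"
proof (rule laurent_additive_eqI[where f = "\<lambda>p. f (p * q)"])
  show "f (mon k a * q) = f (mon k a) * f q" for k a
    by (rule laurent_additive_eqI[where f = "\<lambda>q. f (mon k a * q)"]) (simp_all add: f m distrib_left)
qed (simp_all add: f distrib_right)

lemma adj_mult [simp]: "laurent_adj (p * q) = laurent_adj p * laurent_adj q"
  by (rule laurent_mult_hom) (simp_all add: mult_single)

lemma reflect_mult [simp]: "laurent_reflect (p * q) = laurent_reflect p * laurent_reflect q"
  by (rule laurent_mult_hom) (simp_all add: mult_single)

lemma adj_sum [simp]: "laurent_adj (sum f A) = (\<Sum>x\<in>A. laurent_adj (f x))"
  by (induction A rule: infinite_finite_induct) auto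

lemma reflect_sum [simp]: "laurent_reflect (sum f A) = (\<Sum>x\<in>A. laurent_reflect (f x))"
  by (induction A rule: infinite_finite_induct) auto

lemma coef_single_mult [simp]: "coef (mon n a * p) k = a * coef p (k - n)"
proof (rule laurent_additive_eqI[where f = "\<lambda>p. coef (mon n a * p) k"])
  show "coef (mon n a * mon j b) k = a * coef (mon j b) (k - n)" for j b
    by (auto simp: mult_single lookup_single when_def)
qed (simp_all add: lookup_add algebra_simps)

section \<open>Evaluation at nonzero complex numbers and its injectivity\<close>

lemma eval_single [simp]: "laurent_eval (mon k a) z = a * z powi k"
  by (simp add: laurent_eval_def)

lemma eval_zero [simp]: "laurent_eval 0 z = 0"
  by (simp add: laurent_eval_def)

lemma eval_add [simp]: "laurent_eval (p + q) z = laurent_eval p z + laurent_eval q z"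
  unfolding laurent_eval_def
  by (rule setsum_keys_plus_distrib[where f = "\<lambda>k a. a * z powi k"]) (simp_all add: distrib_right)

lemma eval_one [simp]: "laurent_eval 1 z = 1"
  using eval_single[of 0 1 z] by simp

lemma eval_mult [simp]:
  assumes "z \<noteq> 0"
  shows "laurent_eval (p * q) z = laurent_eval p z * laurent_eval q z"
  by (rule laurent_mult_hom[where f = "\<lambda>p. laurent_eval p z"])
    (simp_all add: mult_single power_int_add assms)

lemma eval_sum [simp]: "laurent_eval (sum f A) z = (\<Sum>x\<in>A. laurent_eval (f x) z)"
  by (induction A rule: infinite_finite_induct) auto

text \<open>Dividing by the lowest power \<open>z powi N\<close> gives an ordinary polynomial that
  vanishes at all nonzero complex numbers, hence has infinitely many roots and is zero.\<close>

lemma eval_eq_zero_imp: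
  assumes "\<And>z. z \<noteq> 0 \<Longrightarrow> laurent_eval p z = 0"
  shows "p = 0"
proof -
  define N where "N = (if Poly_Mapping.keys p = {} then 0 else Min (Poly_Mapping.keys p))"
  have N: "k \<ge> N" if "k \<in> Poly_Mapping.keys p" for k
    using that by (auto simp: N_def)
  define f where "f = (\<Sum>k\<in>Poly_Mapping.keys p. monom (coef p k) (nat (k - N)))"
  have "poly f z * z powi N = laurent_eval p z" if "z \<noteq> 0" for z
  proof -
    have "z ^ nat (k - N) * z powi N = z powi k" if "k \<in> Poly_Mapping.keys p" for k
      using N[OF that] \<open>z \<noteq> 0\<close> by (simp add: power_int_diff flip: power_int_of_nat)
    then show ?thesis
      unfolding f_def poly_sum laurent_eval_def sum_distrib_right
      by (intro sum.cong) (auto simp: poly_monom mult.assoc)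
  qed
  then have "- {0} \<subseteq> {z. poly f z = 0}"
    using assms by auto
  moreover have "infinite (- {0::complex})"
    by (simp add: finite_compl infinite_UNIV_char_0)
  ultimately have "f = 0"
    using poly_roots_finite finite_subset by blast
  have "coef p k = 0" for k
  proof (cases "k \<in> Poly_Mapping.keys p")
    case True
    have "coeff f (nat (k - N)) = (\<Sum>j\<in>Poly_Mapping.keys p. if j = k then coef p j else 0)"
      unfolding f_def coeff_sum using N True by (intro sum.cong) (auto simp: eq_nat_nat_iff)
    then show ?thesis
      using True \<open>f = 0\<close> by simp
  qed (simp add: in_keys_iff)
  then show ?thesis
    by (intro poly_mapping_eqI) simp
qed

lemma eval_eqI:
  assumes "\<And>z. z \<noteq> 0 \<Longrightarrow> laurent_eval p z = laurent_eval q z"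
  shows "p = q"
proof -
  have "laurent_eval (p - q) z = 0" if "z \<noteq> 0" for z
    using eval_add[of "p - q" q z] assms[OF that] by simp
  then show ?thesis
    using eval_eq_zero_imp[of "p - q"] by simp
qed


section \<open>Vectors of Laurent polynomials and orthonormal bases over the field\<close>

text \<open>As simp rules these rewrite sums and differences of vectors to abstractions.\<close>

declare plus_fun_apply [simp del] zero_fun_apply [simp del] minus_apply [simp del]

lemmas vec_apply = plus_fun_apply zero_fun_apply minus_apply

type_synonym lvec = "nat \<Rightarrow> laurent"

definition lmul :: "laurent \<Rightarrow> lvec \<Rightarrow> lvec" where
  "lmul p v = (\<lambda>j. p * v j)"

abbreviation scl :: "complex \<Rightarrow> lvec \<Rightarrow> lvec" where
  "scl a \<equiv> lmul (mon 0 a)"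

abbreviation sh :: "int \<Rightarrow> lvec \<Rightarrow> lvec" where
  "sh n \<equiv> lmul (mon n 1)"

lemma sum_fun_apply: "(sum f A :: 'a \<Rightarrow> 'b::comm_monoid_add) x = (\<Sum>a\<in>A. f a x)"
  by (induction A rule: infinite_finite_induct) (auto simp: vec_apply)

lemma lmul_apply: "lmul p v j = p * v j"
  by (simp add: lmul_def)

lemma lmul_lmul [simp]: "lmul p (lmul q v) = lmul (p * q) v"
  by (simp add: lmul_def mult.assoc)

lemma lmul_one [simp]: "lmul 1 v = v"
  by (simp add: lmul_def)

lemma lmul_zero [simp]: "lmul p 0 = 0" "lmul 0 v = 0"
  by (auto simp: lmul_def vec_apply)

lemma lmul_add: "lmul p (v + w) = lmul p v + lmul p w"
  and lmul_diff: "lmul p (v - w) = lmul p v - lmul p w"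
  by (auto simp: lmul_def vec_apply algebra_simps)

lemma lmul_sum: "lmul p (sum f A) = (\<Sum>x\<in>A. lmul p (f x))"
  by (rule ext) (simp add: lmul_def sum_distrib_left sum_fun_apply)

text \<open>The source of positivity: the constant coefficient of \<open>p * laurent_adj q\<close>
  is the standard Hermitian product of the two coefficient sequences.\<close>

lemma coef_mult_adj: "coef (p * laurent_adj q) 0 = (\<Sum>k\<in>Poly_Mapping.keys p. coef p k * cnj (coef q k))"
proof (rule laurent_additive_eqI[where f = "\<lambda>p. coef (p * laurent_adj q) 0"])
  fix p p' :: laurent
  show "(\<Sum>k\<in>Poly_Mapping.keys (p + p'). coef (p + p') k * cnj (coef q k)) =
     (\<Sum>k\<in>Poly_Mapping.keys p. coef p k * cnj (coef q k)) +
     (\<Sum>k\<in>Poly_Mapping.keys p'. coef p' k * cnj (coef q k))"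
    by (rule setsum_keys_plus_distrib[where f = "\<lambda>k a. a * cnj (coef q k)"])
      (simp_all add: distrib_right)
qed (auto simp: distrib_right lookup_add)

lemma coef_mult: "coef (p * q) n = (\<Sum>k\<in>Poly_Mapping.keys p. coef p k * coef q (n - k))"
proof (rule laurent_additive_eqI[where f = "\<lambda>p. coef (p * q) n"
      and g = "\<lambda>p. \<Sum>k\<in>Poly_Mapping.keys p. coef p k * coef q (n - k)"])
  fix p p' :: laurent
  show "(\<Sum>k\<in>Poly_Mapping.keys (p + p'). coef (p + p') k * coef q (n - k)) =
     (\<Sum>k\<in>Poly_Mapping.keys p. coef p k * coef q (n - k)) +
     (\<Sum>k\<in>Poly_Mapping.keys p'. coef p' k * coef q (n - k))"
    by (rule setsum_keys_plus_distrib[where f = "\<lambda>k a. a * coef q (n - k)"])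
      (simp_all add: distrib_right)
qed (simp_all add: distrib_right lookup_add)

section \<open>Coefficients in the field\<close>

locale conj_sqrt_field =
  fixes F :: "complex set"
  assumes subfield: "complex_subfield F"
    and cnj_closed: "\<And>x. x \<in> F \<Longrightarrow> cnj x \<in> F"
    and sqrt_closed: "\<And>y :: real. y > 0 \<Longrightarrow> complex_of_real y \<in> F \<Longrightarrow> complex_of_real (sqrt y) \<in> F"
begin

lemma F_closed [simp, intro]:
  "0 \<in> F" "1 \<in> F" "x \<in> F \<Longrightarrow> y \<in> F \<Longrightarrow> x + y \<in> F" "x \<in> F \<Longrightarrow> y \<in> F \<Longrightarrow> x * y \<in> F"
  "x \<in> F \<Longrightarrow> - x \<in> F" "x \<in> F \<Longrightarrow> inverse x \<in> F" "x \<in> F \<Longrightarrow> cnj x \<in> F"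
  using subfield cnj_closed by (auto simp: complex_subfield_def)

lemma F_diff [simp, intro]: "x \<in> F \<Longrightarrow> y \<in> F \<Longrightarrow> x - y \<in> F"
  using F_closed(3)[of x "- y"] by simp

lemma F_divide [simp, intro]: "x \<in> F \<Longrightarrow> y \<in> F \<Longrightarrow> x / y \<in> F"
  by (simp add: divide_inverse)

lemma F_sum [intro]: "(\<And>x. x \<in> A \<Longrightarrow> f x \<in> F) \<Longrightarrow> sum f A \<in> F"
  by (induction A rule: infinite_finite_induct) auto

lemma F_half: "1 / 2 \<in> F"
  using F_closed(3)[of 1 1] by (intro F_divide) auto

definition FL :: "laurent set" where
  "FL = {p. \<forall>k. coef p k \<in> F}"

lemma FL_closed [simp, intro]:
  "0 \<in> FL" "1 \<in> FL"
  "p \<in> FL \<Longrightarrow> q \<in> FL \<Longrightarrow> p + q \<in> FL" "p \<in> FL \<Longrightarrow> q \<in> FL \<Longrightarrow> p - q \<in> FL"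
  "p \<in> FL \<Longrightarrow> laurent_adj p \<in> FL" "p \<in> FL \<Longrightarrow> laurent_reflect p \<in> FL"
  "a \<in> F \<Longrightarrow> mon k a \<in> FL" "p \<in> FL \<Longrightarrow> q \<in> FL \<Longrightarrow> p * q \<in> FL"
  by (auto simp: FL_def lookup_add lookup_minus lookup_single when_def lookup_one coef_mult)

lemma FL_sum [intro]: "(\<And>x. x \<in> A \<Longrightarrow> f x \<in> FL) \<Longrightarrow> sum f A \<in> FL"
  by (induction A rule: infinite_finite_induct) auto

end

locale laurent_space = conj_sqrt_field +
  fixes s :: nat
begin

definition vecs :: "lvec set" where
  "vecs = {v. (\<forall>j. v j \<in> FL) \<and> (\<forall>j\<ge>s. v j = 0)}"

lemma vecs_closed [simp, intro]:
  "0 \<in> vecs" "v \<in> vecs \<Longrightarrow> w \<in> vecs \<Longrightarrow> v + w \<in> vecs" "v \<in> vecs \<Longrightarrow> w \<in> vecs \<Longrightarrow> v - w \<in> vecs"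
  "p \<in> FL \<Longrightarrow> v \<in> vecs \<Longrightarrow> lmul p v \<in> vecs"
  by (auto simp: vecs_def lmul_def vec_apply)

lemma vecs_sum [intro]: "(\<And>x. x \<in> A \<Longrightarrow> f x \<in> vecs) \<Longrightarrow> sum f A \<in> vecs"
  by (induction A rule: infinite_finite_induct) auto

section \<open>The Laurent-valued Hermitian form and its constant coefficient\<close>

definition form :: "lvec \<Rightarrow> lvec \<Rightarrow> laurent" where
  "form v w = (\<Sum>j<s. v j * laurent_adj (w j))"

definition ip :: "lvec \<Rightarrow> lvec \<Rightarrow> complex" where
  "ip v w = coef (form v w) 0"

lemma form_simps [simp]:
  "form (v + v') w = form v w + form v' w" "form (v - v') w = form v w - form v' w"
  "form (lmul p v) w = p * form v w" "form 0 w = 0"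
  "form v (w + w') = form v w + form v w'" "form v (w - w') = form v w - form v w'"
  "form v (lmul p w) = laurent_adj p * form v w" "form v 0 = 0"
  by (simp_all add: form_def lmul_def vec_apply algebra_simps sum.distrib sum_subtractf sum_distrib_left)

lemma form_sum_left [simp]: "form (sum f A) w = (\<Sum>x\<in>A. form (f x) w)"
  by (induction A rule: infinite_finite_induct) auto

lemma form_sum_right [simp]: "form w (sum f A) = (\<Sum>x\<in>A. form w (f x))"
  by (induction A rule: infinite_finite_induct) auto

lemma form_commute: "form w v = laurent_adj (form v w)"
  by (simp add: form_def mult.commute)

lemma form_in_FL: "v \<in> vecs \<Longrightarrow> w \<in> vecs \<Longrightarrow> form v w \<in> FL"
  by (auto simp: form_def vecs_def)

lemma ip_simps [simp]:
  "ip (v + v') w = ip v w + ip v' w" "ip (v - v') w = ip v w - ip v' w"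
  "ip (scl a v) w = a * ip v w" "ip 0 w = 0"
  "ip v (w + w') = ip v w + ip v w'" "ip v (w - w') = ip v w - ip v w'"
  "ip v (scl a w) = cnj a * ip v w" "ip v 0 = 0"
  by (simp_all add: ip_def lookup_add lookup_minus)

lemma ip_sum_left [simp]: "ip (sum f A) w = (\<Sum>x\<in>A. ip (f x) w)"
  by (simp add: ip_def lookup_sum)

lemma ip_sum_right [simp]: "ip w (sum f A) = (\<Sum>x\<in>A. ip w (f x))"
  by (induction A rule: infinite_finite_induct) auto

lemma ip_commute: "ip w v = cnj (ip v w)"
  by (simp add: ip_def form_commute[of w v])

lemma ip_eq_zero_commute: "ip v w = 0 \<Longrightarrow> ip w v = 0"
  by (subst ip_commute) simp

lemma ip_sh_right: "ip v (sh n w) = coef (form v w) n"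
  by (simp add: ip_def)

lemma ip_sh_left: "ip (sh n v) w = ip v (sh (- n) w)"
  by (simp add: ip_def)

lemma ip_in_F: "v \<in> vecs \<Longrightarrow> w \<in> vecs \<Longrightarrow> ip v w \<in> F"
  using form_in_FL by (auto simp: ip_def FL_def)

lemma ip_eq: "ip v w = (\<Sum>j<s. \<Sum>k\<in>Poly_Mapping.keys (v j). coef (v j) k * cnj (coef (w j) k))"
  by (simp add: ip_def form_def lookup_sum coef_mult_adj)

lemma ip_disjoint: "(\<And>j k. coef (v j) k = 0 \<or> coef (w j) k = 0) \<Longrightarrow> ip v w = 0"
  unfolding ip_eq by (intro sum.neutral ballI) (metis complex_cnj_zero mult_eq_0_iff)

lemma ip_self: "ip v v = of_real (\<Sum>j<s. \<Sum>k\<in>Poly_Mapping.keys (v j). (cmod (coef (v j) k))\<^sup>2)"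
  unfolding ip_eq by (simp only: complex_norm_square of_real_sum)

lemma ip_self_eq_zeroD:
  assumes "ip v v = 0" "v \<in> vecs"
  shows "v = 0"
proof -
  have "complex_of_real (\<Sum>j<s. \<Sum>k\<in>Poly_Mapping.keys (v j). (cmod (coef (v j) k))\<^sup>2) = 0"
    using assms(1) unfolding ip_self .
  then have *: "(\<Sum>j<s. \<Sum>k\<in>Poly_Mapping.keys (v j). (cmod (coef (v j) k))\<^sup>2) = 0"
    by (simp only: of_real_eq_0_iff)
  have "v j = 0" if "j < s" for j
  proof -
    have "\<forall>j\<in>{..<s}. (\<Sum>k\<in>Poly_Mapping.keys (v j). (cmod (coef (v j) k))\<^sup>2) = 0"
      using * by (subst (asm) sum_nonneg_eq_0_iff) (auto intro: sum_nonneg)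
    with that have "(\<Sum>k\<in>Poly_Mapping.keys (v j). (cmod (coef (v j) k))\<^sup>2) = 0"
      by simp
    then have "\<forall>k\<in>Poly_Mapping.keys (v j). coef (v j) k = 0"
      by (subst (asm) sum_nonneg_eq_0_iff) auto
    then show ?thesis
      by (intro poly_mapping_eqI) (auto simp: in_keys_iff)
  qed
  then show ?thesis
    using assms(2) by (auto simp: vecs_def fun_eq_iff zero_fun_apply not_less[symmetric])
qed

text \<open>Linearity over \<open>F\<close> only: lattices, their complements and eigenspaces need
  not be closed under multiplication by \<open>z\<close>.\<close>

definition subsp :: "lvec set \<Rightarrow> bool" where
  "subsp S \<longleftrightarrow> S \<subseteq> vecs \<and> 0 \<in> S \<and> (\<forall>v\<in>S. \<forall>w\<in>S. v + w \<in> S) \<and> (\<forall>a\<in>F. \<forall>v\<in>S. scl a v \<in> S)"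

lemma subspD:
  assumes "subsp S"
  shows "v \<in> S \<Longrightarrow> v \<in> vecs" "0 \<in> S" "v \<in> S \<Longrightarrow> w \<in> S \<Longrightarrow> v + w \<in> S"
    "a \<in> F \<Longrightarrow> v \<in> S \<Longrightarrow> scl a v \<in> S"
  using assms by (auto simp: subsp_def)

lemma subsp_diff:
  assumes "subsp S" "v \<in> S" "w \<in> S"
  shows "v - w \<in> S"
proof -
  have "v - w = v + scl (- 1) w"
    by (simp add: fun_eq_iff lmul_def single_uminus vec_apply)
  moreover have "scl (- 1) w \<in> S"
    using assms by (simp add: subspD)
  ultimately show ?thesis
    using assms by (simp only: subspD(3))
qed

lemma subsp_sum: "subsp S \<Longrightarrow> (\<And>x. x \<in> A \<Longrightarrow> f x \<in> S) \<Longrightarrow> sum f A \<in> S"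
  by (induction A rule: infinite_finite_induct) (auto simp: subsp_def)

section \<open>Gram-Schmidt and projections for spaces of bounded support\<close>

definition orthonormal :: "lvec set \<Rightarrow> bool" where
  "orthonormal B \<longleftrightarrow> (\<forall>b\<in>B. \<forall>c\<in>B. ip b c = (if b = c then 1 else 0))"

lemma orthonormal_expand:
  assumes "orthonormal B" "finite B" "b \<in> B"
  shows "ip (\<Sum>c\<in>B. scl (f c) c) b = f b"
proof -
  have "(\<Sum>c\<in>B. f c * ip c b) = (\<Sum>c\<in>B. if c = b then f b else 0)"
    using assms by (intro sum.cong) (auto simp: orthonormal_def)
  then show ?thesis
    using assms by simp
qed

text \<open>The place where closure under square roots enters: \<open>ip v v\<close> is a positive
  real number in \<open>F\<close>, and the inverse of its root is the scaling factor.\<close>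

lemma normalize:
  assumes "v \<in> vecs" "v \<noteq> 0"
  obtains c where "c \<in> F" "c \<noteq> 0" "ip (scl c v) (scl c v) = 1"
proof -
  define y where "y = (\<Sum>j<s. \<Sum>k\<in>Poly_Mapping.keys (v j). (cmod (coef (v j) k))\<^sup>2)"
  have y: "ip v v = of_real y"
    unfolding y_def by (rule ip_self)
  have "y \<noteq> 0"
    using assms y ip_self_eq_zeroD by auto
  moreover have "y \<ge> 0"
    unfolding y_def by (intro sum_nonneg) auto
  ultimately have "y > 0"
    by simp
  have "complex_of_real y \<in> F"
    using ip_in_F[OF assms(1) assms(1)] y by simp
  then have "inverse (complex_of_real (sqrt y)) \<in> F"
    using sqrt_closed \<open>y > 0\<close> by blast
  moreover have "ip (scl (inverse (of_real (sqrt y))) v) (scl (inverse (of_real (sqrt y))) v) = 1"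
    using \<open>y > 0\<close> by (simp add: y field_simps flip: of_real_mult)
  ultimately show ?thesis
    using \<open>y > 0\<close> that by auto
qed

text \<open>Gram-Schmidt, with the finite set \<open>X\<close> of admissible positions in the role
  of a dimension: requiring the coefficient at one position to vanish costs at most one dimension,
  and one normalized vector makes up for it.\<close>

lemma orthonormal_basis:
  assumes "finite X" "subsp S" "\<And>v j k. v \<in> S \<Longrightarrow> coef (v j) k \<noteq> 0 \<Longrightarrow> (j, k) \<in> X"
  shows "\<exists>B. finite B \<and> B \<subseteq> S \<and> orthonormal B \<and> (\<forall>v\<in>S. v = (\<Sum>b\<in>B. scl (ip v b) b))"
  using assms
proof (induction X arbitrary: S rule: finite_induct)
  case empty
  then have "v = 0" if "v \<in> S" for v
    using that by (fastforce simp: fun_eq_iff zero_fun_apply intro: poly_mapping_eqI)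
  then show ?case
    by (intro exI[of _ "{}"]) (auto simp: orthonormal_def)
next
  case (insert x X)
  obtain j k where x: "x = (j, k)"
    by force
  define S0 where "S0 = {v\<in>S. coef (v j) k = 0}"
  have "subsp S0"
    using insert.prems(1) by (auto simp: S0_def subsp_def lookup_add lmul_def vec_apply)
  moreover have "(j', k') \<in> X" if "v \<in> S0" "coef (v j') k' \<noteq> 0" for v j' k'
    using insert.prems(2)[of v j' k'] that x by (auto simp: S0_def)
  ultimately obtain B where B: "finite B" "B \<subseteq> S0" "orthonormal B"
    "\<And>v. v \<in> S0 \<Longrightarrow> v = (\<Sum>b\<in>B. scl (ip v b) b)"
    using insert.IH[of S0] by blast
  show ?case
  proof (cases "S \<subseteq> S0")
    case True
    then show ?thesis
      using B unfolding S0_def by blast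
  next
    case False
    then obtain w where w: "w \<in> S" "coef (w j) k \<noteq> 0"
      by (auto simp: S0_def)
    have BS: "b \<in> S" "b \<in> vecs" "coef (b j) k = 0" if "b \<in> B" for b
      using that B(2) insert.prems(1) by (auto simp: S0_def subsp_def)
    have "w \<in> vecs"
      using w insert.prems(1) by (simp add: subspD)
    \<comment> \<open>The members of \<open>B\<close> vanish at \<open>(j, k)\<close>, so removing
      the \<open>B\<close>-component of \<open>w\<close> leaves its coefficient there unchanged and
      \<open>u\<close> is nonzero.\<close>
    define u where "u = w - (\<Sum>b\<in>B. scl (ip w b) b)"
    have "u \<in> S"
      unfolding u_def using insert.prems(1) w(1) BS \<open>w \<in> vecs\<close>
      by (intro subsp_diff subsp_sum) (auto simp: subspD ip_in_F)
    have u0: "coef (u j) k \<noteq> 0"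
      using w(2) BS(3) by (simp add: u_def lookup_minus lookup_sum lmul_apply sum_fun_apply vec_apply)
    have uB: "ip u b = 0" if "b \<in> B" for b
      using orthonormal_expand[OF B(3,1) that] by (simp add: u_def)
    obtain c where c: "c \<in> F" "c \<noteq> 0" "ip (scl c u) (scl c u) = 1"
      using normalize[of u] \<open>u \<in> S\<close> insert.prems(1) u0 by (metis lookup_zero subspD(1) zero_fun_apply)
    define d where "d = scl c u"
    have d: "d \<in> S" "coef (d j) k \<noteq> 0" "ip d d = 1"
      using c \<open>u \<in> S\<close> u0 insert.prems(1) by (auto simp: d_def subspD lmul_apply)
    have dB: "ip d b = 0" "ip b d = 0" if "b \<in> B" for b
      using uB[OF that] ip_eq_zero_commute by (auto simp: d_def)
    have "d \<notin> B"
      using d(3) dB by force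
    have "v = (\<Sum>b\<in>insert d B. scl (ip v b) b)" if "v \<in> S" for v
    proof -
      \<comment> \<open>Chosen so that \<open>v - scl a d\<close> vanishes at \<open>(j, k)\<close>
        and falls under the induction hypothesis; orthogonality then identifies \<open>a\<close>
        with \<open>ip v d\<close>.\<close>
      define a where "a = coef (v j) k / coef (d j) k"
      have "a \<in> F"
        using that d(1) insert.prems(1) by (auto simp: a_def subsp_def vecs_def FL_def)
      have "v - scl a d \<in> S0"
        using d that \<open>a \<in> F\<close> insert.prems(1)
        by (auto simp: S0_def a_def lookup_minus lmul_apply vec_apply intro!: subsp_diff subspD)
      then have *: "v - scl a d = (\<Sum>b\<in>B. scl (ip (v - scl a d) b) b)"
        by (rule B(4))
      also have "\<dots> = (\<Sum>b\<in>B. scl (ip v b) b)"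
        by (intro sum.cong) (auto simp: dB)
      finally have eq: "v = scl a d + (\<Sum>b\<in>B. scl (ip v b) b)"
        by (simp add: algebra_simps)
      have "ip v d = ip (scl a d + (\<Sum>b\<in>B. scl (ip v b) b)) d"
        using eq by simp
      also have "\<dots> = a"
        using d(3) dB by simp
      finally show ?thesis
        using eq B(1) \<open>d \<notin> B\<close> by simp
    qed
    moreover have "orthonormal (insert d B)"
      using B(3) d dB by (auto simp: orthonormal_def)
    moreover have "finite (insert d B)" "insert d B \<subseteq> S"
      using B(1) BS(1) d(1) by auto
    ultimately show ?thesis
      by blast
  qed
qed

lemma orthogonal_projection:
  assumes "finite X" "subsp S" "\<And>v j k. v \<in> S \<Longrightarrow> coef (v j) k \<noteq> 0 \<Longrightarrow> (j, k) \<in> X" "v \<in> vecs"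
  obtains p where "p \<in> S" "\<And>w. w \<in> S \<Longrightarrow> ip (v - p) w = 0"
proof -
  obtain B where B: "finite B" "B \<subseteq> S" "orthonormal B" "\<forall>v\<in>S. v = (\<Sum>b\<in>B. scl (ip v b) b)"
  proof -
    have "\<exists>B. finite B \<and> B \<subseteq> S \<and> orthonormal B \<and> (\<forall>v\<in>S. v = (\<Sum>b\<in>B. scl (ip v b) b))"
      by (rule orthonormal_basis[OF assms(1,2)]) (rule assms(3))
    then show ?thesis
      using that by (elim exE conjE)
  qed
  define p where "p = (\<Sum>b\<in>B. scl (ip v b) b)"
  have BS: "b \<in> S" "b \<in> vecs" if "b \<in> B" for b
    using that B(2) assms(2) by (auto simp: subsp_def)
  have "p \<in> S"
    unfolding p_def
  proof (rule subsp_sum[OF assms(2)])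
    show "scl (ip v b) b \<in> S" if "b \<in> B" for b
      using BS[OF that] ip_in_F[OF assms(4)] assms(2) by (intro subspD(4))
  qed
  moreover have pB: "ip (v - p) b = 0" if "b \<in> B" for b
    using orthonormal_expand[OF B(3,1) that] by (simp add: p_def)
  have "ip (v - p) w = 0" if "w \<in> S" for w
  proof -
    have "ip (v - p) w = ip (v - p) (\<Sum>b\<in>B. scl (ip w b) b)"
      using bspec[OF B(4) that] by (rule arg_cong)
    also have "\<dots> = (\<Sum>b\<in>B. cnj (ip w b) * ip (v - p) b)"
      by (simp del: ip_simps(2))
    also have "\<dots> = 0"
      by (simp add: pB del: ip_simps(2))
    finally show ?thesis .
  qed
  ultimately show ?thesis
    using that by blast
qed

end


section \<open>Symmetric lattices\<close>

context laurent_space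
begin

section \<open>Coordinate vectors and orthonormal bases over the Laurent ring\<close>

definition unit_vec_at :: "nat \<Rightarrow> int \<Rightarrow> lvec" where
  "unit_vec_at j k = (\<lambda>i. if i = j then mon k 1 else 0)"

lemma vecs_coef: "v \<in> vecs \<Longrightarrow> coef (v j) k \<noteq> 0 \<Longrightarrow> j < s"
  by (cases "j < s") (auto simp: vecs_def)

lemma unit_vec_at_vecs [simp]: "j < s \<Longrightarrow> unit_vec_at j k \<in> vecs"
  by (auto simp: unit_vec_at_def vecs_def)

lemma coef_unit_vec_at: "coef (unit_vec_at j k i) m = (if i = j \<and> m = k then 1 else 0)"
  by (simp add: unit_vec_at_def lookup_single when_def)

lemma form_unit_vec_at:
  assumes "j < s"
  shows "form (unit_vec_at j k) v = mon k 1 * laurent_adj (v j)"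
proof -
  have "form (unit_vec_at j k) v = (\<Sum>i<s. if i = j then mon k 1 * laurent_adj (v i) else 0)"
    unfolding form_def by (intro sum.cong) (auto simp: unit_vec_at_def)
  then show ?thesis
    using assms by simp
qed

lemma ip_unit_vec_at: "j < s \<Longrightarrow> ip v (unit_vec_at j k) = coef (v j) k"
  by (subst ip_commute) (simp add: ip_def form_unit_vec_at)

definition perp :: "lvec set \<Rightarrow> lvec set" where
  "perp S = {x \<in> vecs. \<forall>y\<in>S. ip x y = 0}"

text \<open>An orthonormal basis of the module of vectors: orthonormality for \<open>form\<close> is
  orthonormality for \<open>ip\<close> of all shifts at once. Spanning is expressed by a trivial
  orthogonal complement, which is the form in which the lattice argument delivers it.\<close>

definition tight_frame :: "lvec set \<Rightarrow> bool" where
  "tight_frame A \<longleftrightarrow> finite A \<and> A \<subseteq> vecs \<and> (\<forall>a\<in>A. \<forall>b\<in>A. form a b = (if a = b then 1 else 0)) \<and>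
    (\<forall>v\<in>vecs. (\<forall>a\<in>A. form v a = 0) \<longrightarrow> v = 0)"

lemma tight_frame_expand:
  assumes "tight_frame A" "v \<in> vecs"
  shows "v = (\<Sum>a\<in>A. lmul (form v a) a)"
proof -
  define w where "w = v - (\<Sum>a\<in>A. lmul (form v a) a)"
  have A: "finite A" "\<And>a. a \<in> A \<Longrightarrow> a \<in> vecs"
    using assms(1) by (auto simp: tight_frame_def)
  have "w \<in> vecs"
    unfolding w_def using assms(2) A(2) by (auto intro!: form_in_FL)
  moreover have "form w a = 0" if "a \<in> A" for a
  proof -
    have "(\<Sum>b\<in>A. form v b * form b a) = (\<Sum>b\<in>A. if b = a then form v a else 0)"
      using assms(1) that by (intro sum.cong) (auto simp: tight_frame_def)
    then show ?thesis
      using A(1) that by (simp add: w_def)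
  qed
  ultimately have "w = 0"
    using assms(1) by (auto simp: tight_frame_def)
  then show ?thesis
    by (simp add: w_def)
qed

text \<open>Both sides are the trace of the Gram matrix.\<close>

lemma card_tight_frame:
  assumes "tight_frame A"
  shows "card A = s"
proof -
  have "(\<Sum>a\<in>A. laurent_adj (a j) * a j) = 1" if "j < s" for j
  proof -
    have "unit_vec_at j 0 j = (\<Sum>a\<in>A. lmul (form (unit_vec_at j 0) a) a) j"
      using tight_frame_expand[OF assms unit_vec_at_vecs[OF that]] by (rule fun_cong)
    then show ?thesis
      using that by (simp add: unit_vec_at_def[of j 0] sum_fun_apply lmul_apply)
        (simp add: form_unit_vec_at flip: unit_vec_at_def)
  qed
  then have "of_nat s = (\<Sum>j<s. \<Sum>a\<in>A. laurent_adj (a j) * a j)"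
    by simp
  also have "\<dots> = (\<Sum>a\<in>A. form a a)"
    by (subst sum.swap) (simp add: form_def mult.commute)
  also have "\<dots> = of_nat (card A)"
    using assms by (simp add: tight_frame_def)
  finally have "(of_nat s :: laurent) = of_nat (card A)" .
  then show ?thesis
    by simp
qed

end

section \<open>The reflection attached to a symmetry row\<close>

locale symmetric_space = laurent_space +
  fixes ep :: "nat \<Rightarrow> complex" and tt :: "nat \<Rightarrow> int"
  assumes ep: "\<And>j. ep j \<in> {-1, 1}" and tt: "\<And>j. tt j \<in> {0, 1}"
begin

lemma ep_simps [simp]: "ep j * ep j = 1" "ep j * (ep j * x) = x" "cnj (ep j) = ep j" "ep j \<noteq> 0" "ep j \<in> F"
  using ep[of j] by auto

definition sg :: "lvec \<Rightarrow> lvec" where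
  "sg v = (\<lambda>j. mon (- tt j) (ep j) * laurent_reflect (v j))"

lemma coef_sg [simp]: "coef (sg v j) k = ep j * coef (v j) (- k - tt j)"
  by (simp add: sg_def)

lemma sg_vecs [simp, intro]: "v \<in> vecs \<Longrightarrow> sg v \<in> vecs"
  by (auto simp: vecs_def sg_def)

lemma sg_sg [simp]: "sg (sg v) = v"
  by (rule ext, rule poly_mapping_eqI) simp

lemma sg_simps [simp]: "sg (v + w) = sg v + sg w" "sg (v - w) = sg v - sg w"
  "sg (lmul p v) = lmul (laurent_reflect p) (sg v)" "sg 0 = 0"
  by (simp_all add: sg_def lmul_def fun_eq_iff vec_apply algebra_simps)

lemma form_sg: "form (sg v) (sg w) = laurent_reflect (form v w)"
proof -
  have "mon (- tt j) (ep j) * laurent_reflect (v j) * laurent_adj (mon (- tt j) (ep j) * laurent_reflect (w j))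
     = laurent_reflect (v j * laurent_adj (w j))" for j
  proof -
    have "mon (- tt j) (ep j) * mon (tt j) (ep j) = 1"
      by (simp add: mult_single)
    then show ?thesis
      by (simp add: adj_reflect)
  qed
  then show ?thesis
    unfolding form_def sg_def reflect_sum by (intro sum.cong refl)
qed

lemma ip_sg_sg: "ip (sg v) (sg w) = ip v w"
  by (simp add: ip_def form_sg)

lemma ip_sg: "ip (sg v) w = ip v (sg w)"
  using ip_sg_sg[of v "sg w"] by simp

text \<open>\<open>low m\<close> is \<open>z^m\<close> times the lattice of the standard basis. In
  column \<open>j\<close> the height of an exponent \<open>k\<close> is \<open>k + tt j\<close>, so
  that lattice itself is \<open>low 0\<close>.\<close>

definition low :: "int \<Rightarrow> lvec set" where
  "low m = {v \<in> vecs. \<forall>j k. coef (v j) k \<noteq> 0 \<longrightarrow> k + tt j \<le> m}"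

lemma lowI: "v \<in> vecs \<Longrightarrow> (\<And>j k. coef (v j) k \<noteq> 0 \<Longrightarrow> k + tt j \<le> m) \<Longrightarrow> v \<in> low m"
  and lowD: "v \<in> low m \<Longrightarrow> v \<in> vecs" "v \<in> low m \<Longrightarrow> coef (v j) k \<noteq> 0 \<Longrightarrow> k + tt j \<le> m"
  unfolding low_def by blast+

lemma low_subsp: "subsp (low m)"
  unfolding subsp_def
proof (intro conjI ballI subsetI)
  show "v + w \<in> low m" if "v \<in> low m" "w \<in> low m" for v w
  proof (rule lowI)
    show "v + w \<in> vecs"
      using that by (simp add: lowD)
    show "k + tt j \<le> m" if "coef ((v + w) j) k \<noteq> 0" for j k
    proof -
      have "coef (v j) k \<noteq> 0 \<or> coef (w j) k \<noteq> 0"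
        using that by (auto simp: vec_apply lookup_add)
      then show ?thesis
        using lowD(2) \<open>v \<in> low m\<close> \<open>w \<in> low m\<close> by blast
    qed
  qed
  show "scl a v \<in> low m" if "a \<in> F" "v \<in> low m" for a v
    using that by (auto intro!: lowI simp: lmul_apply lowD)
  show "0 \<in> low m"
    by (rule lowI) (auto simp: zero_fun_apply)
qed (rule lowD)

lemma low_sh: "v \<in> low m \<Longrightarrow> sh n v \<in> low (m + n)"
  by (fastforce simp: low_def lmul_apply)

lemma low_mono: "v \<in> low m \<Longrightarrow> m \<le> n \<Longrightarrow> v \<in> low n"
  by (force simp: low_def)

text \<open>The orthogonal projection onto \<open>low m\<close>, given by truncation because
  \<open>low m\<close> has no finite set of positions.\<close>

definition cut :: "int \<Rightarrow> lvec \<Rightarrow> lvec" where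
  "cut m v = (\<lambda>j. Poly_Mapping.mapp (\<lambda>k a. if k + tt j \<le> m then a else 0) (v j))"

lemma coef_cut [simp]: "coef (cut m v j) k = (if k + tt j \<le> m then coef (v j) k else 0)"
  by (auto simp: cut_def lookup_mapp when_def in_keys_iff)

lemma cut_low: "v \<in> vecs \<Longrightarrow> cut m v \<in> low m"
  by (auto simp: low_def vecs_def FL_def intro: poly_mapping_eqI)

text \<open>\<open>S\<close> is the orthogonal sum of \<open>low (-1)\<close> and the part
  \<open>M\<close> of \<open>S\<close> without coefficients there. Truncation projects onto the
  first summand; the second occupies finitely many positions, so Gram-Schmidt applies to it.\<close>

lemma sandwich_projection:
  assumes "subsp S" "S \<subseteq> low 1" "low (-1) \<subseteq> S" "v \<in> vecs"
  obtains p where "p \<in> S" "v - p \<in> perp S"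
proof -
  define M where "M = {w \<in> S. \<forall>j k. k + tt j \<le> -1 \<longrightarrow> coef (w j) k = 0}"
  have M: "subsp M"
    using assms(1) by (auto simp: M_def subsp_def lmul_apply vec_apply lookup_add)
  have supp: "(j, k) \<in> {..<s} \<times> {-2..2}" if "w \<in> M" "coef (w j) k \<noteq> 0" for w j k
  proof -
    have "w \<in> low 1"
      using that assms(2) by (auto simp: M_def)
    then have "k + tt j \<le> 1" "j < s"
      using that(2) vecs_coef by (blast dest: lowD)+
    moreover have "k + tt j > -1"
      using that by (auto simp: M_def intro: leI)
    ultimately show ?thesis
      using tt[of j] by auto
  qed
  have "finite ({..<s} \<times> {-2..2::int})"
    by simp
  then obtain q where q: "q \<in> M" "\<And>w. w \<in> M \<Longrightarrow> ip (v - q) w = 0"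
    by (rule orthogonal_projection[OF _ M _ assms(4)]) (use supp that in blast)+
  define p where "p = cut (-1) v + q"
  have cS: "cut (-1) w \<in> S" if "w \<in> vecs" for w
    using cut_low[OF that] assms(3) by blast
  have "p \<in> S"
    using cS[OF assms(4)] q(1) assms(1) by (simp add: p_def M_def subspD)
  moreover have "ip (v - p) w = 0" if "w \<in> S" for w
  proof -
    have "w \<in> vecs"
      using assms(1) that by (rule subspD)
    then have "w - cut (-1) w \<in> M"
      using subsp_diff[OF assms(1) that cS] by (auto simp: M_def vec_apply lookup_minus)
    then have "ip (v - q) (w - cut (-1) w) = 0"
      by (rule q(2))
    moreover have "ip (cut (-1) v) (w - cut (-1) w) = 0" "ip (v - cut (-1) v) (cut (-1) w) = 0"
      by (rule ip_disjoint; simp add: vec_apply lookup_minus)+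
    moreover have "ip q (cut (-1) w) = 0"
      using q(1) by (intro ip_disjoint) (auto simp: M_def not_less)
    ultimately show ?thesis
      by (simp add: p_def algebra_simps)
  qed
  moreover have "v - p \<in> vecs"
    using assms(1,4) \<open>p \<in> S\<close> by (auto dest: subspD)
  ultimately show ?thesis
    using that by (auto simp: perp_def)
qed

end

text \<open>The inclusions between \<open>low (-1)\<close> and \<open>low 1\<close> serve twice:
  they provide projections onto \<open>L\<close>, and they confine the new basis to exponents
  between -1 and 1. Shift invariance, \<open>L_iso\<close> and \<open>L_coiso\<close> give
  orthogonality and completeness of the shifted eigenvectors.\<close>

locale symmetric_lattice = symmetric_space +
  fixes L :: "lvec set"
  assumes L_subsp: "subsp L"
    and L_low: "L \<subseteq> low 1"
    and low_L: "low (-1) \<subseteq> L"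
    and L_shift: "\<And>y. y \<in> L \<Longrightarrow> sh (-1) y \<in> L"
    and L_iso: "\<And>x y. x \<in> L \<Longrightarrow> y \<in> L \<Longrightarrow> ip x (sh 1 (sg y)) = 0"
    and L_coiso: "\<And>x. x \<in> vecs \<Longrightarrow> (\<And>y. y \<in> L \<Longrightarrow> ip x (sg y) = 0) \<Longrightarrow> x \<in> L"
begin

lemma L_vecs: "v \<in> L \<Longrightarrow> v \<in> vecs"
  using L_subsp by (rule subspD)

lemma L_sh:
  assumes "y \<in> L" "n \<le> 0"
  shows "sh n y \<in> L"
proof -
  have "sh (- int m) y \<in> L" for m
  proof (induction m)
    case (Suc m)
    then show ?case
      using L_shift[of "sh (- int m) y"] by (simp add: mult_single)
  qed (use assms in simp)
  from this[of "nat (- n)"] assms show ?thesis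
    by simp
qed

lemma perp_sh:
  assumes "a \<in> perp L" "n \<ge> 0"
  shows "sh n a \<in> perp L"
  using assms L_sh[of _ "- n"] by (auto simp: perp_def ip_sh_left)

lemma ip_perp: "x \<in> L \<Longrightarrow> a \<in> perp L \<Longrightarrow> ip x a = 0"
  by (auto simp: perp_def intro: ip_eq_zero_commute)

lemma L_iso_sh:
  assumes "x \<in> L" "y \<in> L" "n \<ge> 1"
  shows "ip x (sh n (sg y)) = 0"
  using L_iso[OF assms(1) L_sh[OF assms(2), of "1 - n"]] assms(3) by (simp add: mult_single)

lemma sg_perp: "a \<in> perp L \<Longrightarrow> sg a \<in> L"
  by (rule L_coiso) (auto simp: perp_def ip_sg_sg)

lemma L_projection:
  assumes "v \<in> vecs"
  obtains p where "p \<in> L" "v - p \<in> perp L"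
  using sandwich_projection[OF L_subsp L_low low_L assms] .

text \<open>The four symmetry types \<open>e z^(-t)\<close> of a regrouped row become four
  eigenspaces: of \<open>\<sigma>\<close> in \<open>L\<close> for \<open>t = 0\<close>, of
  \<open>z \<sigma>\<close> in \<open>perp L\<close> for \<open>t = 1\<close>. Membership in the
  reflected space is automatic for an eigenvector.\<close>

definition H :: "complex \<Rightarrow> int \<Rightarrow> lvec set" where
  "H e t = {a \<in> (if t = 0 then L else perp L). sg a = lmul (mon (- t) e) a}"

lemma H_vecs: "a \<in> H e t \<Longrightarrow> a \<in> vecs"
  by (auto simp: H_def L_vecs perp_def split: if_splits)

lemma H_subsp: "subsp (H e t)"
proof -
  have *: "subsp (if t = 0 then L else perp L)"
    using L_subsp by (auto simp: subsp_def perp_def)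
  show ?thesis
    unfolding subsp_def
  proof (intro conjI ballI subsetI)
    show "scl a v \<in> H e t" if "a \<in> F" "v \<in> H e t" for a v
      using that * by (auto simp: H_def mult.commute subspD(4))
  qed (use * H_vecs in \<open>auto simp: H_def lmul_add subspD\<close>)
qed

lemma H_shift_sg: "a \<in> H e t \<Longrightarrow> e \<in> {-1, 1} \<Longrightarrow> a = lmul (mon t e) (sg a)"
  by (auto simp: H_def mult_single)

lemma H_coef_partner:
  assumes "a \<in> H e t" "e \<in> {-1, 1}" "coef (a j) k \<noteq> 0"
  shows "coef (a j) (- (k - t) - tt j) \<noteq> 0"
proof -
  have "sg a = lmul (mon (- t) e) a"
    using assms(1) by (simp add: H_def)
  then have "coef (sg a j) (k - t) = coef (lmul (mon (- t) e) a j) (k - t)"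
    by simp
  then show ?thesis
    using assms(2,3) by (auto simp: lmul_apply)
qed

text \<open>The eigenvalue equation pairs the exponents \<open>k\<close> and
  \<open>t - tt j - k\<close>, so a bound on one side gives one on the other. For
  \<open>t = 0\<close> the upper bound comes from \<open>L \<subseteq> low 1\<close>, for
  \<open>t = 1\<close> the lower bound from orthogonality to \<open>low (-1)\<close>. This is what
  makes the change of basis elementary.\<close>

lemma H_supp:
  assumes "a \<in> H e t" "e \<in> {-1, 1}" "t \<in> {0, 1}" "coef (a j) k \<noteq> 0"
  shows "j < s" "-1 \<le> k" "k \<le> 1"
proof -
  show "j < s"
    using H_vecs[OF assms(1)] assms(4) by (rule vecs_coef)
  have partner: "coef (a j) (t - tt j - k) \<noteq> 0"
    using H_coef_partner[OF assms(1,2,4)] by (simp add: algebra_simps)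
  have "-1 \<le> k \<and> k \<le> 1"
  proof (cases "t = 0")
    case True
    then have "a \<in> low 1"
      using assms(1) L_low by (auto simp: H_def)
    then have "m + tt j \<le> 1" if "coef (a j) m \<noteq> 0" for m
      using that by (auto simp: low_def)
    from this[OF assms(4)] this[OF partner] show ?thesis
      using True tt[of j] by auto
  next
    case False
    have "m + tt j > -1" if "coef (a j) m \<noteq> 0" for m
    proof (rule ccontr)
      assume "\<not> m + tt j > -1"
      then have "unit_vec_at j m \<in> low (-1)"
        using \<open>j < s\<close> by (intro lowI) (auto simp: coef_unit_vec_at split: if_splits)
      then have "ip a (unit_vec_at j m) = 0"
        using False assms(1) low_L by (auto simp: H_def perp_def)
      then show False
        using that \<open>j < s\<close> by (simp add: ip_unit_vec_at)
    qed
    from this[OF assms(4)] this[OF partner] show ?thesis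
      using False assms(3) tt[of j] by auto
  qed
  then show "-1 \<le> k" "k \<le> 1"
    by auto
qed

text \<open>The eigenvalue equations turn each of the four combinations of \<open>t\<close> and
  \<open>t'\<close> into a pairing of \<open>L\<close> with \<open>perp L\<close> or with a positive
  shift of \<open>\<sigma> L\<close>. For \<open>t = t' = 1\<close> this uses that
  \<open>\<sigma>\<close> maps \<open>perp L\<close> into \<open>L\<close>.\<close>

lemma H_orthogonal_pos:
  assumes a: "a \<in> H e t" "e \<in> {-1, 1}" "t \<in> {0, 1}" and b: "b \<in> H e' t'" "e' \<in> {-1, 1}" "t' \<in> {0, 1}"
    and n: "n > 0 \<or> n = 0 \<and> t = 0 \<and> t' = 1"
  shows "ip a (sh n b) = 0"
proof -
  consider "t' = 1" "t = 0" | "t' = 0" "t = 0" | "t' = 0" "t = 1" | "t' = 1" "t = 1"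
    using a b by blast
  then show ?thesis
  proof cases
    case 1
    then show ?thesis
      using a b n perp_sh[of b n] ip_perp by (auto simp: H_def)
  next
    case 2
    have "sh n b = sh n (lmul (mon t' e') (sg b))"
      using H_shift_sg[OF b(1,2)] by simp
    then have "ip a (sh n b) = ip a (scl e' (sh n (sg b)))"
      using 2 by (simp add: mult_single)
    also have "\<dots> = 0"
      using 2 a b n L_iso_sh[of a b n] by (auto simp: H_def simp del: lmul_lmul)
    finally show ?thesis .
  next
    case 3
    have "ip a (sh n b) = ip (sh 1 (scl e (sg a))) (sh n (scl e' (sg b)))"
      using H_shift_sg[OF a(1,2)] H_shift_sg[OF b(1,2)] 3 by (simp add: mult_single)
    also have "\<dots> = e * cnj e' * ip (sg a) (sg (sh (1 - n) b))"
      by (simp add: ip_def mult_single)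
    also have "ip (sg a) (sg (sh (1 - n) b)) = 0"
      unfolding ip_sg_sg using a b n 3 L_sh[of b "1 - n"] by (auto simp: H_def perp_def)
    finally show ?thesis
      by simp
  next
    case 4
    have "sg a \<in> L"
      by (rule sg_perp) (use a(1) 4 in \<open>simp add: H_def\<close>)
    have "sh (n - 1) b \<in> perp L"
      using b(1) n 4 perp_sh[of b "n - 1"] by (auto simp: H_def)
    have "ip a (sh n b) = ip (sh 1 (scl e (sg a))) (sh n b)"
      using H_shift_sg[OF a(1,2)] 4 by (simp add: mult_single)
    also have "\<dots> = e * ip (sg a) (sh (n - 1) b)"
      by (simp add: ip_def mult_single)
    finally show ?thesis
      using ip_perp[OF \<open>sg a \<in> L\<close> \<open>sh (n - 1) b \<in> perp L\<close>] by simp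
  qed
qed

text \<open>Negative shifts follow by exchanging the two vectors. For equal \<open>t\<close> and no
  shift, \<open>\<sigma>\<close> is an isometry and the two vectors belong to different signs, so
  their product equals its own negative.\<close>

lemma H_orthogonal:
  assumes a: "a \<in> H e t" "e \<in> {-1, 1}" "t \<in> {0, 1}" and b: "b \<in> H e' t'" "e' \<in> {-1, 1}" "t' \<in> {0, 1}"
    and n: "n \<noteq> 0 \<or> t \<noteq> t' \<or> e \<noteq> e'"
  shows "ip a (sh n b) = 0"
proof -
  consider "n > 0 \<or> n = 0 \<and> t = 0 \<and> t' = 1" | "n < 0 \<or> n = 0 \<and> t = 1 \<and> t' = 0" | "n = 0" "t = t'" "e \<noteq> e'"
    using n a(3) b(3) by force
  then show ?thesis
  proof cases
    case 1
    then show ?thesis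
      by (rule H_orthogonal_pos[OF a b])
  next
    case 2
    then have "ip b (sh (- n) a) = 0"
      by (intro H_orthogonal_pos[OF b a]) auto
    then show ?thesis
      using ip_eq_zero_commute[of b "sh (- n) a"] by (simp add: ip_sh_left)
  next
    case 3
    have "ip a b = ip (sg a) (sg b)"
      by (simp add: ip_sg_sg)
    also have "\<dots> = ip (lmul (mon (- t) e) a) (lmul (mon (- t) e') b)"
      using a b 3 by (simp add: H_def)
    also have "\<dots> = e * cnj e' * ip a b"
      by (simp add: ip_def mult_single flip: mult.assoc)
    also have "\<dots> = - ip a b"
      using 3 a b by auto
    finally show ?thesis
      using 3 by simp
  qed
qed

text \<open>\<open>z^t \<sigma>\<close> is an involution, so \<open>x\<close> is the sum of its two
  halves \<open>f 1\<close> and \<open>f (-1)\<close>, which are eigenvectors and stay in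
  \<open>S\<close> because \<open>S\<close> contains the reflection of \<open>x\<close>.\<close>

lemma eigen_split:
  assumes "subsp S" "x \<in> S" "sh t (sg x) \<in> S" "\<And>e a. a \<in> S \<Longrightarrow> sg a = lmul (mon (- t) e) a \<Longrightarrow> a \<in> H e t"
    and "\<And>e a. e \<in> {-1, 1} \<Longrightarrow> a \<in> H e t \<Longrightarrow> ip v a = 0"
  shows "ip v x = 0"
proof -
  define f where "f e = scl (1 / 2) (x + scl e (sh t (sg x)))" for e
  have "f e \<in> H e t" if e: "e \<in> {-1, 1}" for e
  proof (rule assms(4))
    have "e \<in> F"
      using e by auto
    then show "f e \<in> S"
      unfolding f_def using assms(1-3) F_half by (blast intro: subspD)
    show "sg (f e) = lmul (mon (- t) e) (f e)"
      using e by (auto simp: f_def lmul_add mult_single add.commute)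
  qed
  then have "ip v (f e) = 0" if "e \<in> {-1, 1}" for e
    using assms(5) that by blast
  then have "ip v (f 1) = 0" "ip v (f (- 1)) = 0"
    by auto
  then have "ip v (f 1 + f (- 1)) = 0"
    by simp
  moreover have "f 1 + f (- 1) = x"
    by (rule ext, rule poly_mapping_eqI) (simp add: f_def vec_apply lmul_apply lookup_add mult.assoc add_divide_distrib diff_divide_distrib)
  ultimately show ?thesis
    by simp
qed

text \<open>For \<open>v\<close> in \<open>L\<close> orthogonal to all shifted eigenvectors, the
  \<open>L\<close>-component \<open>p\<close> of \<open>\<sigma> v\<close> has its reflection in
  \<open>L\<close> too; it then splits into eigenvectors orthogonal to \<open>v\<close>, which
  forces \<open>p = 0\<close>. So \<open>\<sigma> v\<close> is orthogonal to \<open>L\<close>, and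
  the same argument kills the component \<open>d\<close> of \<open>z v\<close> in
  \<open>perp L\<close>.\<close>

lemma H_complete_step:
  assumes v: "v \<in> L" and orth: "\<And>e t a n. e \<in> {-1, 1} \<Longrightarrow> t \<in> {0, 1} \<Longrightarrow> a \<in> H e t \<Longrightarrow> ip v (sh n a) = 0"
  shows "sh 1 v \<in> L"
proof -
  have vv: "v \<in> vecs" "sg v \<in> vecs" "sh 1 v \<in> vecs"
    using v L_vecs by auto
  obtain p where p: "p \<in> L" "sg v - p \<in> perp L"
    using L_projection[OF vv(2)] .
  define w where "w = sg v - p"
  have "sg w \<in> L"
    using sg_perp[OF p(2)] by (simp add: w_def)
  then have "v - sg w \<in> L"
    using v L_subsp subsp_diff by blast
  then have "sg p \<in> L"
    by (simp add: w_def)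
  have "ip v (sg p) = 0"
  proof (rule eigen_split[OF L_subsp \<open>sg p \<in> L\<close>, of 0])
    show "sh 0 (sg (sg p)) \<in> L"
      using p(1) by simp
    show "a \<in> H e 0" if "a \<in> L" "sg a = lmul (mon (- 0) e) a" for e a
      using that by (simp add: H_def)
    show "ip v a = 0" if "e \<in> {-1, 1}" "a \<in> H e 0" for e a
      using orth[of e 0 a 0] that by simp
  qed
  moreover have "ip (sg w) (sg p) = 0"
    unfolding ip_sg_sg w_def using p unfolding perp_def by blast
  ultimately have "ip (v - sg w) (sg p) = 0"
    by simp
  then have "ip (sg p) (sg p) = 0"
    by (simp add: w_def)
  then have "sg p = 0"
    using p(1) by (intro ip_self_eq_zeroD) (auto simp: L_vecs)
  then have "p = 0"
    by (metis sg_sg sg_simps(4))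
  then have sgv: "sg v \<in> perp L"
    using p(2) by simp
  obtain c where c: "c \<in> L" "sh 1 v - c \<in> perp L"
    using L_projection[OF vv(3)] .
  define d where "d = sh 1 v - c"
  \<comment> \<open>\<open>z \<sigma> d\<close> equals \<open>\<sigma> v - z \<sigma> c\<close>: the
    first term has just been shown orthogonal to \<open>L\<close>, the second is so by
    \<open>L_iso\<close>.\<close>
  have "sh 1 (sg d) \<in> perp L"
    unfolding perp_def
  proof (intro CollectI conjI ballI)
    show "sh 1 (sg d) \<in> vecs"
      using vv c(1) L_vecs by (auto simp: d_def)
    fix y assume y: "y \<in> L"
    have "ip y (sh 1 (sg c)) = 0"
      by (rule L_iso[OF y c(1)])
    then have "ip (sh 1 (sg c)) y = 0"
      by (rule ip_eq_zero_commute)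
    moreover have "ip (sg v) y = 0"
      using sgv y by (simp add: perp_def)
    ultimately show "ip (sh 1 (sg d)) y = 0"
      by (simp add: d_def lmul_diff mult_single)
  qed
  have perp: "subsp (perp L)"
    by (auto simp: subsp_def perp_def)
  have "ip (sh 1 v) d = 0"
  proof (rule eigen_split[OF perp _ \<open>sh 1 (sg d) \<in> perp L\<close>])
    show "d \<in> perp L"
      using c by (simp add: d_def)
    show "a \<in> H e 1" if "a \<in> perp L" "sg a = lmul (mon (- 1) e) a" for e a
      using that by (simp add: H_def)
    show "ip (sh 1 v) a = 0" if "e \<in> {-1, 1}" "a \<in> H e 1" for e a
      using orth[of e 1 a "-1"] that by (simp add: ip_sh_left)
  qed
  moreover have "ip c d = 0"
    unfolding d_def by (rule ip_perp[OF c])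
  ultimately have "ip d d = 0"
    by (simp add: d_def)
  then have "d = 0"
    using c vv by (intro ip_self_eq_zeroD) (auto simp: d_def L_vecs)
  then show ?thesis
    using c(1) by (simp add: d_def)
qed

text \<open>A low shift of \<open>v\<close> lies in \<open>L\<close>, and the step lemma moves it
  upwards without leaving \<open>L\<close>. Since heights in \<open>L\<close> are at most 1, only
  \<open>v = 0\<close> survives this.\<close>

lemma H_complete:
  assumes v: "v \<in> vecs" and orth: "\<And>e t a n. e \<in> {-1, 1} \<Longrightarrow> t \<in> {0, 1} \<Longrightarrow> a \<in> H e t \<Longrightarrow> ip v (sh n a) = 0"
  shows "v = 0"
proof -
  define X where "X = insert 0 (\<Union>j<s. Poly_Mapping.keys (v j))"
  have "finite X"
    by (simp add: X_def)
  \<comment> \<open>Heights exceed exponents by at most 1, so \<open>v\<close> has height at most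
    \<open>N - 1\<close> and its shift by \<open>- N\<close> lies in
    \<open>low (-1)\<close>.\<close>
  define N where "N = Max X + 2"
  have "k + tt j \<le> N - 1" if "coef (v j) k \<noteq> 0" for j k
  proof -
    have "k \<in> X"
      using vecs_coef[OF v that] that by (auto simp: X_def in_keys_iff)
    then have "k \<le> Max X"
      using \<open>finite X\<close> by simp
    then show ?thesis
      using tt[of j] by (auto simp: N_def)
  qed
  then have "v \<in> low (N - 1)"
    using v by (simp add: low_def)
  then have "sh (- N) v \<in> low (-1)"
    using low_sh[of v "N - 1" "- N"] by simp
  then have base: "sh (- N) v \<in> L"
    using low_L by blast
  have inL: "sh (int m - N) v \<in> L" for m
  proof (induction m)
    case (Suc m)
    have "sh 1 (sh (int m - N) v) \<in> L"
    proof (rule H_complete_step[OF Suc])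
      show "ip (sh (int m - N) v) (sh n a) = 0" if "e \<in> {-1, 1}" "t \<in> {0, 1}" "a \<in> H e t" for e t a n
        using orth[OF that, of "n - (int m - N)"] by (simp add: ip_sh_left mult_single algebra_simps)
    qed
    then show ?case
      by (simp add: mult_single algebra_simps)
  qed (use base in simp)
  have "coef (v j) k = 0" for j k
  proof (rule ccontr)
    assume nz: "coef (v j) k \<noteq> 0"
    define m where "m = nat (\<bar>N - k\<bar> + 2)"
    have "sh (int m - N) v \<in> low 1"
      using inL L_low by blast
    moreover have "coef (sh (int m - N) v j) (k + (int m - N)) \<noteq> 0"
      using nz by (simp add: lmul_apply)
    ultimately have "k + (int m - N) + tt j \<le> 1"
      by (simp add: low_def)
    then show False
      using tt[of j] by (auto simp: m_def)
  qed
  then show ?thesis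
    by (intro ext poly_mapping_eqI) (simp add: zero_fun_apply)
qed

text \<open>Each of the four eigenspaces has bounded support, so inside it the complement of
  \<open>U\<close> has a finite orthonormal basis. Orthogonality between eigenspaces and shifts
  makes the union orthonormal over the Laurent ring, and \<open>H_complete\<close> makes it
  complete.\<close>

lemma H_tight_frame_extension:
  assumes U: "finite U" "\<And>u. u \<in> U \<Longrightarrow> \<exists>e\<in>{-1, 1}. \<exists>t\<in>{0, 1}. u \<in> H e t" "orthonormal U"
  obtains A where "tight_frame A" "U \<subseteq> A" "\<And>a. a \<in> A \<Longrightarrow> \<exists>e\<in>{-1, 1}. \<exists>t\<in>{0, 1}. a \<in> H e t"
proof -
  define C where "C e t = {x \<in> H e t. \<forall>u\<in>U. ip x u = 0}" for e t
  define I where "I = {-1, 1::complex} \<times> {0, 1::int}"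
  have "\<exists>B. finite B \<and> B \<subseteq> C e t \<and> orthonormal B \<and> (\<forall>v\<in>C e t. v = (\<Sum>b\<in>B. scl (ip v b) b))"
    if "(e, t) \<in> I" for e t
  proof (rule orthonormal_basis)
    show "finite ({..<s} \<times> {-1..1::int})"
      by simp
    show "(j, k) \<in> {..<s} \<times> {-1..1}" if "v \<in> C e t" "coef (v j) k \<noteq> 0" for v j k
      using H_supp[of v e t j k] that \<open>(e, t) \<in> I\<close> by (auto simp: I_def C_def)
    show "subsp (C e t)"
      using H_subsp[of e t] by (auto simp: subsp_def C_def)
  qed
  then have "\<forall>x\<in>I. \<exists>B. finite B \<and> B \<subseteq> C (fst x) (snd x) \<and> orthonormal B \<and>
      (\<forall>v\<in>C (fst x) (snd x). v = (\<Sum>b\<in>B. scl (ip v b) b))"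
    by auto
  from bchoice[OF this] obtain B where B: "\<forall>x\<in>I. finite (B x) \<and> B x \<subseteq> C (fst x) (snd x) \<and> orthonormal (B x) \<and>
      (\<forall>v\<in>C (fst x) (snd x). v = (\<Sum>b\<in>B x. scl (ip v b) b))" ..
  define A where "A = U \<union> (\<Union>x\<in>I. B x)"
  have A_cases: "\<exists>x\<in>I. a \<in> H (fst x) (snd x) \<and> (a \<in> U \<or> a \<in> B x)" if "a \<in> A" for a
    using that U(2)[of a] B by (auto simp: A_def I_def C_def)
  have UB: "ip u b = 0" "ip b u = 0" if "u \<in> U" "b \<in> B x" "x \<in> I" for u b x
  proof -
    show "ip b u = 0"
      using that B by (auto simp: C_def)
    then show "ip u b = 0"
      by (rule ip_eq_zero_commute)
  qed
  have "form a b = (if a = b then 1 else 0)" if ab: "a \<in> A" "b \<in> A" for a b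
  proof -
    obtain x where x: "x \<in> I" "a \<in> H (fst x) (snd x)" "a \<in> U \<or> a \<in> B x"
      using A_cases[OF ab(1)] by blast
    obtain y where y: "y \<in> I" "b \<in> H (fst y) (snd y)" "b \<in> U \<or> b \<in> B y"
      using A_cases[OF ab(2)] by blast
    have I: "fst z \<in> {-1, 1}" "snd z \<in> {0, 1}" if "z \<in> I" for z
      using that by (auto simp: I_def)
    have dist: "ip a (sh n b) = 0" if "n \<noteq> 0 \<or> x \<noteq> y" for n
      by (rule H_orthogonal[OF x(2) I[OF x(1)] y(2) I[OF y(1)]]) (use that in \<open>auto simp: prod_eq_iff\<close>)
    have "ip a a = 1"
      using x U(3) B by (auto simp: orthonormal_def)
    have "ip a b = 0" if "a \<noteq> b"
    proof (cases "x = y")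
      case True
      then show ?thesis
        using that x y UB U(3) B unfolding orthonormal_def by metis
    next
      case False
      then show ?thesis
        using dist[of 0] by simp
    qed
    \<comment> \<open>The products with all shifts are the coefficients of \<open>form a b\<close>,
      so scalar orthogonality relations become a Laurent identity.\<close>
    then have "ip a (sh n b) = coef (if a = b then 1 else 0) n" for n
      using dist[of n] \<open>ip a a = 1\<close> by (cases "n = 0") (auto simp: lookup_one)
    then show ?thesis
      by (intro poly_mapping_eqI) (simp add: ip_sh_right)
  qed
  moreover have "finite A"
    using B U(1) by (auto simp: A_def I_def)
  moreover have "A \<subseteq> vecs"
    using A_cases H_vecs by blast
  moreover have "v = 0" if v: "v \<in> vecs" and vA: "\<forall>a\<in>A. form v a = 0" for v
  proof (rule H_complete[OF v])
    fix e t a n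
    assume et: "e \<in> {-1, 1::complex}" "t \<in> {0, 1::int}" and a: "a \<in> H e t"
    have "(e, t) \<in> I"
      using et by (auto simp: I_def)
    have vB: "form v c = 0" if "c \<in> B (e, t)" for c
      using vA that \<open>(e, t) \<in> I\<close> unfolding A_def by blast
    \<comment> \<open>Removing the \<open>U\<close>-component keeps \<open>a\<close> in its
      eigenspace: members of \<open>U\<close> from the other eigenspaces are orthogonal to
      \<open>a\<close> and contribute zero.\<close>
    define b where "b = a - (\<Sum>u\<in>U. scl (ip a u) u)"
    have "scl (ip a u) u \<in> H e t" if "u \<in> U" for u
    proof (cases "u \<in> H e t")
      case True
      then show ?thesis
        using H_subsp a by (auto intro!: subspD(4) ip_in_F dest: H_vecs)
    next
      case False
      then obtain e' t' where "e' \<in> {-1, 1}" "t' \<in> {0, 1}" "u \<in> H e' t'" "t \<noteq> t' \<or> e \<noteq> e'"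
        using U(2)[OF \<open>u \<in> U\<close>] by blast
      then have "ip a u = 0"
        using H_orthogonal[OF a et, of u e' t' 0] by simp
      then show ?thesis
        using H_subsp[of e t] by (simp add: subspD(2))
    qed
    then have "b \<in> H e t"
      unfolding b_def by (intro subsp_diff[OF H_subsp] a subsp_sum[OF H_subsp])
    moreover have "ip b u = 0" if "u \<in> U" for u
      using orthonormal_expand[OF U(3,1) that] by (simp add: b_def)
    ultimately have "b \<in> C e t"
      by (simp add: C_def)
    then have "b = (\<Sum>c\<in>B (e, t). scl (ip b c) c)"
      using B \<open>(e, t) \<in> I\<close> by fastforce
    then have "ip v (sh n b) = ip v (sh n (\<Sum>c\<in>B (e, t). scl (ip b c) c))"
      by (rule arg_cong)
    also have "\<dots> = (\<Sum>c\<in>B (e, t). cnj (ip b c) * coef (form v c) n)"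
      by (simp add: lmul_sum ip_def mult_single lookup_sum)
    also have "\<dots> = 0"
      using vB by simp
    finally have "ip v (sh n b) = 0" .
    moreover have "ip v (sh n (\<Sum>u\<in>U. scl (ip a u) u)) = (\<Sum>u\<in>U. cnj (ip a u) * coef (form v u) n)"
      by (simp add: lmul_sum ip_def mult_single lookup_sum)
    then have "ip v (sh n (\<Sum>u\<in>U. scl (ip a u) u)) = 0"
      using vA by (simp add: A_def)
    ultimately show "ip v (sh n a) = 0"
      by (simp add: b_def lmul_diff)
  qed
  ultimately have "tight_frame A"
    by (auto simp: tight_frame_def)
  moreover have "\<exists>e\<in>{-1, 1}. \<exists>t\<in>{0, 1}. a \<in> H e t" if "a \<in> A" for a
    using A_cases[OF that] by (auto simp: I_def)
  ultimately show ?thesis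
    using that[of A] by (simp add: A_def)
qed

text \<open>The frame is listed with the prescribed vectors in front, as the rows of a square matrix
  require. Its cardinality \<open>s\<close> gives both the length of the list and
  \<open>r \<le> s\<close>.\<close>

lemma enumerated_frame_extension:
  assumes u: "\<And>i. i < r \<Longrightarrow> u i \<in> H (h i) (d i)" and h: "\<And>i. h i \<in> {-1, 1}" and d: "\<And>i. d i \<in> {0, 1}"
    and on: "\<And>i j. i < r \<Longrightarrow> j < r \<Longrightarrow> form (u i) (u j) = (if i = j then 1 else 0)"
  obtains a e t where "r \<le> s" "\<And>i. i < r \<Longrightarrow> a i = u i \<and> e i = h i \<and> t i = d i"
    "\<And>i. e i \<in> {-1, 1}" "\<And>i. t i \<in> {0, 1}" "\<And>i. i < s \<Longrightarrow> a i \<in> H (e i) (t i)"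
    "\<And>i j. i < s \<Longrightarrow> j < s \<Longrightarrow> form (a i) (a j) = (if i = j then 1 else 0)"
    "\<And>v. v \<in> vecs \<Longrightarrow> v = (\<Sum>i<s. lmul (form v (a i)) (a i))"
proof -
  have inj: "inj_on u {..<r}"
    using on by (auto simp: inj_on_def) (metis one_neq_zero)
  have "orthonormal (u ` {..<r})"
    using on inj by (auto simp: orthonormal_def ip_def inj_on_eq_iff)
  moreover have "\<exists>e\<in>{-1, 1}. \<exists>t\<in>{0, 1}. x \<in> H e t" if "x \<in> u ` {..<r}" for x
    using that u h d by blast
  ultimately obtain A where A: "tight_frame A" "u ` {..<r} \<subseteq> A"
    "\<And>a. a \<in> A \<Longrightarrow> \<exists>e\<in>{-1, 1}. \<exists>t\<in>{0, 1}. a \<in> H e t"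
    using H_tight_frame_extension[of "u ` {..<r}"] by blast
  have fin: "finite A" and card: "card A = s"
    using A(1) card_tight_frame by (auto simp: tight_frame_def)
  have cU: "card (u ` {..<r}) = r"
    using card_image[OF inj] by simp
  then have "r \<le> s"
    using card_mono[OF fin A(2)] card by simp
  have "card (A - u ` {..<r}) = card {r..<s}"
    using A(2) fin card cU by (simp add: card_Diff_subset)
  then obtain f where f: "bij_betw f {r..<s} (A - u ` {..<r})"
    using finite_same_card_bij[of "{r..<s}" "A - u ` {..<r}"] fin by auto
  define a where "a i = (if i < r then u i else f i)" for i
  have "bij_betw a ({..<r} \<union> {r..<s}) (u ` {..<r} \<union> (A - u ` {..<r}))"
  proof (rule bij_betw_combine)
    show "bij_betw a {..<r} (u ` {..<r})"
      using inj_on_imp_bij_betw[OF inj] by (subst bij_betw_cong[where g = u]) (auto simp: a_def)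
    show "bij_betw a {r..<s} (A - u ` {..<r})"
      using f by (subst bij_betw_cong[where g = f]) (auto simp: a_def)
  qed auto
  moreover have "{..<r} \<union> {r..<s} = {..<s}" "u ` {..<r} \<union> (A - u ` {..<r}) = A"
    using \<open>r \<le> s\<close> A(2) by auto
  ultimately have bij: "bij_betw a {..<s} A"
    by simp
  then have aA: "a i \<in> A" if "i < s" for i
    using that by (auto simp: bij_betw_def)
  have "\<exists>x. fst x \<in> {-1, 1} \<and> snd x \<in> {0, 1} \<and> a i \<in> H (fst x) (snd x)" if "i < s" for i
  proof -
    obtain e t where "e \<in> {-1, 1}" "t \<in> {0, 1}" "a i \<in> H e t"
      using A(3)[OF aA[OF \<open>i < s\<close>]] by blast
    then show ?thesis
      by (intro exI[of _ "(e, t)"]) simp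
  qed
  then have "\<exists>g. \<forall>i\<in>{..<s}. fst (g i) \<in> {-1, 1} \<and> snd (g i) \<in> {0, 1} \<and> a i \<in> H (fst (g i)) (snd (g i))"
    by (intro bchoice) blast
  then obtain g where g: "\<And>i. i < s \<Longrightarrow> fst (g i) \<in> {-1, 1} \<and> snd (g i) \<in> {0, 1} \<and> a i \<in> H (fst (g i)) (snd (g i))"
    by (auto simp del: insert_iff)
  \<comment> \<open>The values beyond \<open>s\<close> are fillers that keep \<open>e\<close> and
    \<open>t\<close> admissible at every index, so that they can serve as the \<open>ep\<close> and
    \<open>tt\<close> of the next symmetric space.\<close>
  define e where "e i = (if i < r then h i else if i < s then fst (g i) else 1)" for i
  define t where "t i = (if i < r then d i else if i < s then snd (g i) else 0)" for i
  show ?thesis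
  proof (rule that[of a e t])
    show "form (a i) (a j) = (if i = j then 1 else 0)" if "i < s" "j < s" for i j
      using A(1) aA that bij by (auto simp: tight_frame_def bij_betw_def inj_on_eq_iff)
    show "v = (\<Sum>i<s. lmul (form v (a i)) (a i))" if "v \<in> vecs" for v
    proof -
      have "(\<Sum>i<s. lmul (form v (a i)) (a i)) = (\<Sum>x\<in>A. lmul (form v x) x)"
        by (rule sum.reindex_bij_betw[OF bij])
      then show ?thesis
        using tight_frame_expand[OF A(1) that] by simp
    qed
    show "e i \<in> {-1, 1}" "t i \<in> {0, 1}" for i
      using g h[of i] d[of i] by (auto simp: e_def t_def)
    show "a i \<in> H (e i) (t i)" if "i < s" for i
      using g[OF that] u[of i] that by (auto simp: e_def t_def a_def)
  qed (auto simp: a_def e_def t_def \<open>r \<le> s\<close>)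
qed

end


section \<open>The lattice that shortens a family of symmetric rows\<close>

locale symmetric_rows = symmetric_space +
  fixes r :: nat and v :: "nat \<Rightarrow> lvec" and h :: "nat \<Rightarrow> complex" and d :: "nat \<Rightarrow> int" and K :: int
  assumes h: "\<And>i. h i \<in> {-1, 1}" and d: "\<And>i. d i \<in> {0, 1}"
    and v_vecs: "\<And>i. i < r \<Longrightarrow> v i \<in> vecs"
    and sg_v: "\<And>i. i < r \<Longrightarrow> sg (v i) = lmul (mon (d i) (h i)) (v i)"
    and form_v: "\<And>i j. i < r \<Longrightarrow> j < r \<Longrightarrow> form (v i) (v j) = (if i = j then 1 else 0)"
    and v_supp: "\<And>i j k. i < r \<Longrightarrow> coef (v i j) k \<noteq> 0 \<Longrightarrow> - K \<le> k + tt j \<and> k + tt j \<le> K"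
    and K: "K \<ge> 1"
begin

text \<open>One shift of each row suffices: for \<open>n \<le> - K\<close> the vector
  \<open>sh n (v i)\<close> already lies in \<open>low 0\<close>.\<close>

definition Z :: "lvec set" where
  "Z = {y \<in> vecs. \<exists>c. (\<forall>i. c i \<in> F) \<and> y - (\<Sum>i<r. scl (c i) (sh (1 - K) (v i))) \<in> low 0}"

text \<open>\<open>z \<sigma>\<close> sends the added vector \<open>sh (1 - K) (v i)\<close> to
  \<open>h i\<close> times \<open>sh (K + d i) (v i)\<close>, so the condition contains
  orthogonality to the mirror images of the added vectors. Ranging over all \<open>n \<ge> K\<close>
  makes it invariant under \<open>1/z\<close>.\<close>

definition L :: "lvec set" where
  "L = {y \<in> Z. \<forall>n\<ge>K. \<forall>i<r. ip y (sh n (v i)) = 0}"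

lemma sg_sum: "sg (sum f A) = (\<Sum>x\<in>A. sg (f x))"
  by (induction A rule: infinite_finite_induct) auto

lemma low_closed [intro]:
  "x \<in> low m \<Longrightarrow> y \<in> low m \<Longrightarrow> x + y \<in> low m" "x \<in> low m \<Longrightarrow> y \<in> low m \<Longrightarrow> x - y \<in> low m"
  "a \<in> F \<Longrightarrow> x \<in> low m \<Longrightarrow> scl a x \<in> low m" "0 \<in> low m"
  using low_subsp[of m] subsp_diff[OF low_subsp] by (simp_all add: subspD)

lemma low_sum: "(\<And>x. x \<in> A \<Longrightarrow> f x \<in> low m) \<Longrightarrow> sum f A \<in> low m"
  using low_subsp by (rule subsp_sum)

lemma sh_v_low: "i < r \<Longrightarrow> n + K \<le> m \<Longrightarrow> sh n (v i) \<in> low m"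
  using v_supp[of i] v_vecs by (fastforce intro!: lowI simp: lmul_apply)

lemma Z_low: "Z \<subseteq> low 1"
proof
  fix y assume "y \<in> Z"
  then obtain c where c: "\<And>i. c i \<in> F" "y - (\<Sum>i<r. scl (c i) (sh (1 - K) (v i))) \<in> low 0"
    by (auto simp: Z_def)
  have "(\<Sum>i<r. scl (c i) (sh (1 - K) (v i))) \<in> low 1"
    by (intro low_sum low_closed c(1) sh_v_low) auto
  moreover have "y - (\<Sum>i<r. scl (c i) (sh (1 - K) (v i))) \<in> low 1"
    using c(2) by (rule low_mono) simp
  ultimately have "(y - (\<Sum>i<r. scl (c i) (sh (1 - K) (v i)))) + (\<Sum>i<r. scl (c i) (sh (1 - K) (v i))) \<in> low 1"
    by (rule low_closed(1)[rotated])
  then show "y \<in> low 1"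
    by simp
qed

lemma low_Z: "low 0 \<subseteq> Z"
  by (auto simp: Z_def lowD intro!: exI[of _ "\<lambda>_. 0"])

lemma Z_subsp: "subsp Z"
  unfolding subsp_def
proof (intro conjI ballI subsetI)
  fix x y assume "x \<in> Z" "y \<in> Z"
  then obtain b c where *: "\<And>i. b i \<in> F" "\<And>i. c i \<in> F" "x \<in> vecs" "y \<in> vecs"
    "x - (\<Sum>i<r. scl (b i) (sh (1 - K) (v i))) \<in> low 0"
    "y - (\<Sum>i<r. scl (c i) (sh (1 - K) (v i))) \<in> low 0"
    by (auto simp: Z_def)
  have "x + y - (\<Sum>i<r. scl (b i + c i) (sh (1 - K) (v i)))
     = (x - (\<Sum>i<r. scl (b i) (sh (1 - K) (v i)))) + (y - (\<Sum>i<r. scl (c i) (sh (1 - K) (v i))))"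
    by (rule ext) (simp add: vec_apply sum_fun_apply lmul_apply single_add distrib_right sum.distrib)
  then have "x + y - (\<Sum>i<r. scl (b i + c i) (sh (1 - K) (v i))) \<in> low 0"
    using low_closed(1)[OF *(5,6)] by (simp only:)
  then show "x + y \<in> Z"
    using * unfolding Z_def by (intro CollectI conjI exI[of _ "\<lambda>i. b i + c i"]) auto
next
  fix a y assume a: "a \<in> F" and "y \<in> Z"
  then obtain c where *: "\<And>i. c i \<in> F" "y \<in> vecs"
    "y - (\<Sum>i<r. scl (c i) (sh (1 - K) (v i))) \<in> low 0"
    by (auto simp: Z_def)
  have "scl a y - (\<Sum>i<r. scl (a * c i) (sh (1 - K) (v i))) = scl a (y - (\<Sum>i<r. scl (c i) (sh (1 - K) (v i))))"
    by (simp add: lmul_diff lmul_sum mult_single)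
  then have "scl a y - (\<Sum>i<r. scl (a * c i) (sh (1 - K) (v i))) \<in> low 0"
    using low_closed(3)[OF a *(3)] by simp
  then show "scl a y \<in> Z"
    using * a unfolding Z_def by (intro CollectI conjI exI[of _ "\<lambda>i. a * c i"]) auto
qed (use low_Z low_closed(4) in \<open>auto simp: Z_def\<close>)

lemma sh_v_Z:
  assumes "i < r" "n \<le> 1 - K"
  shows "sh n (v i) \<in> Z"
proof (cases "n = 1 - K")
  case True
  have "(\<Sum>j<r. scl (if j = i then 1 else 0) (sh (1 - K) (v j))) = (\<Sum>j<r. if j = i then sh (1 - K) (v j) else 0)"
    by (intro sum.cong) auto
  then have "sh n (v i) - (\<Sum>j<r. scl (if j = i then 1 else 0) (sh (1 - K) (v j))) = 0"
    using True assms(1) by simp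
  then show ?thesis
    unfolding Z_def using v_vecs[OF assms(1)] low_closed(4)
    by (intro CollectI conjI exI[of _ "\<lambda>j. if j = i then 1 else 0"]) auto
next
  case False
  then show ?thesis
    using assms low_Z sh_v_low[of i n 0] by auto
qed

lemma v_orth: "i < r \<Longrightarrow> j < r \<Longrightarrow> m \<noteq> n \<Longrightarrow> ip (sh m (v i)) (sh n (v j)) = 0"
  by (simp add: ip_def form_v lookup_one)

lemma sh_v_L: "i < r \<Longrightarrow> n \<le> 1 - K \<Longrightarrow> sh n (v i) \<in> L"
  using sh_v_Z v_orth K by (auto simp: L_def simp del: lmul_lmul)

lemma sg_sh_v: "i < r \<Longrightarrow> sg (sh n (v i)) = scl (h i) (sh (d i - n) (v i))"
  by (simp add: sg_v mult_single)

lemma L_sh_v: "y \<in> L \<Longrightarrow> i < r \<Longrightarrow> n \<ge> K \<Longrightarrow> ip y (sh n (v i)) = 0"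
  by (simp add: L_def)

lemma sh_v_L': "y \<in> L \<Longrightarrow> i < r \<Longrightarrow> n \<ge> K \<Longrightarrow> ip (sh n (v i)) y = 0"
  using L_sh_v ip_eq_zero_commute by blast

lemma L_decomp:
  assumes "y \<in> L"
  obtains f c where "f \<in> low 0" "y = f + (\<Sum>i<r. scl (c i) (sh (1 - K) (v i)))"
proof -
  from assms obtain c where "y - (\<Sum>i<r. scl (c i) (sh (1 - K) (v i))) \<in> low 0"
    by (auto simp: L_def Z_def)
  then show ?thesis
    using that[of "y - (\<Sum>i<r. scl (c i) (sh (1 - K) (v i)))" c] by simp
qed

text \<open>Write both vectors as a \<open>low 0\<close> part plus added rows. Reflected added rows
  are shifts by at least \<open>K\<close> and hence orthogonal to \<open>L\<close>; they are
  orthogonal to the \<open>low 0\<close> part as well, because the rows are orthonormal. The two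
  \<open>low 0\<close> parts do not interact, as one of them is reflected to exponents
  \<open>k \<ge> 1\<close>.\<close>

lemma iso:
  assumes "x \<in> L" "y \<in> L"
  shows "ip x (sh 1 (sg y)) = 0"
proof -
  obtain f b where x: "f \<in> low 0" "x = f + (\<Sum>i<r. scl (b i) (sh (1 - K) (v i)))"
    using L_decomp[OF assms(1)] .
  obtain g c where y: "g \<in> low 0" "y = g + (\<Sum>i<r. scl (c i) (sh (1 - K) (v i)))"
    using L_decomp[OF assms(2)] .
  have sh_sg: "sh 1 (sg (f' + (\<Sum>i<r. scl (c' i) (sh (1 - K) (v i)))))
      = sh 1 (sg f') + (\<Sum>i<r. scl (c' i * h i) (sh (K + d i) (v i)))" for f' c'
    by (simp add: lmul_add lmul_sum sg_sum sg_v mult_single algebra_simps)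
  have zero: "ip (sh (K + d i) (v i)) y = 0" "ip x (sh (K + d i) (v i)) = 0" if "i < r" for i
    using L_sh_v[OF assms(1) that] sh_v_L'[OF assms(2) that] d[of i] by auto
  have g: "ip (sh (K + d i) (v i)) g = 0" if i: "i < r" for i
  proof -
    have "ip (sh (K + d i) (v i)) (sh (1 - K) (v j)) = 0" if "j < r" for j
    proof (rule v_orth[OF i that])
      \<comment> \<open>Here \<open>K \<ge> 1\<close> matters: for \<open>K = 0\<close> and
        \<open>d i = 1\<close> an added row would coincide with its mirror image up to sign.\<close>
      show "K + d i \<noteq> 1 - K"
      proof -
        have "d i \<ge> 0"
          using d[of i] by auto
        then show ?thesis
          using K by linarith
      qed
    qed
    moreover have "g = y - (\<Sum>j<r. scl (c j) (sh (1 - K) (v j)))"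
      by (simp add: y(2))
    ultimately show ?thesis
      using zero(1)[OF i] by (simp only: ip_simps ip_sum_right) simp
  qed
  have "ip (sh 1 (sg f)) g = 0"
  proof (rule ip_disjoint)
    fix j k
    show "coef (sh 1 (sg f) j) k = 0 \<or> coef (g j) k = 0"
    proof (rule ccontr)
      assume "\<not> ?thesis"
      then have "coef (f j) (- (k - 1) - tt j) \<noteq> 0" "coef (g j) k \<noteq> 0"
        by (auto simp: lmul_apply)
      from lowD(2)[OF x(1) this(1)] lowD(2)[OF y(1) this(2)] show False
        using tt[of j] by auto
    qed
  qed
  moreover have "ip (sh 1 (sg x)) g = ip (sh 1 (sg f)) g + (\<Sum>i<r. b i * h i * ip (sh (K + d i) (v i)) g)"
    unfolding x(2) sh_sg by (simp only: ip_simps ip_sum_left)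
  ultimately have "ip (sh 1 (sg x)) g = 0"
    using g by simp
  moreover have "ip x (sh 1 (sg g)) = ip (sh 1 (sg x)) g"
    by (simp add: ip_sh_left ip_sg)
  moreover have "ip x (sh 1 (sg y)) = ip x (sh 1 (sg g)) + (\<Sum>i<r. cnj (c i * h i) * ip x (sh (K + d i) (v i)))"
    unfolding y(2) sh_sg by (simp only: ip_simps ip_sum_right)
  ultimately show ?thesis
    using zero(2) by simp
qed

text \<open>Testing against reflected rows in \<open>L\<close> yields the orthogonality conditions.
  For membership in \<open>Z\<close>, let \<open>w\<close> be the component of \<open>x\<close>
  orthogonal to \<open>Z\<close>: being orthogonal to \<open>low 0\<close> and to the lowered rows,
  its reflection lies in \<open>L\<close>. Hence \<open>w\<close> is orthogonal to \<open>x\<close>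
  as well as to the projection of \<open>x\<close>, and therefore to itself.\<close>

lemma coiso:
  assumes x: "x \<in> vecs" and orth: "\<And>y. y \<in> L \<Longrightarrow> ip x (sg y) = 0"
  shows "x \<in> L"
proof -
  have "ip x (sh n (v i)) = 0" if "n \<ge> K" "i < r" for n i
  proof -
    have "sh (d i - n) (v i) \<in> L"
      using that d[of i] by (intro sh_v_L) auto
    then have "ip x (sg (sh (d i - n) (v i))) = 0"
      by (rule orth)
    then show ?thesis
      using that h[of i] by (auto simp only: sg_sh_v ip_simps) auto
  qed
  moreover have "x \<in> Z"
  proof -
    have "low (-1) \<subseteq> Z"
      using low_Z low_mono[of _ "-1" 0] by auto
    then obtain p where p: "p \<in> Z" "x - p \<in> perp Z"
      using sandwich_projection[OF Z_subsp Z_low _ x] by blast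
    define w where "w = x - p"
    have w: "w \<in> vecs" "\<And>y. y \<in> Z \<Longrightarrow> ip w y = 0"
      using p(2) by (auto simp: w_def perp_def)
    have pos: "k + tt j > 0" if "coef (w j) k \<noteq> 0" for j k
    proof (rule ccontr)
      have "j < s"
        using vecs_coef[OF w(1) that] .
      assume "\<not> k + tt j > 0"
      then have "unit_vec_at j k \<in> low 0"
        using \<open>j < s\<close> by (intro lowI) (auto simp: coef_unit_vec_at split: if_splits)
      then have "ip w (unit_vec_at j k) = 0"
        using w(2) low_Z by blast
      then show False
        using that \<open>j < s\<close> by (simp add: ip_unit_vec_at)
    qed
    have "sg w \<in> low 0"
    proof (rule lowI)
      show "k + tt j \<le> 0" if "coef (sg w j) k \<noteq> 0" for j k
        using pos[of j "- k - tt j"] that tt[of j] by auto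
    qed (use w(1) in blast)
    then have "sg w \<in> Z"
      using low_Z by blast
    moreover have "ip (sg w) (sh n (v i)) = 0" if "n \<ge> K" "i < r" for n i
    proof -
      have "sh (d i - n) (v i) \<in> Z"
        using that d[of i] by (intro sh_v_Z) auto
      then show ?thesis
        using that w(2) by (simp only: ip_sg sg_sh_v ip_simps) simp
    qed
    ultimately have "sg w \<in> L"
      by (simp add: L_def)
    then have "ip x w = 0"
      using orth by fastforce
    moreover have "ip p w = 0"
      using w(2)[OF p(1)] by (rule ip_eq_zero_commute)
    ultimately have "ip w w = 0"
      by (simp add: w_def)
    then have "w = 0"
      using w(1) by (rule ip_self_eq_zeroD)
    then show ?thesis
      using p(1) by (simp add: w_def)
  qed
  ultimately show ?thesis
    by (simp add: L_def)
qed

sublocale lattice: symmetric_lattice F s ep tt L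
proof
  have Z: "y \<in> vecs" if "y \<in> Z" for y
    using that by (simp add: Z_def)
  show "subsp L"
    using Z_subsp by (auto simp: L_def subsp_def Z)
  show "L \<subseteq> low 1"
    using Z_low by (auto simp: L_def)
  show "low (-1) \<subseteq> L"
  proof
    fix y assume y: "y \<in> low (-1)"
    have "ip y (sh n (v i)) = 0" if "n \<ge> K" "i < r" for n i
    proof (rule ip_disjoint)
      fix j k
      show "coef (y j) k = 0 \<or> coef (sh n (v i) j) k = 0"
      proof (rule ccontr)
        assume "\<not> ?thesis"
        then have "coef (y j) k \<noteq> 0" "coef (v i j) (k - n) \<noteq> 0"
          by (auto simp: lmul_apply)
        then show False
          using lowD(2)[OF y, of j k] v_supp[OF that(2), of j "k - n"] that(1) by linarith
      qed
    qed
    then show "y \<in> L"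
      using y low_Z low_mono[of y "-1" 0] by (auto simp: L_def)
  qed
  show "sh (-1) y \<in> L" if "y \<in> L" for y
  proof -
    have "y \<in> low 1"
      using that Z_low by (auto simp: L_def)
    then have "sh (-1) y \<in> Z"
      using low_sh[of y 1 "-1"] low_Z by auto
    moreover have "ip (sh (-1) y) (sh n (v i)) = 0" if "n \<ge> K" "i < r" for n i
      using L_sh_v[OF \<open>y \<in> L\<close> \<open>i < r\<close>, of "n + 1"] that by (simp add: ip_sh_left mult_single add.commute)
    ultimately show ?thesis
      by (simp add: L_def)
  qed
qed (fact iso coiso)+

lemma sh_v_perp: "i < r \<Longrightarrow> sh K (v i) \<in> perp L"
  using sh_v_L' v_vecs by (auto simp: perp_def)

text \<open>The coefficient of \<open>form (v i) a\<close> at \<open>k\<close> is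
  \<open>ip (v i) (sh k a)\<close>. It vanishes for large \<open>k\<close> because
  \<open>sh (1 - K) (v i)\<close> lies in \<open>L\<close>, and for small \<open>k\<close> because
  \<open>sh K (v i)\<close> is orthogonal to \<open>L\<close>; each end loses one.\<close>

lemma reduced_support:
  assumes i: "i < r" and a: "a \<in> lattice.H e t" "e \<in> {-1, 1}" "t \<in> {0, 1}" and nz: "coef (form (v i) a) k \<noteq> 0"
  shows "- (K - 1) \<le> k + t \<and> k + t \<le> K - 1"
proof -
  have vL: "sh (1 - K) (v i) \<in> L"
    using i by (intro sh_v_L) auto
  have shift: "ip (v i) (sh k a) = ip (sh m (v i)) (sh (k + m) a)" for k m
    by (simp add: ip_def mult_single)
  have up: "ip (v i) (sh k a) = 0" if k: "k + t \<ge> K" for k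
  proof (cases "t = 0")
    case True
    then have "sg a = scl e a" "a \<in> L"
      using a(1) by (auto simp: lattice.H_def)
    then have "a = scl e (sg a)"
      using a(2) by (auto simp: mult_single)
    then have "ip (v i) (sh k a) = ip (sh (1 - K) (v i)) (sh (k + (1 - K)) (scl e (sg a)))"
      using shift[of k "1 - K"] by metis
    also have "\<dots> = ip (sh (1 - K) (v i)) (scl e (sh (k + (1 - K)) (sg a)))"
      by (simp add: mult_single)
    also have "\<dots> = 0"
      using lattice.L_iso_sh[OF vL \<open>a \<in> L\<close>, of "k + (1 - K)"] k True by (simp del: lmul_lmul)
    finally show ?thesis .
  next
    case False
    then have "sh (k + (1 - K)) a \<in> perp L"
      using a(1,3) k by (intro lattice.perp_sh) (auto simp: lattice.H_def)
    then show ?thesis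
      using lattice.ip_perp[OF vL] shift by metis
  qed
  have "ip (v i) (sh k a) = 0" if k: "k + t \<le> - K" for k
  proof (cases "t = 0")
    case True
    then have "sh (k + K) a \<in> L"
      using a(1) k by (intro lattice.L_sh) (auto simp: lattice.H_def)
    then have "ip (sh K (v i)) (sh (k + K) a) = 0"
      using sh_v_perp[OF i] by (simp add: perp_def)
    then show ?thesis
      using shift by metis
  next
    case False
    then have "t = 1"
      using a(3) by simp
    \<comment> \<open>For \<open>t = 1\<close> the lower bound is the upper bound seen through the
      isometry \<open>sg\<close>; the extra shift by \<open>d i\<close> does no harm, since
      \<open>d i \<le> 1\<close>.\<close>
    have "ip (v i) (sh k a) = ip (sg (v i)) (sg (sh k a))"
      by (rule ip_sg_sg[symmetric])
    also have "\<dots> = ip (lmul (mon (d i) (h i)) (v i)) (sh (- k) (lmul (mon (-1) e) a))"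
      using a(1) \<open>t = 1\<close> by (simp add: sg_v[OF i] lattice.H_def)
    also have "\<dots> = h i * cnj e * ip (v i) (sh (- k - 1 - d i) a)"
      by (simp add: ip_def mult_single diff_diff_eq flip: mult.assoc) (simp add: ac_simps)
    also have "ip (v i) (sh (- k - 1 - d i) a) = 0"
      using k \<open>t = 1\<close> d[of i] by (intro up) auto
    finally show ?thesis
      by simp
  qed
  with up[of k] nz show ?thesis
    by (force simp: ip_sh_right)
qed

end


section \<open>Elementary factorization of matrices\<close>

definition trow :: "nat \<Rightarrow> (nat \<Rightarrow> complex) \<Rightarrow> (nat \<Rightarrow> int) \<Rightarrow> laurent mat" where
  "trow n e c = mat 1 n (\<lambda>(_, j). mon (c j) (e j))"

text \<open>Compatible symmetry with left row \<open>e i z^(c i)\<close> and right row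
  \<open>e' j z^(c' j)\<close>, as an equation for each entry. Zero entries satisfy it for all rows,
  so it passes to products without a choice of symmetry values for them.\<close>

definition msym ::
  "(nat \<Rightarrow> complex) \<Rightarrow> (nat \<Rightarrow> int) \<Rightarrow> (nat \<Rightarrow> complex) \<Rightarrow> (nat \<Rightarrow> int) \<Rightarrow> laurent mat \<Rightarrow> bool" where
  "msym e c e' c' M \<longleftrightarrow> (\<forall>i<dim_row M. \<forall>j<dim_col M.
     M $$ (i, j) = mon (c' j - c i) (e i * e' j) * laurent_reflect (M $$ (i, j)))"

lemma mat_mult_index:
  assumes "A \<in> carrier_mat m n" "B \<in> carrier_mat n p" "i < m" "j < p"
  shows "(A * B) $$ (i, j) = (\<Sum>l<n. A $$ (i, l) * B $$ (l, j))"
  using assms by (auto simp: scalar_prod_def lessThan_atLeast0 intro!: sum.cong)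

lemma mat_adj_carrier [simp]: "A \<in> carrier_mat m n \<Longrightarrow> mat_adj A \<in> carrier_mat n m"
  and mat_adj_dim [simp]: "dim_row (mat_adj A) = dim_col A" "dim_col (mat_adj A) = dim_row A"
  and mat_adj_index [simp]: "i < dim_col A \<Longrightarrow> j < dim_row A \<Longrightarrow> mat_adj A $$ (i, j) = laurent_adj (A $$ (j, i))"
  by (auto simp: mat_adj_def)

lemma mat_adj_adj [simp]: "mat_adj (mat_adj A) = A"
  by (intro eq_matI) auto

lemma mat_adj_mult:
  assumes "A \<in> carrier_mat m n" "B \<in> carrier_mat n p"
  shows "mat_adj (A * B) = mat_adj B * mat_adj A"
proof (rule eq_matI)
  fix i j assume "i < dim_row (mat_adj B * mat_adj A)" "j < dim_col (mat_adj B * mat_adj A)"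
  then have ij: "i < p" "j < m"
    using assms by auto
  have "mat_adj (A * B) $$ (i, j) = laurent_adj (\<Sum>l<n. A $$ (j, l) * B $$ (l, i))"
    using ij assms by (subst mat_adj_index) (simp_all add: mat_mult_index[OF assms] del: index_mult_mat(1))
  also have "\<dots> = (mat_adj B * mat_adj A) $$ (i, j)"
    using ij assms by (subst mat_mult_index[of _ p n _ m]) (auto simp: mult.commute intro!: sum.cong)
  finally show "mat_adj (A * B) $$ (i, j) = (mat_adj B * mat_adj A) $$ (i, j)" .
qed (use assms in auto)

text \<open>Evaluation at nonzero points is multiplicative and jointly injective, so the pointwise
  identity is an identity over the Laurent ring.\<close>

lemma paraunitary_iff: "paraunitary P \<longleftrightarrow> P * mat_adj P = 1\<^sub>m (dim_row P)"
proof -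
  define m n where "m = dim_row P" and "n = dim_col P"
  have P: "P \<in> carrier_mat m n"
    by (simp add: m_def n_def)
  have eval: "mat_eval P z * mat_eval (mat_adj P) z = mat_eval (P * mat_adj P) z" if "z \<noteq> 0" for z
  proof (rule eq_matI)
    fix i j assume "i < dim_row (mat_eval (P * mat_adj P) z)" "j < dim_col (mat_eval (P * mat_adj P) z)"
    then have ij: "i < m" "j < m"
      using P by (auto simp: mat_eval_def)
    have "mat_eval P z \<in> carrier_mat m n" "mat_eval (mat_adj P) z \<in> carrier_mat n m"
      using P by (auto simp: mat_eval_def)
    then have "(mat_eval P z * mat_eval (mat_adj P) z) $$ (i, j)
        = (\<Sum>l<n. mat_eval P z $$ (i, l) * mat_eval (mat_adj P) z $$ (l, j))"
      using ij by (rule mat_mult_index)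
    also have "\<dots> = laurent_eval (\<Sum>l<n. P $$ (i, l) * mat_adj P $$ (l, j)) z"
      using P ij that by (auto simp: mat_eval_def intro!: sum.cong)
    also have "\<dots> = mat_eval (P * mat_adj P) z $$ (i, j)"
      using P ij by (simp add: mat_eval_def mat_mult_index[OF P mat_adj_carrier[OF P]] del: index_mult_mat(1))
    finally show "(mat_eval P z * mat_eval (mat_adj P) z) $$ (i, j) = mat_eval (P * mat_adj P) z $$ (i, j)" .
  qed (auto simp: mat_eval_def)
  have one: "mat_eval (1\<^sub>m m) z = 1\<^sub>m m" for z
    by (intro eq_matI) (auto simp: mat_eval_def)
  have "P * mat_adj P = 1\<^sub>m m" if *: "\<And>z. z \<noteq> 0 \<Longrightarrow> mat_eval (P * mat_adj P) z = 1\<^sub>m m"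
  proof (rule eq_matI)
    fix i j assume "i < dim_row (1\<^sub>m m)" "j < dim_col (1\<^sub>m m)"
    then have ij: "i < m" "j < m"
      by auto
    show "(P * mat_adj P) $$ (i, j) = 1\<^sub>m m $$ (i, j)"
    proof (rule eval_eqI)
      fix z :: complex assume "z \<noteq> 0"
      then have "mat_eval (P * mat_adj P) z $$ (i, j) = mat_eval (1\<^sub>m m) z $$ (i, j)"
        unfolding *[OF \<open>z \<noteq> 0\<close>] one by simp
      then show "laurent_eval ((P * mat_adj P) $$ (i, j)) z = laurent_eval (1\<^sub>m m $$ (i, j)) z"
        using ij P by (simp add: mat_eval_def del: index_mult_mat(1) index_one_mat(1))
    qed
  qed (use P in auto)
  then show ?thesis
    unfolding paraunitary_def m_def[symmetric] using eval one by auto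
qed

lemma paraunitary_mult:
  assumes "A \<in> carrier_mat m n" "B \<in> carrier_mat n p" "A * mat_adj A = 1\<^sub>m m" "B * mat_adj B = 1\<^sub>m n"
  shows "(A * B) * mat_adj (A * B) = 1\<^sub>m m"
proof -
  have "(A * B) * mat_adj (A * B) = A * (B * (mat_adj B * mat_adj A))"
    unfolding mat_adj_mult[OF assms(1,2)] using assms(1,2) by (intro assoc_mult_mat) auto
  also have "B * (mat_adj B * mat_adj A) = (B * mat_adj B) * mat_adj A"
    using assms(1,2) by (intro assoc_mult_mat[symmetric]) auto
  also have "A * ((B * mat_adj B) * mat_adj A) = 1\<^sub>m m"
    using assms by simp
  finally show ?thesis .
qed

lemma msym_mult:
  assumes A: "A \<in> carrier_mat m n" "msym e c e1 c1 A" and B: "B \<in> carrier_mat n p" "msym e1 c1 e2 c2 B"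
    and e1: "\<And>j. j < n \<Longrightarrow> e1 j \<in> {-1, 1}"
  shows "msym e c e2 c2 (A * B)"
  unfolding msym_def
proof (intro allI impI)
  fix i j assume "i < dim_row (A * B)" "j < dim_col (A * B)"
  then have ij: "i < m" "j < p"
    using A B by auto
  have "A $$ (i, l) * B $$ (l, j) = mon (c2 j - c i) (e i * e2 j) * laurent_reflect (A $$ (i, l) * B $$ (l, j))"
    if "l < n" for l
  proof -
    have "A $$ (i, l) = mon (c1 l - c i) (e i * e1 l) * laurent_reflect (A $$ (i, l))"
      "B $$ (l, j) = mon (c2 j - c1 l) (e1 l * e2 j) * laurent_reflect (B $$ (l, j))"
      using A B ij that by (auto simp: msym_def)
    then have "A $$ (i, l) * B $$ (l, j) = (mon (c1 l - c i) (e i * e1 l) * laurent_reflect (A $$ (i, l))) *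
        (mon (c2 j - c1 l) (e1 l * e2 j) * laurent_reflect (B $$ (l, j)))"
      by (rule arg_cong2)
    also have "\<dots> = (mon (c1 l - c i) (e i * e1 l) * mon (c2 j - c1 l) (e1 l * e2 j)) *
        laurent_reflect (A $$ (i, l) * B $$ (l, j))"
      by (simp add: ac_simps)
    also have "mon (c1 l - c i) (e i * e1 l) * mon (c2 j - c1 l) (e1 l * e2 j) = mon (c2 j - c i) (e i * e2 j)"
      using e1[OF that] by (auto simp: mult_single)
    finally show ?thesis .
  qed
  then have "(\<Sum>l<n. A $$ (i, l) * B $$ (l, j))
     = (\<Sum>l<n. mon (c2 j - c i) (e i * e2 j) * laurent_reflect (A $$ (i, l) * B $$ (l, j)))"
    by (intro sum.cong refl) (simp only: lessThan_iff)
  then show "(A * B) $$ (i, j) = mon (c2 j - c i) (e i * e2 j) * laurent_reflect ((A * B) $$ (i, j))"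
    unfolding mat_mult_index[OF A(1) B(1) ij] reflect_sum sum_distrib_left .
qed

lemma mat_chain_carrier: "(\<And>m. m \<le> n \<Longrightarrow> R m \<in> carrier_mat s s) \<Longrightarrow> mat_chain R n \<in> carrier_mat s s"
  by (induction n) (simp_all add: mult_carrier_mat[of _ s s])

lemma mat_chain_Suc_left:
  assumes "\<And>m. m \<le> Suc n \<Longrightarrow> R m \<in> carrier_mat s s"
  shows "mat_chain R (Suc n) = mat_chain (\<lambda>m. R (Suc m)) n * R 0"
  using assms
proof (induction n)
  case (Suc n)
  have "mat_chain R (Suc (Suc n)) = R (Suc (Suc n)) * (mat_chain (\<lambda>m. R (Suc m)) n * R 0)"
    using Suc by simp
  also have "\<dots> = (R (Suc (Suc n)) * mat_chain (\<lambda>m. R (Suc m)) n) * R 0"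
    using Suc.prems mat_chain_carrier[of n "\<lambda>m. R (Suc m)" s] by (intro assoc_mult_mat[symmetric]) auto
  finally show ?case
    by simp
qed simp

context symmetric_space
begin

section \<open>Dictionary between matrices and families of row vectors\<close>

definition row_vec :: "laurent mat \<Rightarrow> nat \<Rightarrow> lvec" where
  "row_vec Q i = (\<lambda>j. if j < s then Q $$ (i, j) else 0)"

definition rows_mat :: "nat \<Rightarrow> (nat \<Rightarrow> lvec) \<Rightarrow> laurent mat" where
  "rows_mat m a = mat m s (\<lambda>(i, j). a i j)"

lemma rows_mat_carrier [simp]: "rows_mat m a \<in> carrier_mat m s"
  by (simp add: rows_mat_def)

lemma rows_mat_coeffs: "(\<And>i. i < m \<Longrightarrow> a i \<in> vecs) \<Longrightarrow> coeffs_in F (rows_mat m a)"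
  by (auto simp: coeffs_in_def rows_mat_def vecs_def FL_def)

lemma rows_mat_row_vec: "Q \<in> carrier_mat m s \<Longrightarrow> rows_mat m (row_vec Q) = Q"
  by (intro eq_matI) (auto simp: rows_mat_def row_vec_def)

lemma row_vec_vecs: "Q \<in> carrier_mat m s \<Longrightarrow> coeffs_in F Q \<Longrightarrow> i < m \<Longrightarrow> row_vec Q i \<in> vecs"
  by (auto simp: coeffs_in_def row_vec_def vecs_def FL_def)

lemma rows_mat_adj_mult:
  "rows_mat m a * mat_adj (rows_mat n b) = mat m n (\<lambda>(i, j). form (a i) (b j))"
proof (rule eq_matI)
  fix i j assume "i < dim_row (mat m n (\<lambda>(i, j). form (a i) (b j)))" "j < dim_col (mat m n (\<lambda>(i, j). form (a i) (b j)))"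
  then have ij: "i < m" "j < n"
    by auto
  have "(rows_mat m a * mat_adj (rows_mat n b)) $$ (i, j)
      = (\<Sum>l<s. rows_mat m a $$ (i, l) * mat_adj (rows_mat n b) $$ (l, j))"
    using ij by (intro mat_mult_index) auto
  also have "\<dots> = form (a i) (b j)"
    using ij by (simp add: rows_mat_def form_def)
  finally show "(rows_mat m a * mat_adj (rows_mat n b)) $$ (i, j) = mat m n (\<lambda>(i, j). form (a i) (b j)) $$ (i, j)"
    using ij by simp
qed (simp_all add: rows_mat_def)

lemma rows_mat_unitary:
  "(\<And>i j. i < m \<Longrightarrow> j < m \<Longrightarrow> form (a i) (a j) = (if i = j then 1 else 0)) \<Longrightarrow>
    rows_mat m a * mat_adj (rows_mat m a) = 1\<^sub>m m"
  unfolding rows_mat_adj_mult by (intro eq_matI) auto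

lemma form_row_vec:
  assumes "Q \<in> carrier_mat m s" "Q * mat_adj Q = 1\<^sub>m m" "i < m" "j < m"
  shows "form (row_vec Q i) (row_vec Q j) = (if i = j then 1 else 0)"
proof -
  have "(rows_mat m (row_vec Q) * mat_adj (rows_mat m (row_vec Q))) $$ (i, j) = 1\<^sub>m m $$ (i, j)"
    using assms(1,2) by (simp add: rows_mat_row_vec)
  then show ?thesis
    unfolding rows_mat_adj_mult using assms(3,4) by simp
qed

lemma sg_row_vec:
  assumes "Q \<in> carrier_mat m s" "msym h (\<lambda>i. - d i) ep (\<lambda>j. - tt j) Q" "h i \<in> {-1, 1}" "i < m"
  shows "sg (row_vec Q i) = lmul (mon (- d i) (h i)) (row_vec Q i)"
proof
  fix j
  show "sg (row_vec Q i) j = lmul (mon (- d i) (h i)) (row_vec Q i) j"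
  proof (cases "j < s")
    case True
    define q where "q = laurent_reflect (Q $$ (i, j))"
    have "Q $$ (i, j) = mon (d i - tt j) (h i * ep j) * q"
      using assms True by (auto simp: msym_def q_def)
    then have "mon (- d i) (h i) * Q $$ (i, j) = (mon (- d i) (h i) * mon (d i - tt j) (h i * ep j)) * q"
      by (simp add: mult.assoc)
    also have "mon (- d i) (h i) * mon (d i - tt j) (h i * ep j) = mon (- tt j) (ep j)"
      using assms(3) by (auto simp: mult_single)
    finally show ?thesis
      using True by (simp add: sg_def row_vec_def lmul_apply q_def)
  qed (simp add: sg_def row_vec_def lmul_apply)
qed

lemma rows_mat_msym:
  assumes "\<And>i. i < m \<Longrightarrow> sg (a i) = lmul (mon (- t i) (e i)) (a i)" "\<And>i. e i \<in> {-1, 1}"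
  shows "msym e (\<lambda>i. - t i) ep (\<lambda>j. - tt j) (rows_mat m a)"
  unfolding msym_def
proof (intro allI impI)
  fix i j assume "i < dim_row (rows_mat m a)" "j < dim_col (rows_mat m a)"
  then have ij: "i < m" "j < s"
    by (auto simp: rows_mat_def)
  have "mon (- tt j) (ep j) * laurent_reflect (a i j) = mon (- t i) (e i) * a i j"
    using fun_cong[OF assms(1)[OF ij(1)], of j] by (simp add: sg_def lmul_apply)
  then have "mon (t i) (e i) * (mon (- tt j) (ep j) * laurent_reflect (a i j)) = mon (t i) (e i) * (mon (- t i) (e i) * a i j)"
    by simp
  also have "\<dots> = a i j"
    using assms(2)[of i] by (auto simp: mult_single simp flip: mult.assoc)
  finally show "rows_mat m a $$ (i, j) = mon (- tt j - - t i) (e i * ep j) * laurent_reflect (rows_mat m a $$ (i, j))"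
    using ij by (simp add: rows_mat_def mult_single flip: mult.assoc)
qed

lemma parseval:
  assumes expand: "\<And>v. v \<in> vecs \<Longrightarrow> v = (\<Sum>i<s. lmul (form v (a i)) (a i))" and "w \<in> vecs"
  shows "form v w = (\<Sum>l<s. form v (a l) * laurent_adj (form w (a l)))"
proof -
  have "form v w = form v (\<Sum>l<s. lmul (form w (a l)) (a l))"
    using expand[OF assms(2)] by (rule arg_cong)
  then show ?thesis
    by (simp add: mult.commute)
qed

text \<open>The rows of \<open>A\<close> are the basis of the lattice made from the rows of
  \<open>Q\<close>, and \<open>Q'\<close> holds the coordinates of the rows of \<open>Q\<close> in
  it. Parseval preserves orthonormality, and the eigenvalue equations turn into the symmetry of
  \<open>A\<close> and \<open>Q'\<close>.\<close>

lemma degree_reduction: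
  assumes Q: "Q \<in> carrier_mat r s" "coeffs_in F Q" "Q * mat_adj Q = 1\<^sub>m r"
    and h: "\<And>i. h i \<in> {-1, 1}" and d: "\<And>i. d i \<in> {0, 1}"
    and sym: "msym h (\<lambda>i. - d i) ep (\<lambda>j. - tt j) Q"
    and supp: "\<And>i j k. i < r \<Longrightarrow> j < s \<Longrightarrow> coef (Q $$ (i, j)) k \<noteq> 0 \<Longrightarrow> - K \<le> k - d i + tt j \<and> k - d i + tt j \<le> K"
    and K: "K \<ge> 1"
  obtains A Q' e t where "A \<in> carrier_mat s s" "coeffs_in F A" "A * mat_adj A = 1\<^sub>m s"
    "\<And>i. e i \<in> {-1, 1}" "\<And>i. t i \<in> {0, 1}"
    "msym e (\<lambda>i. - t i) ep (\<lambda>j. - tt j) A"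
    "\<And>i j k. i < s \<Longrightarrow> j < s \<Longrightarrow> coef (A $$ (i, j)) k \<noteq> 0 \<Longrightarrow> - 1 \<le> k \<and> k \<le> 1"
    "Q' \<in> carrier_mat r s" "coeffs_in F Q'" "Q' * mat_adj Q' = 1\<^sub>m r"
    "msym h (\<lambda>i. - d i) e (\<lambda>j. - t j) Q'"
    "\<And>i j k. i < r \<Longrightarrow> j < s \<Longrightarrow> coef (Q' $$ (i, j)) k \<noteq> 0 \<Longrightarrow> - (K - 1) \<le> k - d i + t j \<and> k - d i + t j \<le> K - 1"
    "Q = Q' * A"
proof -
  define u where "u = row_vec Q"
  have u_vecs: "u i \<in> vecs" if "i < r" for i
    unfolding u_def using Q(1,2) that by (rule row_vec_vecs)
  have form_u: "form (u i) (u j) = (if i = j then 1 else 0)" if "i < r" "j < r" for i j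
    unfolding u_def using Q(1,3) that by (rule form_row_vec)
  have sg_u: "sg (u i) = lmul (mon (- d i) (h i)) (u i)" if "i < r" for i
    unfolding u_def using Q(1) sym h that by (rule sg_row_vec)
  \<comment> \<open>The shift makes the supports independent of \<open>d i\<close>: heights in
    \<open>v i\<close> lie between \<open>- K\<close> and \<open>K\<close>. It turns the symmetry
    factor \<open>z^(- d i)\<close> into \<open>z^(d i)\<close>.\<close>
  define v where "v i = sh (- d i) (u i)" for i
  interpret rows: symmetric_rows F s ep tt r v h d K
  proof
    show "h i \<in> {-1, 1}" "d i \<in> {0, 1}" for i
      by (rule h d)+
    show "v i \<in> vecs" if "i < r" for i
      using u_vecs[OF that] by (simp add: v_def)
    show "sg (v i) = lmul (mon (d i) (h i)) (v i)" if "i < r" for i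
      using that by (simp add: v_def sg_u mult_single)
    show "form (v i) (v j) = (if i = j then 1 else 0)" if "i < r" "j < r" for i j
      using that by (simp add: v_def form_u mult_single)
    show "- K \<le> k + tt j \<and> k + tt j \<le> K" if "i < r" "coef (v i j) k \<noteq> 0" for i j k
      using supp[OF that(1), of j "k + d i"] that(2)
      by (auto simp: v_def lmul_apply u_def row_vec_def split: if_splits)
  qed (rule K)
  obtain a e t where e: "\<And>i. e i \<in> {-1, 1}" and t: "\<And>i. t i \<in> {0, 1}"
    and a: "\<And>i. i < s \<Longrightarrow> a i \<in> rows.lattice.H (e i) (t i)"
    and on: "\<And>i j. i < s \<Longrightarrow> j < s \<Longrightarrow> form (a i) (a j) = (if i = j then 1 else 0)"
    and expand: "\<And>v. v \<in> vecs \<Longrightarrow> v = (\<Sum>i<s. lmul (form v (a i)) (a i))"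
    \<comment> \<open>No vector is prescribed here; the rows of \<open>Q\<close> enter through the
      lattice alone.\<close>
    by (rule rows.lattice.enumerated_frame_extension[of 0 u h d]) (use h d in auto)
  have a_vecs: "a i \<in> vecs" if "i < s" for i
    using a[OF that] by (rule rows.lattice.H_vecs)
  have sg_a: "sg (a i) = lmul (mon (- t i) (e i)) (a i)" if "i < s" for i
    using a[OF that] by (simp add: rows.lattice.H_def)
  define A where "A = rows_mat s a"
  define Q' where "Q' = mat r s (\<lambda>(i, l). form (u i) (a l))"
  have Q': "Q' \<in> carrier_mat r s"
    by (simp add: Q'_def)
  show ?thesis
  proof (rule that[of A e t Q'])
    show "A \<in> carrier_mat s s" "coeffs_in F A" "A * mat_adj A = 1\<^sub>m s"
      using rows_mat_coeffs a_vecs rows_mat_unitary on by (auto simp: A_def)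
    show "msym e (\<lambda>i. - t i) ep (\<lambda>j. - tt j) A"
      unfolding A_def using sg_a e by (rule rows_mat_msym)
    show "- 1 \<le> k \<and> k \<le> 1" if "i < s" "j < s" "coef (A $$ (i, j)) k \<noteq> 0" for i j k
      using rows.lattice.H_supp(2,3)[OF a[OF that(1)] e t, of j k] that by (simp add: A_def rows_mat_def)
    show "coeffs_in F Q'"
      using form_in_FL[OF u_vecs a_vecs] by (auto simp: coeffs_in_def Q'_def FL_def)
    show "Q' * mat_adj Q' = 1\<^sub>m r"
    proof (rule eq_matI)
      fix i j assume "i < dim_row (1\<^sub>m r)" "j < dim_col (1\<^sub>m r)"
      then have ij: "i < r" "j < r"
        by auto
      have "(Q' * mat_adj Q') $$ (i, j) = (\<Sum>l<s. Q' $$ (i, l) * mat_adj Q' $$ (l, j))"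
        using Q' ij by (intro mat_mult_index) auto
      also have "\<dots> = (\<Sum>l<s. form (u i) (a l) * laurent_adj (form (u j) (a l)))"
        using ij by (intro sum.cong) (auto simp: Q'_def)
      also have "\<dots> = form (u i) (u j)"
        using parseval[OF expand u_vecs[OF ij(2)]] by simp
      finally show "(Q' * mat_adj Q') $$ (i, j) = 1\<^sub>m r $$ (i, j)"
        using ij form_u by simp
    qed (use Q' in auto)
    show "msym h (\<lambda>i. - d i) e (\<lambda>j. - t j) Q'"
      unfolding msym_def
    proof (intro allI impI)
      fix i j assume "i < dim_row Q'" "j < dim_col Q'"
      then have ij: "i < r" "j < s"
        by (auto simp: Q'_def)
      have "laurent_reflect (form (u i) (a j)) = form (sg (u i)) (sg (a j))"
        by (rule form_sg[symmetric])
      also have "\<dots> = mon (- d i) (h i) * mon (t j) (e j) * form (u i) (a j)"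
        using e[of j] by (auto simp: sg_u[OF ij(1)] sg_a[OF ij(2)] ac_simps)
      finally have "mon (- t j - - d i) (h i * e j) * laurent_reflect (form (u i) (a j))
          = (mon (- t j - - d i) (h i * e j) * (mon (- d i) (h i) * mon (t j) (e j))) * form (u i) (a j)"
        by (simp add: mult.assoc)
      also have "mon (- t j - - d i) (h i * e j) * (mon (- d i) (h i) * mon (t j) (e j)) = 1"
        using h[of i] e[of j] by (auto simp: mult_single)
      finally show "Q' $$ (i, j) = mon (- t j - - d i) (h i * e j) * laurent_reflect (Q' $$ (i, j))"
        using ij by (simp add: Q'_def)
    qed
    show "- (K - 1) \<le> k - d i + t j \<and> k - d i + t j \<le> K - 1"
      if "i < r" "j < s" "coef (Q' $$ (i, j)) k \<noteq> 0" for i j k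
    proof -
      have "coef (form (v i) (a j)) (k - d i) \<noteq> 0"
        using that by (simp add: Q'_def v_def)
      then show ?thesis
        by (rule rows.reduced_support[OF that(1) a[OF that(2)] e t])
    qed
    show "Q = Q' * A"
    proof (rule eq_matI)
      fix i j assume "i < dim_row (Q' * A)" "j < dim_col (Q' * A)"
      then have ij: "i < r" "j < s"
        by (auto simp: Q'_def A_def rows_mat_def)
      have "Q $$ (i, j) = u i j"
        using ij by (simp add: u_def row_vec_def)
      also have "\<dots> = (\<Sum>l<s. lmul (form (u i) (a l)) (a l)) j"
        using expand[OF u_vecs[OF ij(1)]] by (rule fun_cong)
      also have "\<dots> = (\<Sum>l<s. Q' $$ (i, l) * A $$ (l, j))"
        using ij by (simp add: sum_fun_apply lmul_apply Q'_def A_def rows_mat_def)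
      also have "\<dots> = (Q' * A) $$ (i, j)"
        using ij Q' by (intro mat_mult_index[symmetric]) (auto simp: A_def)
      finally show "Q $$ (i, j) = (Q' * A) $$ (i, j)" .
    qed (use Q Q' in \<open>auto simp: A_def rows_mat_def\<close>)
  qed (rule e t Q')+
qed

text \<open>Once the extent is 0, the rows are eigenvectors of the standard lattice
  \<open>low 0\<close>, so the frame extension with these rows prescribed completes them to a square
  matrix. All eigenvectors of that lattice are constant.\<close>

lemma constant_completion:
  assumes Q: "Q \<in> carrier_mat r s" "coeffs_in F Q" "Q * mat_adj Q = 1\<^sub>m r"
    and h: "\<And>i. h i \<in> {-1, 1}" and d: "\<And>i. d i \<in> {0, 1}"
    and sym: "msym h (\<lambda>i. - d i) ep (\<lambda>j. - tt j) Q"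
    and supp: "\<And>i j k. i < r \<Longrightarrow> j < s \<Longrightarrow> coef (Q $$ (i, j)) k \<noteq> 0 \<Longrightarrow> k - d i + tt j = 0"
  obtains C e t where "r \<le> s" "C \<in> carrier_mat s s" "coeffs_in F C" "C * mat_adj C = 1\<^sub>m s"
    "\<And>i. e i \<in> {-1, 1}" "\<And>i. t i \<in> {0, 1}" "\<And>i. i < r \<Longrightarrow> e i = h i \<and> t i = d i"
    "msym e (\<lambda>i. - t i) ep (\<lambda>j. - tt j) C"
    "\<And>i j k. i < s \<Longrightarrow> j < s \<Longrightarrow> coef (C $$ (i, j)) k \<noteq> 0 \<Longrightarrow> k = 0"
    "Q = mat r s (\<lambda>(i, j). if i = j then 1 else 0) * C"
proof -
  define u where "u = row_vec Q"
  have u_vecs: "u i \<in> vecs" if "i < r" for i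
    unfolding u_def using Q(1,2) that by (rule row_vec_vecs)
  have form_u: "form (u i) (u j) = (if i = j then 1 else 0)" if "i < r" "j < r" for i j
    unfolding u_def using Q(1,3) that by (rule form_row_vec)
  have sg_u: "sg (u i) = lmul (mon (- d i) (h i)) (u i)" if "i < r" for i
    unfolding u_def using Q(1) sym h that by (rule sg_row_vec)
  \<comment> \<open>The only admissible exponent is \<open>d i - tt j\<close>, and the symmetry maps
    the exponent \<open>k\<close> to \<open>d i - tt j - k\<close>. Both must agree, so nonzero
    entries are constant and join a row and a column of equal parity.\<close>
  have u_const: "k = 0 \<and> d i = tt j" if "i < r" "coef (u i j) k \<noteq> 0" for i j k
  proof -
    have supp': "m - d i + tt j = 0" if "coef (u i j) m \<noteq> 0" for m
      using supp[OF \<open>i < r\<close>, of j m] that by (auto simp: u_def row_vec_def split: if_splits)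
    have "coef (sg (u i) j) (k - d i) = coef (lmul (mon (- d i) (h i)) (u i) j) (k - d i)"
      by (simp add: sg_u[OF that(1)])
    then have "coef (u i j) (- (k - d i) - tt j) \<noteq> 0"
      using that(2) h[of i] by (auto simp: lmul_apply)
    from supp'[OF this] supp'[OF that(2)] show ?thesis
      by auto
  qed
  \<comment> \<open>With no rows nothing is added or cut away, and the lattice is
    \<open>low 0\<close>.\<close>
  interpret rows: symmetric_rows F s ep tt 0 u h d 1
    by unfold_locales (use h d in auto)
  have L: "rows.L = low 0"
    by (auto simp: rows.L_def rows.Z_def lowD)
  have H_const: "k = 0" if "a \<in> rows.lattice.H e t" "e \<in> {-1, 1}" "t \<in> {0, 1}" "coef (a j) k \<noteq> 0" for a e t j k
  proof -
    have partner: "coef (a j) (- (k - t) - tt j) \<noteq> 0"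
      using that(1,2,4) by (rule rows.lattice.H_coef_partner)
    have "j < s"
      using that(1,2,3,4) by (rule rows.lattice.H_supp(1))
    show ?thesis
    proof (cases "t = 0")
      case True
      then have "a \<in> low 0"
        using that(1) unfolding rows.lattice.H_def unfolding L by simp
      from lowD(2)[OF this that(4)] lowD(2)[OF this partner] show ?thesis
        using True tt[of j] by auto
    next
      case False
      then have a: "a \<in> perp (low 0)"
        using that(1) unfolding rows.lattice.H_def unfolding L by simp
      have "m + tt j > 0" if m: "coef (a j) m \<noteq> 0" for m
      proof (rule ccontr)
        assume "\<not> m + tt j > 0"
        then have "unit_vec_at j m \<in> low 0"
          using \<open>j < s\<close> by (intro lowI) (auto simp: coef_unit_vec_at split: if_splits)
        then have "ip a (unit_vec_at j m) = 0"
          using a by (simp add: perp_def)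
        then show False
          using m \<open>j < s\<close> by (simp add: ip_unit_vec_at)
      qed
      from this[OF that(4)] this[OF partner] show ?thesis
        using False that(3) tt[of j] by auto
    qed
  qed
  have u_H: "u i \<in> rows.lattice.H (h i) (d i)" if i: "i < r" for i
  proof -
    have "u i \<in> low 0" if "d i = 0"
      using u_vecs[OF i] u_const[OF i] that by (intro lowI) auto
    moreover have "u i \<in> perp (low 0)" if "d i \<noteq> 0"
      unfolding perp_def
    proof (intro CollectI conjI ballI ip_disjoint)
      fix y j k assume y: "y \<in> low 0"
      show "coef (u i j) k = 0 \<or> coef (y j) k = 0"
      proof (rule ccontr)
        assume "\<not> ?thesis"
        then have "coef (u i j) k \<noteq> 0" "coef (y j) k \<noteq> 0"
          by auto
        from u_const[OF i this(1)] lowD(2)[OF y this(2)] show False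
          using that d[of i] by auto
      qed
    qed (rule u_vecs[OF i])
    ultimately show ?thesis
      using sg_u[OF i] unfolding rows.lattice.H_def unfolding L by simp
  qed
  obtain a e t where rs: "r \<le> s" and a_ext: "\<And>i. i < r \<Longrightarrow> a i = u i \<and> e i = h i \<and> t i = d i"
    and e: "\<And>i. e i \<in> {-1, 1}" and t: "\<And>i. t i \<in> {0, 1}"
    and a: "\<And>i. i < s \<Longrightarrow> a i \<in> rows.lattice.H (e i) (t i)"
    and on: "\<And>i j. i < s \<Longrightarrow> j < s \<Longrightarrow> form (a i) (a j) = (if i = j then 1 else 0)"
    by (rule rows.lattice.enumerated_frame_extension[of r u h d]) (use u_H h d form_u in \<open>blast+\<close>)
  have a_vecs: "a i \<in> vecs" if "i < s" for i
    using a[OF that] by (rule rows.lattice.H_vecs)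
  have sg_a: "sg (a i) = lmul (mon (- t i) (e i)) (a i)" if "i < s" for i
    using a[OF that] by (simp add: rows.lattice.H_def)
  define C where "C = rows_mat s a"
  show ?thesis
  proof (rule that[of C e t])
    show "C \<in> carrier_mat s s" "coeffs_in F C" "C * mat_adj C = 1\<^sub>m s"
      using rows_mat_coeffs a_vecs rows_mat_unitary on by (auto simp: C_def)
    show "msym e (\<lambda>i. - t i) ep (\<lambda>j. - tt j) C"
      unfolding C_def using sg_a e by (rule rows_mat_msym)
    show "k = 0" if "i < s" "j < s" "coef (C $$ (i, j)) k \<noteq> 0" for i j k
      using H_const[OF a[OF that(1)] e t, of j k] that by (simp add: C_def rows_mat_def)
    show "Q = mat r s (\<lambda>(i, j). if i = j then 1 else 0) * C"
    proof (rule eq_matI)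
      fix i j assume "i < dim_row (mat r s (\<lambda>(i, j). if i = j then 1 else 0) * C)"
        "j < dim_col (mat r s (\<lambda>(i, j). if i = j then 1 else 0) * C)"
      then have ij: "i < r" "j < s"
        by (auto simp: C_def rows_mat_def)
      have "(mat r s (\<lambda>(i, j). if i = j then 1 else 0) * C) $$ (i, j)
          = (\<Sum>l<s. mat r s (\<lambda>(i, j). if i = j then 1 else 0) $$ (i, l) * C $$ (l, j))"
        using ij by (intro mat_mult_index) (auto simp: C_def)
      also have "\<dots> = (\<Sum>l<s. if l = i then C $$ (i, j) else 0)"
        using ij by (intro sum.cong) auto
      also have "\<dots> = Q $$ (i, j)"
        using ij rs a_ext[OF ij(1)] by (simp add: C_def rows_mat_def u_def row_vec_def)
      finally show "Q $$ (i, j) = (mat r s (\<lambda>(i, j). if i = j then 1 else 0) * C) $$ (i, j)" ..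
    qed (use Q in \<open>auto simp: C_def rows_mat_def\<close>)
  qed (use rs e t a_ext in auto)
qed

end

section \<open>Iteration of the reduction\<close>

lemma coef_const_mult:
  assumes "\<And>m. coef p m \<noteq> 0 \<Longrightarrow> m = 0"
  shows "coef (p * q) k = coef p 0 * coef q k"
proof -
  have "p = mon 0 (coef p 0)"
    using assms by (intro poly_mapping_eqI) (auto simp: lookup_single when_def)
  then have "p * q = mon 0 (coef p 0) * q"
    by (rule arg_cong[where f = "\<lambda>p. p * q"])
  then show ?thesis
    by (simp only: coef_single_mult diff_zero)
qed

lemma (in conj_sqrt_field) coeffs_in_mult:
  assumes "A \<in> carrier_mat m n" "B \<in> carrier_mat n p" "coeffs_in F A" "coeffs_in F B"
  shows "coeffs_in F (A * B)"
proof -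
  have "(A * B) $$ (i, j) \<in> FL" if "i < m" "j < p" for i j
    unfolding mat_mult_index[OF assms(1,2) that] using assms that
    by (intro FL_sum FL_closed(8)) (auto simp: coeffs_in_def FL_def)
  then show ?thesis
    using assms(1,2) unfolding coeffs_in_def FL_def by auto
qed

definition elementary_step ::
  "complex set \<Rightarrow> nat \<Rightarrow> (nat \<Rightarrow> complex) \<Rightarrow> (nat \<Rightarrow> int) \<Rightarrow> (nat \<Rightarrow> complex) \<Rightarrow> (nat \<Rightarrow> int) \<Rightarrow> laurent mat \<Rightarrow> bool" where
  "elementary_step F s e t e' t' A \<longleftrightarrow> A \<in> carrier_mat s s \<and> coeffs_in F A \<and> A * mat_adj A = 1\<^sub>m s \<and>
    msym e (\<lambda>i. - t i) e' (\<lambda>j. - t' j) A \<and>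
    (\<forall>i<s. \<forall>j<s. \<forall>k. coef (A $$ (i, j)) k \<noteq> 0 \<longrightarrow> - 1 \<le> k \<and> k \<le> 1)"

text \<open>Each reduction splits off one factor on the right and lowers the extent by one. The
  induction ends at \<open>K = 1\<close>, where the constant completion joins the last factor, so
  that \<open>K\<close> factors suffice. The final symmetry row is prescribed on the first
  \<open>r\<close> indices and otherwise produced by the completion.\<close>

lemma (in conj_sqrt_field) elementary_factorization:
  assumes "K \<ge> 1"
    and "Q \<in> carrier_mat r s" "coeffs_in F Q" "Q * mat_adj Q = 1\<^sub>m r"
    and h: "\<And>i. h i \<in> {-1, 1}" and d: "\<And>i. d i \<in> {0, 1}"
    and "\<And>j. ep j \<in> {-1, 1}" "\<And>j. tt j \<in> {0, 1}"
    and "msym h (\<lambda>i. - d i) ep (\<lambda>j. - tt j) Q"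
    and "\<And>i j k. i < r \<Longrightarrow> j < s \<Longrightarrow> coef (Q $$ (i, j)) k \<noteq> 0 \<Longrightarrow>
      - int K \<le> k - d i + tt j \<and> k - d i + tt j \<le> int K"
  shows "\<exists>R e t. (\<forall>m<K. elementary_step F s (e (Suc m)) (t (Suc m)) (e m) (t m) (R m)) \<and>
    e 0 = ep \<and> t 0 = tt \<and> (\<forall>m i. e m i \<in> {-1, 1} \<and> t m i \<in> {0, 1}) \<and>
    (\<forall>i<r. e K i = h i \<and> t K i = d i) \<and>
    Q = mat r s (\<lambda>(i, j). if i = j then 1 else 0) * mat_chain R (K - 1)"
  using assms(1-4,7-)
proof (induction K arbitrary: Q ep tt rule: nat_induct_at_least)
  case base
  interpret symmetric_space F s ep tt
    by unfold_locales (use base in auto)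
  obtain A Q' e t where A: "A \<in> carrier_mat s s" "coeffs_in F A" "A * mat_adj A = 1\<^sub>m s"
      "msym e (\<lambda>i. - t i) ep (\<lambda>j. - tt j) A"
      "\<And>i j k. i < s \<Longrightarrow> j < s \<Longrightarrow> coef (A $$ (i, j)) k \<noteq> 0 \<Longrightarrow> - 1 \<le> k \<and> k \<le> 1"
    and et: "\<And>i. e i \<in> {-1, 1}" "\<And>i. t i \<in> {0, 1}"
    and Q': "Q' \<in> carrier_mat r s" "coeffs_in F Q'" "Q' * mat_adj Q' = 1\<^sub>m r"
      "msym h (\<lambda>i. - d i) e (\<lambda>j. - t j) Q'"
      "\<And>i j k. i < r \<Longrightarrow> j < s \<Longrightarrow> coef (Q' $$ (i, j)) k \<noteq> 0 \<Longrightarrow> - (int 1 - 1) \<le> k - d i + t j \<and> k - d i + t j \<le> int 1 - 1"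
    and QA: "Q = Q' * A"
    by (rule degree_reduction[OF base(1-3) h d base(6,7)]) (use base in auto)
  interpret Q': symmetric_space F s e t
    by unfold_locales (use et in auto)
  obtain C e' t' where C: "C \<in> carrier_mat s s" "coeffs_in F C" "C * mat_adj C = 1\<^sub>m s"
      "msym e' (\<lambda>i. - t' i) e (\<lambda>j. - t j) C"
      "\<And>i j k. i < s \<Longrightarrow> j < s \<Longrightarrow> coef (C $$ (i, j)) k \<noteq> 0 \<Longrightarrow> k = 0"
    and et': "\<And>i. e' i \<in> {-1, 1}" "\<And>i. t' i \<in> {0, 1}" "\<And>i. i < r \<Longrightarrow> e' i = h i \<and> t' i = d i"
    and QC: "Q' = mat r s (\<lambda>(i, j). if i = j then 1 else 0) * C"
    by (rule Q'.constant_completion[OF Q'(1-3) h d Q'(4)]) (use Q'(5) in force)+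
  \<comment> \<open>\<open>C\<close> is constant, so it only mixes the rows of \<open>A\<close> and
    brings in no new exponents.\<close>
  have "- 1 \<le> k \<and> k \<le> 1" if ij: "i < s" "j < s" and nz: "coef ((C * A) $$ (i, j)) k \<noteq> 0" for i j k
  proof -
    have "coef ((C * A) $$ (i, j)) k = (\<Sum>l<s. coef (C $$ (i, l)) 0 * coef (A $$ (l, j)) k)"
      unfolding mat_mult_index[OF C(1) A(1) ij] lookup_sum
      using C(5) ij by (intro sum.cong refl coef_const_mult) auto
    then obtain l where "l < s" "coef (A $$ (l, j)) k \<noteq> 0"
      using nz by (metis (no_types, lifting) lessThan_iff mult_zero_right sum.neutral)
    then show ?thesis
      using A(5) ij by blast
  qed
  then have "elementary_step F s e' t' ep tt (C * A)"
    unfolding elementary_step_def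
    using mult_carrier_mat[OF C(1) A(1)] coeffs_in_mult[OF C(1) A(1) C(2) A(2)]
      paraunitary_mult[OF C(1) A(1) C(3) A(3)] msym_mult[OF C(1,4) A(1,4) et(1)] by blast
  moreover have "Q = mat r s (\<lambda>(i, j). if i = j then 1 else 0) * (C * A)"
    unfolding QA QC using C(1) A(1) by (intro assoc_mult_mat) auto
  ultimately show ?case
    using base et' by (intro exI[of _ "\<lambda>_. C * A"] exI[of _ "case_nat ep (\<lambda>_. e')"] exI[of _ "case_nat tt (\<lambda>_. t')"])
      (auto split: nat.splits)
next
  case (Suc K)
  interpret symmetric_space F s ep tt
    by unfold_locales (use Suc.prems in auto)
  obtain A Q' e t where A: "A \<in> carrier_mat s s" "coeffs_in F A" "A * mat_adj A = 1\<^sub>m s"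
      "msym e (\<lambda>i. - t i) ep (\<lambda>j. - tt j) A"
      "\<And>i j k. i < s \<Longrightarrow> j < s \<Longrightarrow> coef (A $$ (i, j)) k \<noteq> 0 \<Longrightarrow> - 1 \<le> k \<and> k \<le> 1"
    and et: "\<And>i. e i \<in> {-1, 1}" "\<And>i. t i \<in> {0, 1}"
    and Q': "Q' \<in> carrier_mat r s" "coeffs_in F Q'" "Q' * mat_adj Q' = 1\<^sub>m r"
      "msym h (\<lambda>i. - d i) e (\<lambda>j. - t j) Q'"
      "\<And>i j k. i < r \<Longrightarrow> j < s \<Longrightarrow> coef (Q' $$ (i, j)) k \<noteq> 0 \<Longrightarrow>
        - (int (Suc K) - 1) \<le> k - d i + t j \<and> k - d i + t j \<le> int (Suc K) - 1"
    and QA: "Q = Q' * A"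
    by (rule degree_reduction[OF Suc.prems(1-3) h d Suc.prems(6,7)]) (use Suc.prems in auto)
  obtain R e' t' where R: "\<And>m. m < K \<Longrightarrow> elementary_step F s (e' (Suc m)) (t' (Suc m)) (e' m) (t' m) (R m)"
    "e' 0 = e" "t' 0 = t" "\<And>m i. e' m i \<in> {-1, 1} \<and> t' m i \<in> {0, 1}" "\<And>i. i < r \<Longrightarrow> e' K i = h i \<and> t' K i = d i"
    "Q' = mat r s (\<lambda>(i, j). if i = j then 1 else 0) * mat_chain R (K - 1)"
    using Suc.IH[OF Q'(1-3) et Q'(4)] Q'(5) by force
  \<comment> \<open>The factor split off stands at the far right of the product and therefore gets
    index 0.\<close>
  define R' where "R' = case_nat A R"
  define e'' where "e'' = case_nat ep e'"
  define t'' where "t'' = case_nat tt t'"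
  have step: "elementary_step F s (e'' (Suc m)) (t'' (Suc m)) (e'' m) (t'' m) (R' m)" if "m < Suc K" for m
    using that R(1-3) A by (cases m) (auto simp: R'_def e''_def t''_def elementary_step_def)
  have carrier: "R' m \<in> carrier_mat s s" if "m < Suc K" for m
    using step[OF that] by (simp add: elementary_step_def)
  have "mat_chain R' (Suc (K - 1)) = mat_chain (\<lambda>m. R' (Suc m)) (K - 1) * R' 0"
    using carrier Suc.hyps by (intro mat_chain_Suc_left[where s = s]) auto
  then have chain: "mat_chain R' K = mat_chain R (K - 1) * A"
    using Suc.hyps by (simp add: R'_def)
  have "mat_chain R (K - 1) \<in> carrier_mat s s"
    using R(1) Suc.hyps by (intro mat_chain_carrier) (auto simp: elementary_step_def)
  then have "Q = mat r s (\<lambda>(i, j). if i = j then 1 else 0) * mat_chain R' (Suc K - 1)"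
    unfolding QA R(6) diff_Suc_1 chain using A(1) by (intro assoc_mult_mat) auto
  then show ?case
    using step R(4,5) Suc.prems(4,5) by (intro exI[of _ R'] exI[of _ e''] exI[of _ t''])
      (auto simp: e''_def t''_def split: nat.splits)
qed


section \<open>Symmetry rows and regrouping matrices\<close>

lemma trow_carrier [simp]: "trow n e c \<in> carrier_mat 1 n"
  by (simp add: trow_def)

lemma sym_row_imp_trow:
  assumes "sym_row n \<theta> T"
  obtains e c where "T = trow n e c" "\<And>j. e j \<in> {-1, 1}"
proof -
  have dims: "\<theta> \<in> carrier_mat 1 n" "T \<in> carrier_mat 1 n"
    using assms by (auto simp: sym_row_def mat_sym_value_def)
  have "\<exists>x. fst x \<in> {-1, 1} \<and> (j < n \<longrightarrow> T $$ (0, j) = mon (snd x) (fst x))" for j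
  proof (cases "j < n")
    case True
    then have "sym_value (\<theta> $$ (0, j)) (T $$ (0, j))"
      using assms dims by (auto simp: sym_row_def mat_sym_value_def)
    then show ?thesis
      unfolding sym_value_def by force
  qed (auto intro!: exI[of _ "(1, 0)"])
  then obtain g where g: "\<And>j. fst (g j) \<in> {-1, 1} \<and> (j < n \<longrightarrow> T $$ (0, j) = mon (snd (g j)) (fst (g j)))"
    by metis
  show ?thesis
  proof (rule that[of "\<lambda>j. fst (g j)" "\<lambda>j. snd (g j)"])
    show "T = trow n (\<lambda>j. fst (g j)) (\<lambda>j. snd (g j))"
      using g dims by (intro eq_matI) (auto simp: trow_def)
  qed (use g in blast)
qed

text \<open>The zero polynomial has every symmetry, so any row of signed monomials is a value of the
  symmetry of the zero row. This supplies the row vectors wherever compatibility has to be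
  proved.\<close>

lemma sym_row_zero:
  assumes "\<And>j. j < n \<Longrightarrow> e j \<in> {-1, 1}"
  shows "sym_row n (0\<^sub>m 1 n) (trow n e c)"
proof -
  have "sym_value 0 (mon (c j) (e j))" if "j < n" for j
    unfolding sym_value_def using assms[OF that] by (intro conjI bexI[of _ "e j"] exI[of _ "c j"]) auto
  then show ?thesis
    by (auto simp: sym_row_def mat_sym_value_def has_symmetry_def trow_def)
qed

lemma adj_trow_mult:
  assumes "\<And>i. i < m \<Longrightarrow> e i \<in> {-1, 1}"
  shows "mat_adj (trow m e c) * trow n e' c' = mat m n (\<lambda>(i, j). mon (c' j - c i) (e i * e' j))"
proof (rule eq_matI)
  fix i j assume "i < dim_row (mat m n (\<lambda>(i, j). mon (c' j - c i) (e i * e' j)))"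
    "j < dim_col (mat m n (\<lambda>(i, j). mon (c' j - c i) (e i * e' j)))"
  then have ij: "i < m" "j < n"
    by auto
  have "(mat_adj (trow m e c) * trow n e' c') $$ (i, j) = (\<Sum>l<1. mat_adj (trow m e c) $$ (i, l) * trow n e' c' $$ (l, j))"
    by (rule mat_mult_index[OF mat_adj_carrier[OF trow_carrier] trow_carrier ij])
  then show "(mat_adj (trow m e c) * trow n e' c') $$ (i, j) = mat m n (\<lambda>(i, j). mon (c' j - c i) (e i * e' j)) $$ (i, j)"
    using ij assms[OF ij(1)] by (auto simp: trow_def mult_single)
qed (auto simp: trow_def)

lemma mat_sym_value_iff_msym:
  assumes "M \<in> carrier_mat m n" "\<And>i. i < m \<Longrightarrow> e i \<in> {-1, 1}" "\<And>j. j < n \<Longrightarrow> e' j \<in> {-1, 1}"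
  shows "mat_sym_value M (mat_adj (trow m e c) * trow n e' c') \<longleftrightarrow> msym e c e' c' M"
proof -
  have "\<exists>a\<in>{-1, 1}. \<exists>k. mon (c' j - c i) (e i * e' j) = mon k a" if "i < m" "j < n" for i j
    using assms(2)[OF that(1)] assms(3)[OF that(2)] by auto
  moreover have "mat_adj (trow m e c) * trow n e' c' = mat m n (\<lambda>(i, j). mon (c' j - c i) (e i * e' j))"
    using assms(2) by (rule adj_trow_mult)
  ultimately show ?thesis
    using assms(1) by (auto simp: mat_sym_value_def msym_def sym_value_def)
qed

text \<open>The product of the diagonal matrix with entries \<open>z^(- f i)\<close> and a
  permutation matrix. \<open>f = 0\<close> gives the permutation matrices themselves.\<close>

definition perm_mat :: "nat \<Rightarrow> (nat \<Rightarrow> nat) \<Rightarrow> (nat \<Rightarrow> int) \<Rightarrow> laurent mat" where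
  "perm_mat n \<pi> f = mat n n (\<lambda>(i, j). if i = \<pi> j then mon (- f i) 1 else 0)"

lemma perm_mat_carrier [simp]: "perm_mat n \<pi> f \<in> carrier_mat n n"
  and perm_mat_dim [simp]: "dim_row (perm_mat n \<pi> f) = n" "dim_col (perm_mat n \<pi> f) = n"
  by (simp_all add: perm_mat_def)

lemma mult_perm_mat_index:
  assumes "\<pi> permutes {..<n}" "M \<in> carrier_mat m n" "i < m" "j < n"
  shows "(M * perm_mat n \<pi> f) $$ (i, j) = mon (- f (\<pi> j)) 1 * M $$ (i, \<pi> j)"
proof -
  have "\<pi> j < n"
    using permutes_in_image[OF assms(1), of j] assms(4) by simp
  have "(M * perm_mat n \<pi> f) $$ (i, j) = (\<Sum>l<n. M $$ (i, l) * perm_mat n \<pi> f $$ (l, j))"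
    using assms by (intro mat_mult_index) auto
  also have "\<dots> = (\<Sum>l<n. if l = \<pi> j then mon (- f l) 1 * M $$ (i, l) else 0)"
    using assms(4) by (intro sum.cong) (auto simp: perm_mat_def mult.commute)
  finally show ?thesis
    using \<open>\<pi> j < n\<close> by simp
qed

lemma adj_perm_mat_mult_index:
  assumes "\<pi> permutes {..<n}" "M \<in> carrier_mat n m" "i < n" "j < m"
  shows "(mat_adj (perm_mat n \<pi> f) * M) $$ (i, j) = mon (f (\<pi> i)) 1 * M $$ (\<pi> i, j)"
proof -
  have "\<pi> i < n"
    using permutes_in_image[OF assms(1), of i] assms(3) by simp
  have "(mat_adj (perm_mat n \<pi> f) * M) $$ (i, j) = (\<Sum>l<n. mat_adj (perm_mat n \<pi> f) $$ (i, l) * M $$ (l, j))"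
    using assms by (intro mat_mult_index) auto
  also have "\<dots> = (\<Sum>l<n. if l = \<pi> i then mon (f l) 1 * M $$ (l, j) else 0)"
    using assms(3) by (intro sum.cong) (auto simp: perm_mat_def)
  finally show ?thesis
    using \<open>\<pi> i < n\<close> by simp
qed

lemma adj_perm_mat_mult:
  assumes "\<pi> permutes {..<n}"
  shows "mat_adj (perm_mat n \<pi> f) * perm_mat n \<pi> f = 1\<^sub>m n"
proof (rule eq_matI)
  fix i j assume "i < dim_row (1\<^sub>m n)" "j < dim_col (1\<^sub>m n)"
  then have ij: "i < n" "j < n"
    by auto
  have "\<pi> i < n" "\<pi> i = \<pi> j \<longleftrightarrow> i = j"
    using permutes_in_image[OF assms, of i] permutes_inj[OF assms] ij(1) by (auto simp: inj_eq)
  then show "(mat_adj (perm_mat n \<pi> f) * perm_mat n \<pi> f) $$ (i, j) = 1\<^sub>m n $$ (i, j)"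
    unfolding adj_perm_mat_mult_index[OF assms perm_mat_carrier ij]
    using ij by (simp add: perm_mat_def mult_single)
qed auto

lemma perm_mat_mult_adj:
  assumes "\<pi> permutes {..<n}"
  shows "perm_mat n \<pi> f * mat_adj (perm_mat n \<pi> f) = 1\<^sub>m n"
proof (rule eq_matI)
  fix i j assume "i < dim_row (1\<^sub>m n)" "j < dim_col (1\<^sub>m n)"
  then have ij: "i < n" "j < n"
    by auto
  obtain l where l: "\<pi> l = i"
    using permutes_surj[OF assms] by (metis surjD)
  then have "l < n"
    using permutes_in_image[OF assms, of l] ij by simp
  have inj: "\<pi> k = i \<longleftrightarrow> k = l" for k
    using permutes_inj[OF assms] l by (auto simp: inj_eq)
  have "(perm_mat n \<pi> f * mat_adj (perm_mat n \<pi> f)) $$ (i, j)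
      = (\<Sum>k<n. perm_mat n \<pi> f $$ (i, k) * mat_adj (perm_mat n \<pi> f) $$ (k, j))"
    using ij by (intro mat_mult_index) auto
  also have "\<dots> = (\<Sum>k<n. if k = l then (if i = j then 1 else 0) else 0)"
  proof (intro sum.cong refl)
    fix k assume "k \<in> {..<n}"
    then show "perm_mat n \<pi> f $$ (i, k) * mat_adj (perm_mat n \<pi> f) $$ (k, j)
        = (if k = l then (if i = j then 1 else 0) else 0)"
      using ij inj[of k] by (cases "k = l") (auto simp: perm_mat_def mult_single)
  qed
  finally show "(perm_mat n \<pi> f * mat_adj (perm_mat n \<pi> f)) $$ (i, j) = 1\<^sub>m n $$ (i, j)"
    using ij \<open>l < n\<close> by simp
qed auto

lemma permutation_matrix_iff: "permutation_matrix n E \<longleftrightarrow> (\<exists>\<pi>. \<pi> permutes {..<n} \<and> E = perm_mat n \<pi> (\<lambda>_. 0))"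
  by (simp add: permutation_matrix_def perm_mat_def cong: if_cong)

lemma mat_diag_mult_perm_mat:
  "mat_diag n (\<lambda>j. mon (- f j) 1) * perm_mat n \<pi> (\<lambda>_. 0) = perm_mat n \<pi> f"
  by (subst mat_diag_mult_left[of _ _ n]) (auto simp: perm_mat_def intro!: eq_matI)

text \<open>The permutation lists the indices of each of the four types one after the other.
  Existence is needed because \<open>regrouping_matrix\<close> is a choice.\<close>

lemma regroups_exists:
  assumes "\<And>j. e j \<in> {-1, 1}"
  shows "\<exists>U. regroups (trow n e c) U"
proof -
  define f where "f j = \<lceil>real_of_int (c j) / 2\<rceil>" for j
  define b where "b j = c j - 2 * f j" for j
  have b: "b j \<in> {0, -1}" for j
    unfolding b_def f_def by (auto; linarith)
  \<comment> \<open>The types 0, 1, 2, 3 number the symmetries \<open>1\<close>, \<open>-1\<close>,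
    \<open>1/z\<close>, \<open>-1/z\<close> in the order of \<open>grouped_row\<close>.\<close>
  define ty :: "nat \<Rightarrow> nat" where "ty j = (if b j = 0 then 0 else 2) + (if e j = 1 then 0 else 1)" for j
  define G where "G k = filter (\<lambda>j. ty j = k) [0..<n]" for k
  define xs where "xs = G 0 @ G 1 @ G 2 @ G 3"
  have ty: "ty j = 0 \<or> ty j = 1 \<or> ty j = 2 \<or> ty j = 3" for j
    by (auto simp: ty_def)
  have "j \<in> set xs" if "j < n" for j
    using ty[of j] that by (auto simp: xs_def G_def)
  then have "{..<n} \<subseteq> set xs"
    by blast
  moreover have "set xs \<subseteq> {..<n}"
    by (auto simp: xs_def G_def)
  ultimately have set: "set xs = {..<n}"
    by blast
  have dist: "distinct xs"
    by (auto simp: xs_def G_def)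
  have len: "length xs = n"
    using distinct_card[OF dist] set by simp
  define \<pi> where "\<pi> j = (if j < n then xs ! j else j)" for j
  have "bij_betw ((!) xs) {..<n} {..<n}"
    by (rule bij_betw_nth[OF dist]) (simp_all add: len set)
  then have "bij_betw \<pi> {..<n} {..<n}"
    by (subst bij_betw_cong[where g = "(!) xs"]) (auto simp: \<pi>_def)
  then have \<pi>: "\<pi> permutes {..<n}"
    by (rule bij_imp_permutes) (simp add: \<pi>_def)
  have G: "ty (G k ! j) = k" if "j < length (G k)" for k j
    using nth_mem[OF that] by (simp add: G_def)
  have entry: "mon (b i) (e i) = (if ty i = 0 then 1 else if ty i = 1 then - 1
      else if ty i = 2 then mon (- 1) 1 else mon (- 1) (- 1))" for i
    using b[of i] assms[of i] by (auto simp: ty_def single_uminus)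
  have "mat 1 n (\<lambda>(_, j). mon (b j) (e j)) * perm_mat n \<pi> (\<lambda>_. 0)
      = grouped_row (length (G 0)) (length (G 1)) (length (G 2)) (length (G 3))"
  proof (rule eq_matI)
    have n: "length (G 0) + length (G 1) + length (G 2) + length (G 3) = n"
      using len by (simp add: xs_def)
    fix i j assume "i < dim_row (grouped_row (length (G 0)) (length (G 1)) (length (G 2)) (length (G 3)))"
      "j < dim_col (grouped_row (length (G 0)) (length (G 1)) (length (G 2)) (length (G 3)))"
    then have ij: "i = 0" "j < n"
      using n by (auto simp: grouped_row_def)
    have "\<pi> j < n"
      using permutes_in_image[OF \<pi>, of j] ij by simp
    then have "(mat 1 n (\<lambda>(_, j). mon (b j) (e j)) * perm_mat n \<pi> (\<lambda>_. 0)) $$ (i, j) = mon (b (xs ! j)) (e (xs ! j))"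
      using ij by (subst mult_perm_mat_index[OF \<pi>, of _ 1]) (auto simp: \<pi>_def)
    also have "\<dots> = grouped_row (length (G 0)) (length (G 1)) (length (G 2)) (length (G 3)) $$ (i, j)"
    proof -
      have nth: "xs ! j = (if j < length (G 0) then G 0 ! j
          else if j < length (G 0) + length (G 1) then G 1 ! (j - length (G 0))
          else if j < length (G 0) + length (G 1) + length (G 2) then G 2 ! (j - length (G 0) - length (G 1))
          else G 3 ! (j - length (G 0) - length (G 1) - length (G 2)))"
        unfolding xs_def nth_append by auto
      have "ty (xs ! j) = (if j < length (G 0) then 0 else if j < length (G 0) + length (G 1) then 1
          else if j < length (G 0) + length (G 1) + length (G 2) then 2 else 3)"
        unfolding nth using ij(2) n by (simp add: G)
      then show ?thesis
        unfolding entry using ij n by (simp add: grouped_row_def)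
    qed
    finally show "(mat 1 n (\<lambda>(_, j). mon (b j) (e j)) * perm_mat n \<pi> (\<lambda>_. 0)) $$ (i, j)
      = grouped_row (length (G 0)) (length (G 1)) (length (G 2)) (length (G 3)) $$ (i, j)" .
  qed (use len in \<open>auto simp: grouped_row_def xs_def perm_mat_def\<close>)
  then have "regroups (trow n e c) (mat_diag n (\<lambda>j. mon (- f j) 1) * perm_mat n \<pi> (\<lambda>_. 0))"
    unfolding regroups_def Let_def permutation_matrix_iff
    using assms \<pi> by (intro exI[of _ e] exI[of _ c] exI[of _ "perm_mat n \<pi> (\<lambda>_. 0)"] exI[of _ "length (G 0)"]
        exI[of _ "length (G 1)"] exI[of _ "length (G 2)"] exI[of _ "length (G 3)"])
      (auto simp: trow_def b_def f_def)
  then show ?thesis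
    by blast
qed

text \<open>The later arguments use only this shape of the chosen matrix; the order within the
  groups remains unknown. Signs beyond index \<open>n\<close> are set to 1, so that they are
  admissible everywhere.\<close>

lemma regrouping_matrix_eq_perm_mat:
  assumes "sym_row n \<theta> T"
  obtains e c \<pi> where "T = trow n e c" "\<And>j. e j \<in> {-1, 1}" "\<pi> permutes {..<n}"
    "regrouping_matrix T = perm_mat n \<pi> (\<lambda>j. \<lceil>real_of_int (c j) / 2\<rceil>)"
proof -
  obtain e c where T: "T = trow n e c" "\<And>j. e j \<in> {-1, 1}"
    using sym_row_imp_trow[OF assms] by blast
  then have "regroups T (regrouping_matrix T)"
    unfolding regrouping_matrix_def using regroups_exists someI_ex by metis
  then obtain e' c' E where *: "\<forall>j<n. e' j \<in> {-1, 1::complex}" "T = mat 1 n (\<lambda>(_, j). mon (c' j) (e' j))"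
    "permutation_matrix n E" "regrouping_matrix T = mat_diag n (\<lambda>j. mon (- \<lceil>real_of_int (c' j) / 2\<rceil>) 1) * E"
    unfolding regroups_def Let_def T(1) by (auto simp: trow_def)
  then obtain \<pi> where "\<pi> permutes {..<n}" "E = perm_mat n \<pi> (\<lambda>_. 0)"
    by (auto simp: permutation_matrix_iff)
  moreover have "T = trow n (\<lambda>j. if j < n then e' j else 1) c'"
    unfolding *(2) by (auto simp: trow_def intro!: eq_matI)
  ultimately show ?thesis
    using * mat_diag_mult_perm_mat by (intro that[of "\<lambda>j. if j < n then e' j else 1" c' \<pi>]) auto
qed

lemma perm_mat_msym:
  assumes "\<pi> permutes {..<n}" "\<And>j. e j \<in> {-1, 1}"
  shows "msym e c (\<lambda>j. e (\<pi> j)) (\<lambda>j. c (\<pi> j) - 2 * f (\<pi> j)) (perm_mat n \<pi> f)"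
  unfolding msym_def
proof (intro allI impI)
  fix i j assume "i < dim_row (perm_mat n \<pi> f)" "j < dim_col (perm_mat n \<pi> f)"
  then have "i < n" "j < n"
    by (auto simp: perm_mat_def)
  then show "perm_mat n \<pi> f $$ (i, j) =
      mon (c (\<pi> j) - 2 * f (\<pi> j) - c i) (e i * e (\<pi> j)) * laurent_reflect (perm_mat n \<pi> f $$ (i, j))"
    using assms(2)[of i] by (auto simp: perm_mat_def mult_single)
qed

lemma msym_adj:
  assumes "msym e c e' c' M" "\<And>i. e i \<in> {-1, 1}" "\<And>i. e' i \<in> {-1, 1}"
  shows "msym e' c' e c (mat_adj M)"
  unfolding msym_def
proof (intro allI impI)
  fix i j assume "i < dim_row (mat_adj M)" "j < dim_col (mat_adj M)"
  then have ij: "j < dim_row M" "i < dim_col M"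
    by auto
  have "M $$ (j, i) = mon (c' i - c j) (e j * e' i) * laurent_reflect (M $$ (j, i))"
    using assms(1) ij by (auto simp: msym_def)
  then have "laurent_adj (M $$ (j, i)) = laurent_adj (mon (c' i - c j) (e j * e' i) * laurent_reflect (M $$ (j, i)))"
    by (rule arg_cong)
  then show "mat_adj M $$ (i, j) = mon (c j - c' i) (e' i * e j) * laurent_reflect (mat_adj M $$ (i, j))"
    using ij assms(2)[of j] assms(3)[of i] by (auto simp: adj_reflect)
qed


section \<open>The factorization theorem\<close>

definition truncation :: "nat \<Rightarrow> nat \<Rightarrow> laurent mat" where
  "truncation r s = mat r s (\<lambda>(i, j). if i = j then 1 else 0)"

lemma truncation_carrier [simp]: "truncation r s \<in> carrier_mat r s"
  and truncation_dim [simp]: "dim_row (truncation r s) = r" "dim_col (truncation r s) = s"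
  by (simp_all add: truncation_def)

lemma truncation_mult_index:
  assumes "r \<le> s" "M \<in> carrier_mat s n" "i < r" "j < n"
  shows "(truncation r s * M) $$ (i, j) = M $$ (i, j)"
proof -
  have "(truncation r s * M) $$ (i, j) = (\<Sum>l<s. truncation r s $$ (i, l) * M $$ (l, j))"
    by (rule mat_mult_index[OF truncation_carrier assms(2-4)])
  also have "\<dots> = (\<Sum>l<s. if l = i then M $$ (i, j) else 0)"
    using assms(3) by (intro sum.cong) (auto simp: truncation_def)
  finally show ?thesis
    using assms by simp
qed

lemma truncation_mult_adj:
  assumes "r \<le> s"
  shows "truncation r s * mat_adj (truncation r s) = 1\<^sub>m r"
proof (rule eq_matI)
  fix i j assume "i < dim_row (1\<^sub>m r)" "j < dim_col (1\<^sub>m r)"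
  then have ij: "i < r" "j < r"
    by auto
  show "(truncation r s * mat_adj (truncation r s)) $$ (i, j) = 1\<^sub>m r $$ (i, j)"
    unfolding truncation_mult_index[OF assms mat_adj_carrier[OF truncation_carrier] ij]
    using ij assms by (auto simp: truncation_def)
qed auto

lemma diag_block_one_eq:
  assumes "U \<in> carrier_mat r r" "r \<le> s"
  shows "diag_block_mat [U, 1\<^sub>m (s - r)] =
    four_block_mat U (0\<^sub>m r (s - r)) (0\<^sub>m (s - r) r) (1\<^sub>m (s - r))"
  unfolding diag_block_mat.simps(2)[of U] diag_block_mat_singleton Let_def using assms(1) by simp

lemma diag_block_one_carrier:
  assumes "U \<in> carrier_mat r r" "r \<le> s"
  shows "diag_block_mat [U, 1\<^sub>m (s - r)] \<in> carrier_mat s s"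
  unfolding diag_block_one_eq[OF assms] using four_block_carrier_mat[OF assms(1) one_carrier_mat[of "s - r"]] assms(2)
  by simp

lemma diag_block_one_index:
  assumes "U \<in> carrier_mat r r" "r \<le> s" "i < s" "j < s"
  shows "diag_block_mat [U, 1\<^sub>m (s - r)] $$ (i, j) =
    (if i < r \<and> j < r then U $$ (i, j) else if i = j then 1 else 0)"
proof -
  have "i < dim_row U + dim_row (1\<^sub>m (s - r) :: laurent mat)" "j < dim_col U + dim_col (1\<^sub>m (s - r) :: laurent mat)"
    using assms by auto
  then show ?thesis
    unfolding diag_block_one_eq[OF assms(1,2)] using assms by (subst index_mat_four_block(1)) auto
qed

lemma truncation_diag_block:
  assumes "U \<in> carrier_mat r r" "r \<le> s"
  shows "truncation r s * diag_block_mat [U, 1\<^sub>m (s - r)] = U * truncation r s"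
proof (rule eq_matI)
  fix i j assume "i < dim_row (U * truncation r s)" "j < dim_col (U * truncation r s)"
  then have ij: "i < r" "j < s"
    using assms by auto
  have "(U * truncation r s) $$ (i, j) = (\<Sum>l<r. U $$ (i, l) * truncation r s $$ (l, j))"
    by (rule mat_mult_index[OF assms(1) truncation_carrier ij])
  also have "\<dots> = (\<Sum>l<r. if l = j then U $$ (i, j) else 0)"
    using ij by (intro sum.cong) (auto simp: truncation_def)
  also have "\<dots> = diag_block_mat [U, 1\<^sub>m (s - r)] $$ (i, j)"
    using ij assms diag_block_one_index[OF assms, of i j] by auto
  finally show "(truncation r s * diag_block_mat [U, 1\<^sub>m (s - r)]) $$ (i, j) = (U * truncation r s) $$ (i, j)"
    using truncation_mult_index[OF assms(2) diag_block_one_carrier[OF assms] ij] by simp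
qed (use assms diag_block_one_carrier[OF assms] in auto)

lemma mat_chain_cong: "(\<And>m. m \<le> n \<Longrightarrow> A m = B m) \<Longrightarrow> mat_chain A n = mat_chain B n"
  by (induction n) auto

section \<open>Support lengths and centered supports\<close>

lemma coeffsupp_subset:
  assumes "\<And>i j k. i < dim_row P \<Longrightarrow> j < dim_col P \<Longrightarrow> coef (P $$ (i, j)) k \<noteq> 0 \<Longrightarrow> a \<le> k \<and> k \<le> b"
  shows "coeffsupp P \<subseteq> {a..b}"
proof -
  define K where "K = {k. map_mat (\<lambda>p. coef p k) P \<noteq> 0\<^sub>m (dim_row P) (dim_col P)}"
  have "K \<subseteq> {a..b}"
  proof
    fix k assume "k \<in> K"
    then obtain i j where "i < dim_row P" "j < dim_col P" "coef (P $$ (i, j)) k \<noteq> 0"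
      unfolding K_def by (auto simp: mat_eq_iff)
    then show "k \<in> {a..b}"
      using assms by auto
  qed
  show ?thesis
  proof (cases "K = {}")
    case False
    then have "Min K \<in> K" "Max K \<in> K"
      using \<open>K \<subseteq> {a..b}\<close> finite_subset[of K "{a..b}"] by auto
    then have "Min K \<in> {a..b}" "Max K \<in> {a..b}"
      using \<open>K \<subseteq> {a..b}\<close> by blast+
    then show ?thesis
      unfolding coeffsupp_def K_def[symmetric] Let_def by auto
  qed (simp add: coeffsupp_def K_def[symmetric])
qed

definition half_length :: "laurent \<Rightarrow> int" where
  "half_length p = \<lceil>real_of_int (Max (Poly_Mapping.keys p) - Min (Poly_Mapping.keys p)) / 2\<rceil>"

lemma ereal_ceiling_entry_supp_length:
  assumes "P $$ (m, n) \<noteq> 0"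
  shows "ereal_ceiling (entry_supp_length P m n / 2) = ereal (real_of_int (half_length (P $$ (m, n))))"
proof -
  have "{k. map_mat (\<lambda>p. coef p k) (mat 1 1 (\<lambda>_. P $$ (m, n))) \<noteq> 0\<^sub>m 1 1} = Poly_Mapping.keys (P $$ (m, n))"
    by (auto simp: mat_eq_iff in_keys_iff)
  moreover have "Poly_Mapping.keys (P $$ (m, n)) \<noteq> {}"
    using assms by simp
  moreover have "Max {Min A..Max A} = Max A \<and> Min {Min A..Max A} = Min A" if "finite A" "A \<noteq> {}" for A :: "int set"
  proof -
    have "Min A \<le> Max A"
      using that by simp
    then show ?thesis
      by (auto intro: Max_eqI Min_eqI)
  qed
  ultimately have "entry_supp_length P m n
      = ereal (real_of_int (Max (Poly_Mapping.keys (P $$ (m, n))) - Min (Poly_Mapping.keys (P $$ (m, n)))))"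
    by (simp add: entry_supp_length_def coeffsupp_def supp_length_def Let_def)
  then show ?thesis
    by (simp add: ereal_ceiling_def half_length_def)
qed

text \<open>The support of \<open>p\<close> is symmetric about \<open>(2 b - t + d) / 2\<close>, so after centering at \<open>b\<close>
  it reaches at most half the support length, rounded up, to either side.\<close>

lemma centered_support:
  assumes sym: "p = mon (2 * b - t + d) e * laurent_reflect p" and e: "e \<noteq> 0"
    and td: "t \<in> {0, 1::int}" "d \<in> {0, 1}" and nz: "coef p (k + b) \<noteq> 0"
  shows "- half_length p \<le> k - d + t \<and> k - d + t \<le> half_length p"
proof -
  define k' where "k' = (2 * b - t + d) - (k + b)"
  have "coef p (k + b) = coef (mon (2 * b - t + d) e * laurent_reflect p) (k + b)"
    using sym by (rule arg_cong)
  also have "\<dots> = e * coef p k'"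
    unfolding coef_single_mult coef_reflect k'_def by (simp add: algebra_simps)
  finally have nz': "coef p k' \<noteq> 0"
    using nz by auto
  define len where "len = Max (Poly_Mapping.keys p) - Min (Poly_Mapping.keys p)"
  have "k + b \<le> Max (Poly_Mapping.keys p)" "Min (Poly_Mapping.keys p) \<le> k + b"
    "k' \<le> Max (Poly_Mapping.keys p)" "Min (Poly_Mapping.keys p) \<le> k'"
    using nz nz' by (auto simp: in_keys_iff)
  then have "\<bar>(k + b) - k'\<bar> \<le> len"
    by (auto simp: len_def)
  \<comment> \<open>\<open>(k + b) - k'\<close> is \<open>2 * k + t - d\<close>, so passing to
    \<open>2 * (k - d + t)\<close> costs \<open>t - d\<close>, at most 1 in absolute value. Since
    \<open>len \<le> 2 * half_length p\<close>, integrality removes this 1 again.\<close>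
  then have "2 * (k - d + t) \<le> len + 1" "- (2 * (k - d + t)) \<le> len + 1"
    using td by (auto simp: k'_def)
  moreover have "real_of_int len / 2 \<le> real_of_int (half_length p)"
    unfolding half_length_def len_def by (rule le_of_int_ceiling)
  then have "len \<le> 2 * half_length p"
    by linarith
  ultimately show ?thesis
    by auto
qed

section \<open>Symmetry of a product of compatible factors\<close>

lemma msym_scale:
  assumes "msym e c e' c' M" "\<kappa> * \<kappa> = 1"
  shows "msym (\<lambda>i. e i * \<kappa>) (\<lambda>i. c i + \<delta>) (\<lambda>j. e' j * \<kappa>) (\<lambda>j. c' j + \<delta>) M"
proof -
  have eq: "e i * \<kappa> * (e' j * \<kappa>) = e i * e' j" for i j
    using assms(2) by (metis (no_types, lifting) mult.assoc mult.left_commute mult.right_neutral)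
  show ?thesis
    using assms(1) unfolding msym_def by (simp only: eq add_diff_cancel_right)
qed

lemma msym_cong:
  assumes "M \<in> carrier_mat m n" "\<And>i. i < m \<Longrightarrow> e i = f i \<and> c i = d i" "\<And>j. j < n \<Longrightarrow> e' j = f' j \<and> c' j = d' j"
  shows "msym e c e' c' M \<longleftrightarrow> msym f d f' d' M"
  using assms by (auto simp: msym_def)

lemma mon_eqD:
  assumes "mon k a = mon l b" "a \<noteq> 0"
  shows "k = l" "a = b"
proof -
  have "coef (mon k a) k = coef (mon l b) k"
    using assms(1) by simp
  then show "k = l" "a = b"
    using assms(2) by (auto simp: lookup_single when_def split: if_splits)
qed

text \<open>The common value \<open>S n\<close> determines the left symmetry row of the \<open>n\<close>-th factor up to one
  monomial, and this monomial can be moved to the right symmetry row of the product.\<close>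

lemma mat_chain_msym:
  assumes s: "s \<ge> 1" and Q: "\<And>j. j \<le> Suc J \<Longrightarrow> Q j \<in> carrier_mat s s"
    and S: "\<And>j. j \<le> Suc J \<Longrightarrow> mat_sym_value (Q j) (S j)"
    and compat: "\<And>j. j \<le> J \<Longrightarrow> mutually_compatible (S (j + 1)) (S j)"
    and n: "n \<le> Suc J"
  shows "\<exists>e c e' c' f b. (\<forall>i. e i \<in> {-1, 1}) \<and> (\<forall>i. e' i \<in> {-1, 1}) \<and> (\<forall>i. f i \<in> {-1, 1}) \<and>
    msym e c e' c' (mat_chain Q n) \<and> S n = mat_adj (trow s e c) * trow s f b"
proof -
  have Sdim: "S j \<in> carrier_mat s s" if "j \<le> Suc J" for j
    using S[OF that] Q[OF that] by (auto simp: mat_sym_value_def)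
  have comp: "\<exists>e1 c1 e2 c2 e3 c3. (\<forall>i. e1 i \<in> {-1, 1}) \<and> (\<forall>i. e2 i \<in> {-1, 1}) \<and> (\<forall>i. e3 i \<in> {-1, 1}) \<and>
      S (Suc j) = mat_adj (trow s e1 c1) * trow s e2 c2 \<and> S j = mat_adj (trow s e2 c2) * trow s e3 c3"
    if j: "j \<le> J" for j
  proof -
    have dims: "dim_row (S (j + 1)) = s" "dim_col (S (j + 1)) = s" "dim_col (S j) = s"
      using Sdim[of j] Sdim[of "j + 1"] j by auto
    obtain \<theta>1 T1 \<theta> T \<theta>2 T2 where *: "sym_row s \<theta>1 T1" "sym_row s \<theta> T" "sym_row s \<theta>2 T2"
      "S (Suc j) = mat_adj T1 * T" "S j = mat_adj T * T2"
      using compat[OF j] unfolding mutually_compatible_def dims by auto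
    obtain e1 c1 where "T1 = trow s e1 c1" "\<And>i. e1 i \<in> {-1, 1}"
      using sym_row_imp_trow[OF *(1)] by blast
    moreover obtain e2 c2 where "T = trow s e2 c2" "\<And>i. e2 i \<in> {-1, 1}"
      using sym_row_imp_trow[OF *(2)] by blast
    moreover obtain e3 c3 where "T2 = trow s e3 c3" "\<And>i. e3 i \<in> {-1, 1}"
      using sym_row_imp_trow[OF *(3)] by blast
    ultimately show ?thesis
      using *(4,5) by blast
  qed
  show ?thesis
    using n
  proof (induction n)
    case 0
    obtain e2 c2 e3 c3 where *: "\<forall>i. e2 i \<in> {-1, 1}" "\<forall>i. e3 i \<in> {-1, 1}"
      "S 0 = mat_adj (trow s e2 c2) * trow s e3 c3"
      using comp[of 0] by blast
    then have "msym e2 c2 e3 c3 (Q 0)"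
      using S[of 0] mat_sym_value_iff_msym[OF Q[of 0], of e2 e3 c2 c3] by simp
    then have "msym e2 c2 e3 c3 (mat_chain Q 0)"
      by simp
    with * show ?case
      by blast
  next
    case (Suc n)
    then obtain e c e' c' f b where IH: "\<forall>i. e i \<in> {-1, 1}" "\<forall>i. e' i \<in> {-1, 1}" "\<forall>i. f i \<in> {-1, 1}"
      "msym e c e' c' (mat_chain Q n)" "S n = mat_adj (trow s e c) * trow s f b"
      using Suc_leD by blast
    obtain e1 c1 e2 c2 e3 c3 where *: "\<forall>i. e1 i \<in> {-1, 1}" "\<forall>i. e2 i \<in> {-1, 1}" "\<forall>i. e3 i \<in> {-1, 1}"
      "S (Suc n) = mat_adj (trow s e1 c1) * trow s e2 c2" "S n = mat_adj (trow s e2 c2) * trow s e3 c3"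
      using comp[of n] Suc.prems by auto
    \<comment> \<open>The two representations of \<open>S n\<close> are compared in column 0, which
      exists because \<open>s \<ge> 1\<close>. Their left rows differ by the same monomial with sign
      \<open>\<kappa>\<close> and exponent \<open>\<delta>\<close> in every place.\<close>
    define \<kappa> where "\<kappa> = f 0 * e3 0"
    define \<delta> where "\<delta> = c3 0 - b 0"
    have f0: "f 0 \<in> {-1, 1}" "e3 0 \<in> {-1, 1}"
      using IH(3) *(3) by blast+
    then have \<kappa>: "\<kappa> * \<kappa> = 1" "\<kappa> \<in> {-1, 1}"
      by (auto simp: \<kappa>_def)
    have left: "e2 i = e i * \<kappa> \<and> c2 i = c i + \<delta>" if i: "i < s" for i
    proof -
      have ei: "e i \<in> {-1, 1}" "e2 i \<in> {-1, 1}"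
        using IH(1) *(2) by blast+
      have "S n $$ (i, 0) = mon (b 0 - c i) (e i * f 0)"
        unfolding IH(5) by (subst adj_trow_mult) (use IH(1) i s in auto)
      moreover have "S n $$ (i, 0) = mon (c3 0 - c2 i) (e2 i * e3 0)"
        unfolding *(5) by (subst adj_trow_mult) (use *(2) i s in auto)
      ultimately have "mon (b 0 - c i) (e i * f 0) = mon (c3 0 - c2 i) (e2 i * e3 0)"
        by simp
      from mon_eqD[OF this] have "b 0 - c i = c3 0 - c2 i" "e i * f 0 = e2 i * e3 0"
        using ei f0 by auto
      then show ?thesis
        using ei f0 by (auto simp: \<kappa>_def \<delta>_def)
    qed
    have "msym (\<lambda>i. e i * \<kappa>) (\<lambda>i. c i + \<delta>) (\<lambda>j. e' j * \<kappa>) (\<lambda>j. c' j + \<delta>) (mat_chain Q n)"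
      using IH(4) \<kappa>(1) by (rule msym_scale)
    moreover have chain: "mat_chain Q n \<in> carrier_mat s s"
      using Q Suc.prems by (intro mat_chain_carrier) auto
    ultimately have "msym e2 c2 (\<lambda>j. e' j * \<kappa>) (\<lambda>j. c' j + \<delta>) (mat_chain Q n)"
      using left by (subst msym_cong[OF chain]) auto
    moreover have "msym e1 c1 e2 c2 (Q (Suc n))"
      using S[of "Suc n"] mat_sym_value_iff_msym[OF Q[of "Suc n"], of e1 e2 c1 c2] * Suc.prems by simp
    ultimately have sym: "msym e1 c1 (\<lambda>j. e' j * \<kappa>) (\<lambda>j. c' j + \<delta>) (mat_chain Q (Suc n))"
      using msym_mult[OF Q[OF Suc.prems] _ chain] *(2) by auto
    have "\<forall>j. e' j * \<kappa> \<in> {-1, 1}"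
    proof
      show "e' j * \<kappa> \<in> {-1, 1}" for j
        using spec[OF IH(2), of j] \<kappa>(2) by auto
    qed
    then show ?case
      by (intro exI[of _ e1] exI[of _ c1] exI[of _ "\<lambda>j. e' j * \<kappa>"] exI[of _ "\<lambda>j. c' j + \<delta>"]
          exI[of _ e2] exI[of _ c2] conjI sym *(1,2,4))
  qed
qed

text \<open>Moving the truncation past the block diagonal factor writes \<open>P\<close> as a
  product of matrices with orthonormal rows. The compatible symmetry rows are read off from the
  chain of factors, not from \<open>T1\<close> and \<open>T2\<close>; \<open>P\<close> inherits them
  as the first \<open>r\<close> rows of the chain.\<close>

lemma symmetric_factorization_imp:
  assumes r: "1 \<le> r" "r \<le> s" and P: "P \<in> carrier_mat r s"
    and T: "sym_row r \<theta>1 T1" "sym_row s \<theta>2 T2" and fact: "symmetric_factorization F r s P T1 T2"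
  shows "paraunitary P" "\<exists>\<theta>1 T1 \<theta>2 T2. compatible_via P \<theta>1 T1 \<theta>2 T2"
proof -
  obtain J Q where Q: "\<And>j. j \<le> Suc J \<Longrightarrow> Q j \<in> carrier_mat s s"
    and PQ: "P = truncation r s * mat_chain Q (Suc J)"
    and el: "\<And>j. 1 \<le> j \<Longrightarrow> j \<le> J \<Longrightarrow> elementary (Q j)" and comp: "mutually_compatible_upto J Q"
    and Q0: "Q 0 = mat_adj (regrouping_matrix T2)"
    and QJ: "Q (Suc J) = diag_block_mat [regrouping_matrix T1, 1\<^sub>m (s - r)]"
    using fact unfolding symmetric_factorization_def truncation_def[symmetric] Suc_eq_plus1[symmetric] by blast
  obtain \<pi>1 f1 where \<pi>1: "\<pi>1 permutes {..<r}" "regrouping_matrix T1 = perm_mat r \<pi>1 f1"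
    using regrouping_matrix_eq_perm_mat[OF T(1)] by metis
  obtain \<pi>2 f2 where \<pi>2: "\<pi>2 permutes {..<s}" "regrouping_matrix T2 = perm_mat s \<pi>2 f2"
    using regrouping_matrix_eq_perm_mat[OF T(2)] by metis
  have chain: "mat_chain Q n \<in> carrier_mat s s" if "n \<le> Suc J" for n
    using Q that by (intro mat_chain_carrier) auto
  have unitary: "mat_chain Q n * mat_adj (mat_chain Q n) = 1\<^sub>m s" if "n \<le> J" for n
    using that
  proof (induction n)
    case 0
    then show ?case
      using adj_perm_mat_mult[OF \<pi>2(1)] by (simp add: Q0 \<pi>2(2))
  next
    case (Suc n)
    have "Q (Suc n) * mat_adj (Q (Suc n)) = 1\<^sub>m s"
      using el[of "Suc n"] Q[of "Suc n"] Suc.prems by (simp add: elementary_def paraunitary_iff)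
    then show ?case
      unfolding mat_chain.simps using Suc Q[of "Suc n"] chain[of n] by (intro paraunitary_mult) auto
  qed
  let ?U = "perm_mat r \<pi>1 f1"
  have "P = (truncation r s * diag_block_mat [?U, 1\<^sub>m (s - r)]) * mat_chain Q J"
    unfolding PQ mat_chain.simps QJ \<pi>1(2)
    by (rule assoc_mult_mat[symmetric]) (use diag_block_one_carrier[of ?U r s] r chain[of J] in auto)
  then have PU: "P = (?U * truncation r s) * mat_chain Q J"
    using truncation_diag_block[of ?U r s] r by simp
  have UT: "?U * truncation r s \<in> carrier_mat r s"
    by (rule mult_carrier_mat[of _ r r]) simp_all
  have "(?U * truncation r s) * mat_adj (?U * truncation r s) = 1\<^sub>m r"
    using perm_mat_mult_adj[OF \<pi>1(1)] truncation_mult_adj[OF r(2)] by (intro paraunitary_mult) auto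
  then have "P * mat_adj P = 1\<^sub>m r"
    unfolding PU using paraunitary_mult[OF UT chain[of J] _ unitary[of J]] by simp
  then show "paraunitary P"
    using P by (simp add: paraunitary_iff)
  obtain S where S: "\<And>j. j \<le> Suc J \<Longrightarrow> mat_sym_value (Q j) (S j)"
    "\<And>j. j \<le> J \<Longrightarrow> mutually_compatible (S (j + 1)) (S j)"
    using comp unfolding mutually_compatible_upto_def by auto
  obtain e c e' c' where *: "\<forall>i. e i \<in> {-1, 1}" "\<forall>i. e' i \<in> {-1, 1}" "msym e c e' c' (mat_chain Q (Suc J))"
  proof -
    have "\<exists>e c e' c' f b. (\<forall>i. e i \<in> {-1, 1}) \<and> (\<forall>i. e' i \<in> {-1, 1}) \<and> (\<forall>i. f i \<in> {-1, 1}) \<and>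
        msym e c e' c' (mat_chain Q (Suc J)) \<and> S (Suc J) = mat_adj (trow s e c) * trow s f b"
      by (rule mat_chain_msym[where J = J]) (use r Q S in auto)
    then show ?thesis
      using that by blast
  qed
  have "msym e c e' c' P"
    unfolding msym_def
  proof (intro allI impI)
    fix i j assume "i < dim_row P" "j < dim_col P"
    then have ij: "i < r" "j < s"
      using P by auto
    have eq: "P $$ (i, j) = mat_chain Q (Suc J) $$ (i, j)"
      unfolding PQ using r ij chain[of "Suc J"] by (intro truncation_mult_index) auto
    have "i < dim_row (mat_chain Q (Suc J))" "j < dim_col (mat_chain Q (Suc J))"
      using ij r chain[of "Suc J"] by (auto simp del: mat_chain.simps)
    then show "P $$ (i, j) = mon (c' j - c i) (e i * e' j) * laurent_reflect (P $$ (i, j))"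
      using *(3) unfolding eq msym_def by blast
  qed
  then have "compatible_via P (0\<^sub>m 1 r) (trow r e c) (0\<^sub>m 1 s) (trow s e' c')"
    unfolding compatible_via_def using P *(1,2) sym_row_zero[of r e c] sym_row_zero[of s e' c']
      mat_sym_value_iff_msym[OF P, of e e' c c'] by auto
  then show "\<exists>\<theta>1 T1 \<theta>2 T2. compatible_via P \<theta>1 T1 \<theta>2 T2"
    by blast
qed

section \<open>From a paraunitary matrix with symmetry to its factors\<close>

lemma (in conj_sqrt_field) perm_mat_coeffs: "coeffs_in F (perm_mat n \<pi> f)"
  by (auto simp: coeffs_in_def perm_mat_def lookup_single when_def)

lemma (in conj_sqrt_field) adj_coeffs: "coeffs_in F A \<Longrightarrow> coeffs_in F (mat_adj A)"
  by (auto simp: coeffs_in_def)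

lemma ceiling_half_cases:
  fixes c :: int
  shows "c - 2 * \<lceil>real_of_int c / 2\<rceil> \<in> {0, -1}"
  by (auto; linarith)

lemma (in conj_sqrt_field) symmetric_factorization_exists:
  assumes r: "1 \<le> r" "r \<le> s" and P: "P \<in> carrier_mat r s" "coeffs_in F P" "paraunitary P"
    and compat: "compatible_via P \<theta>1 T1 \<theta>2 T2"
  shows "symmetric_factorization F r s P T1 T2"
proof -
  have T: "sym_row r \<theta>1 T1" "sym_row s \<theta>2 T2" "mat_sym_value P (mat_adj T1 * T2)"
    using compat P(1) by (auto simp: compatible_via_def)
  obtain e1 c1 \<pi>1 where T1: "T1 = trow r e1 c1" and e1: "\<And>j. e1 j \<in> {-1, 1}" and \<pi>1: "\<pi>1 permutes {..<r}"
    and "regrouping_matrix T1 = perm_mat r \<pi>1 (\<lambda>j. \<lceil>real_of_int (c1 j) / 2\<rceil>)"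
    by (rule regrouping_matrix_eq_perm_mat[OF T(1)]) blast
  obtain e2 c2 \<pi>2 where T2: "T2 = trow s e2 c2" and e2: "\<And>j. e2 j \<in> {-1, 1}" and \<pi>2: "\<pi>2 permutes {..<s}"
    and "regrouping_matrix T2 = perm_mat s \<pi>2 (\<lambda>j. \<lceil>real_of_int (c2 j) / 2\<rceil>)"
    by (rule regrouping_matrix_eq_perm_mat[OF T(2)]) blast
  define f1 where "f1 j = \<lceil>real_of_int (c1 j) / 2\<rceil>" for j
  define f2 where "f2 j = \<lceil>real_of_int (c2 j) / 2\<rceil>" for j
  define U1 where "U1 = perm_mat r \<pi>1 f1"
  define U2 where "U2 = perm_mat s \<pi>2 f2"
  have reg: "regrouping_matrix T1 = U1" "regrouping_matrix T2 = U2"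
    unfolding U1_def U2_def f1_def f2_def by fact+
  have U1: "U1 \<in> carrier_mat r r" and U2: "U2 \<in> carrier_mat s s"
    by (simp_all add: U1_def U2_def)
  define h where "h i = e1 (\<pi>1 i)" for i
  \<comment> \<open>Regrouped symmetries have exponent 0 or -1; the minus sign turns them into the 0
    and 1 used for \<open>d\<close> and \<open>tt\<close>.\<close>
  define d where "d i = - (c1 (\<pi>1 i) - 2 * f1 (\<pi>1 i))" for i
  define ep where "ep j = e2 (\<pi>2 j)" for j
  define tt where "tt j = - (c2 (\<pi>2 j) - 2 * f2 (\<pi>2 j))" for j
  have d: "d i \<in> {0, 1}" and tt: "tt i \<in> {0, 1}" for i
    using ceiling_half_cases[of "c1 (\<pi>1 i)"] ceiling_half_cases[of "c2 (\<pi>2 i)"]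
    by (auto simp: d_def tt_def f1_def f2_def)
  have h: "h i \<in> {-1, 1}" and ep: "ep i \<in> {-1, 1}" for i
    unfolding h_def ep_def by (rule e1 e2)+
  have sym1: "msym e1 c1 h (\<lambda>i. - d i) U1" and sym2: "msym e2 c2 ep (\<lambda>i. - tt i) U2"
    using perm_mat_msym[where e = e1 and c = c1 and f = f1, OF \<pi>1 e1] perm_mat_msym[where e = e2 and c = c2 and f = f2, OF \<pi>2 e2]
    by (simp_all add: U1_def U2_def h_def[abs_def] ep_def[abs_def] d_def[abs_def] tt_def[abs_def])
  have symP: "msym e1 c1 e2 c2 P"
    using T(3) mat_sym_value_iff_msym[OF P(1), of e1 e2 c1 c2] e1 e2 by (simp add: T1 T2)
  define Q where "Q = mat_adj U1 * P * U2"
  have aU1P: "mat_adj U1 * P \<in> carrier_mat r s"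
    by (rule mult_carrier_mat[OF mat_adj_carrier[OF U1] P(1)])
  have Qc: "Q \<in> carrier_mat r s"
    unfolding Q_def by (rule mult_carrier_mat[OF aU1P U2])
  have PQ: "P = U1 * Q * mat_adj U2"
  proof -
    have "U1 * Q * mat_adj U2 = U1 * (Q * mat_adj U2)"
      using U1 U2 Qc by (intro assoc_mult_mat) auto
    also have "Q * mat_adj U2 = (mat_adj U1 * P) * (U2 * mat_adj U2)"
      unfolding Q_def using aU1P U2 by (intro assoc_mult_mat) auto
    also have "\<dots> = mat_adj U1 * P"
      unfolding U2_def perm_mat_mult_adj[OF \<pi>2] by (rule right_mult_one_mat[OF aU1P])
    also have "U1 * (mat_adj U1 * P) = (U1 * mat_adj U1) * P"
      using U1 P(1) by (intro assoc_mult_mat[symmetric]) auto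
    also have "\<dots> = P"
      unfolding U1_def perm_mat_mult_adj[OF \<pi>1] by (rule left_mult_one_mat[OF P(1)])
    finally show ?thesis ..
  qed
  have symQ: "msym h (\<lambda>i. - d i) ep (\<lambda>j. - tt j) Q"
    unfolding Q_def
    by (rule msym_mult[OF aU1P msym_mult[OF mat_adj_carrier[OF U1] msym_adj[OF sym1 e1 h] P(1) symP e1] U2 sym2 e2])
  have coeffsQ: "coeffs_in F Q"
    unfolding Q_def
    using coeffs_in_mult[OF aU1P U2 coeffs_in_mult[OF mat_adj_carrier[OF U1] P(1) adj_coeffs P(2)]] perm_mat_coeffs
    by (simp add: U1_def U2_def)
  have unitQ: "Q * mat_adj Q = 1\<^sub>m r"
  proof -
    have "P * mat_adj P = 1\<^sub>m r"
      using P(1,3) by (simp add: paraunitary_iff)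
    then have "(mat_adj U1 * P) * mat_adj (mat_adj U1 * P) = 1\<^sub>m r"
      by (rule paraunitary_mult[OF mat_adj_carrier[OF U1] P(1), rotated])
        (simp add: U1_def adj_perm_mat_mult[OF \<pi>1])
    then show ?thesis
      unfolding Q_def by (rule paraunitary_mult[OF aU1P U2]) (simp add: U2_def perm_mat_mult_adj[OF \<pi>2])
  qed
  \<comment> \<open>Zero entries have support length \<open>- \<infinity>\<close> in the bound,
    while \<open>half_length\<close> is meaningful for nonzero polynomials only.\<close>
  define A where "A = {(i, j). i < r \<and> j < s \<and> P $$ (i, j) \<noteq> 0}"
  have "finite A"
    by (rule finite_subset[of _ "{..<r} \<times> {..<s}"]) (auto simp: A_def)
  \<comment> \<open>The inserted 1 guarantees an elementary factor that can absorb the constant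
    completion; it corresponds to the \<open>max 1\<close> in the bound on \<open>J\<close>.\<close>
  define B where "B = insert 1 ((\<lambda>(i, j). half_length (P $$ (i, j))) ` A)"
  have B: "finite B" "1 \<in> B" "B \<noteq> {}" "\<And>i j. (i, j) \<in> A \<Longrightarrow> half_length (P $$ (i, j)) \<in> B"
    using \<open>finite A\<close> by (auto simp: B_def)
  define M where "M = Max B"
  have M: "M \<ge> 1" "\<And>i j. (i, j) \<in> A \<Longrightarrow> half_length (P $$ (i, j)) \<le> M" "M \<in> B"
    unfolding M_def using B by (auto intro: Max_ge Max_in)
  define J where "J = nat M"
  have J: "int J = M" "J \<ge> 1"
    using M(1) by (auto simp: J_def)
  have suppQ: "- int J \<le> k - d i + tt j \<and> k - d i + tt j \<le> int J"
    if ij: "i < r" "j < s" and nz: "coef (Q $$ (i, j)) k \<noteq> 0" for i j k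
  proof -
    define a where "a = \<pi>1 i"
    define b where "b = \<pi>2 j"
    have ab: "a < r" "b < s"
      using permutes_in_image[OF \<pi>1, of i] permutes_in_image[OF \<pi>2, of j] ij by (auto simp: a_def b_def)
    have "Q $$ (i, j) = mon (- f2 b) 1 * (mat_adj U1 * P) $$ (i, b)"
      unfolding Q_def U2_def b_def by (rule mult_perm_mat_index[OF \<pi>2 aU1P ij])
    also have "(mat_adj U1 * P) $$ (i, b) = mon (f1 a) 1 * P $$ (a, b)"
      unfolding U1_def a_def by (rule adj_perm_mat_mult_index[OF \<pi>1 P(1) ij(1) ab(2)])
    finally have eq: "Q $$ (i, j) = mon (- f2 b) 1 * (mon (f1 a) 1 * P $$ (a, b))" .
    have nz': "coef (P $$ (a, b)) (k + (f2 b - f1 a)) \<noteq> 0"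
      using nz unfolding eq coef_single_mult by (simp add: algebra_simps)
    have "P $$ (a, b) = mon (c2 b - c1 a) (e1 a * e2 b) * laurent_reflect (P $$ (a, b))"
      using symP ab P(1) by (auto simp: msym_def)
    moreover have "c2 b - c1 a = 2 * (f2 b - f1 a) - tt j + d i"
      by (simp add: a_def b_def tt_def d_def)
    ultimately have "P $$ (a, b) = mon (2 * (f2 b - f1 a) - tt j + d i) (e1 a * e2 b) * laurent_reflect (P $$ (a, b))"
      by simp
    moreover have "e1 a * e2 b \<noteq> 0"
      using e1[of a] e2[of b] by auto
    ultimately have *: "- half_length (P $$ (a, b)) \<le> k - d i + tt j \<and> k - d i + tt j \<le> half_length (P $$ (a, b))"
      using tt d nz' by (rule centered_support)
    have "(a, b) \<in> A"
      using ab nz' by (auto simp: A_def)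
    then show ?thesis
      using * M(2)[of a b] J(1) by linarith
  qed
  have bound: "ereal (real J) \<le> max 1 (MAX (m,n)\<in>{..<r} \<times> {..<s}. ereal_ceiling (entry_supp_length P m n / 2))"
  proof (cases "M = 1")
    case True
    then have "ereal (real J) = 1"
      using J by simp
    then show ?thesis
      by (metis max.cobounded1)
  next
    case False
    then obtain i j where ij: "(i, j) \<in> A" "M = half_length (P $$ (i, j))"
      using M(3) by (auto simp: B_def)
    have "ereal (real J) = ereal (real_of_int (half_length (P $$ (i, j))))"
      using J(1) ij(2) by (metis of_int_of_nat_eq)
    also have "\<dots> = ereal_ceiling (entry_supp_length P i j / 2)"
      using ij(1) ereal_ceiling_entry_supp_length[of P i j] by (simp add: A_def)
    also have "\<dots> \<le> (MAX (m,n)\<in>{..<r} \<times> {..<s}. ereal_ceiling (entry_supp_length P m n / 2))"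
      using ij(1) by (intro Max_ge) (auto simp: A_def)
    finally show ?thesis
      by (rule max.coboundedI2)
  qed
  obtain R e t where R: "\<And>m. m < J \<Longrightarrow> elementary_step F s (e (Suc m)) (t (Suc m)) (e m) (t m) (R m)"
    and et0: "e 0 = ep" "t 0 = tt" and et: "\<And>m i. e m i \<in> {-1, 1}"
    and etJ: "\<And>i. i < r \<Longrightarrow> e J i = h i \<and> t J i = d i"
    and QR: "Q = truncation r s * mat_chain R (J - 1)"
    using elementary_factorization[OF J(2) Qc coeffsQ unitQ h d ep tt symQ suppQ] unfolding truncation_def by blast
  define D where "D = diag_block_mat [U1, 1\<^sub>m (s - r)]"
  have Dc: "D \<in> carrier_mat s s"
    unfolding D_def by (rule diag_block_one_carrier[OF U1 r(2)])
  have D_index: "D $$ (i, j) = (if i < r \<and> j < r then U1 $$ (i, j) else if i = j then 1 else 0)"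
    if "i < s" "j < s" for i j
    unfolding D_def by (rule diag_block_one_index[OF U1 r(2) that])
  have D_coeffs: "coef (D $$ (i, j)) k \<in> F" if "i < s" "j < s" for i j k
    unfolding D_index[OF that] using perm_mat_coeffs[of r \<pi>1 f1]
    by (auto simp: coeffs_in_def U1_def lookup_one when_def)
  define X where "X j = (if j = 0 then mat_adj U2 else if j \<le> J then R (j - 1) else D)" for j
  \<comment> \<open>\<open>E j\<close> and \<open>C j\<close> form the symmetry row to the right of
    the factor \<open>X j\<close>, and thus to the left of \<open>X (j - 1)\<close> for
    \<open>j \<ge> 1\<close>. The outermost row extends \<open>T1\<close> by the symmetries that the
    completion produced beyond index \<open>r\<close>.\<close>
  define E where "E j = (if j = 0 then e2 else if j \<le> Suc J then e (j - 1) else (\<lambda>i. if i < r then e1 i else e J i))" for j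
  define C where "C j = (if j = 0 then c2 else if j \<le> Suc J then (\<lambda>i. - t (j - 1) i)
    else (\<lambda>i. if i < r then c1 i else - t J i))" for j
  have E: "E j i \<in> {-1, 1}" for j i
    unfolding E_def using e1[of i] e2[of i] et[of "j - 1" i] et[of J i] by auto
  \<comment> \<open>On the block \<open>U1\<close> this is the regrouping symmetry, since the row of
    the last elementary factor agrees with \<open>h\<close> and \<open>d\<close> on the first
    \<open>r\<close> indices. The identity block needs equal rows on both sides, which explains the
    extension beyond \<open>r\<close>.\<close>
  have symD: "msym (\<lambda>i. if i < r then e1 i else e J i) (\<lambda>i. if i < r then c1 i else - t J i) (e J) (\<lambda>i. - t J i) D"
    unfolding msym_def
  proof (intro allI impI)
    fix i j assume "i < dim_row D" "j < dim_col D"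
    then have ij: "i < s" "j < s"
      using Dc by auto
    show "D $$ (i, j) = mon (- t J j - (if i < r then c1 i else - t J i)) ((if i < r then e1 i else e J i) * e J j) *
        laurent_reflect (D $$ (i, j))"
    proof (cases "i < r \<and> j < r")
      case True
      then have "U1 $$ (i, j) = mon (- d j - c1 i) (e1 i * h j) * laurent_reflect (U1 $$ (i, j))"
        using sym1 U1 by (auto simp: msym_def)
      then show ?thesis
        using True etJ[of j] by (simp add: D_index[OF ij])
    next
      case False
      have "e J i * e J i = 1"
        using et[of J i] by auto
      then show ?thesis
        using False by (auto simp: D_index[OF ij])
    qed
  qed
  have X: "X j \<in> carrier_mat s s \<and> coeffs_in F (X j) \<and> msym (E (Suc j)) (C (Suc j)) (E j) (C j) (X j)" if jJ: "j \<le> Suc J" for j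
  proof -
    consider "j = 0" | "0 < j" "j \<le> J" | "j = Suc J"
      using jJ by linarith
    then show ?thesis
    proof cases
      case 1
      have "msym ep (\<lambda>i. - tt i) e2 c2 (mat_adj U2)"
        by (rule msym_adj[OF sym2 e2 ep])
      moreover have "coeffs_in F (mat_adj U2)"
        unfolding U2_def by (intro adj_coeffs perm_mat_coeffs)
      ultimately show ?thesis
        using 1 U2 by (simp add: X_def E_def C_def et0)
    next
      case 2
      then have "elementary_step F s (e j) (t j) (e (j - 1)) (t (j - 1)) (R (j - 1))"
        using R[of "j - 1"] by simp
      then show ?thesis
        using 2 by (simp add: X_def E_def C_def elementary_step_def)
    next
      case 3
      have "coeffs_in F D"
        using D_coeffs Dc by (auto simp: coeffs_in_def)
      then show ?thesis
        using 3 Dc symD J(2) by (simp add: X_def E_def C_def)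
    qed
  qed
  have chainX: "mat_chain X J = mat_chain R (J - 1) * mat_adj U2"
  proof -
    have "mat_chain X (Suc (J - 1)) = mat_chain (\<lambda>m. X (Suc m)) (J - 1) * X 0"
      using X by (intro mat_chain_Suc_left[where s = s]) (use J(2) in auto)
    moreover have "mat_chain (\<lambda>m. X (Suc m)) (J - 1) = mat_chain R (J - 1)"
      using J(2) by (intro mat_chain_cong) (auto simp: X_def)
    ultimately show ?thesis
      using J(2) by (simp add: X_def)
  qed
  have chainR: "mat_chain R (J - 1) \<in> carrier_mat s s"
    using R J(2) by (intro mat_chain_carrier) (auto simp: elementary_step_def)
  have PX: "P = truncation r s * mat_chain X (J + 1)"
  proof -
    have "truncation r s * mat_chain X (J + 1) = truncation r s * (D * mat_chain X J)"
      by (simp add: X_def)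
    also have "\<dots> = (truncation r s * D) * (mat_chain R (J - 1) * mat_adj U2)"
      unfolding chainX using Dc chainR U2 by (intro assoc_mult_mat[symmetric]) auto
    also have "truncation r s * D = U1 * truncation r s"
      unfolding D_def by (rule truncation_diag_block[OF U1 r(2)])
    also have "U1 * truncation r s * (mat_chain R (J - 1) * mat_adj U2)
        = (U1 * truncation r s * mat_chain R (J - 1)) * mat_adj U2"
      using U1 chainR U2 by (intro assoc_mult_mat[symmetric]) auto
    also have "U1 * truncation r s * mat_chain R (J - 1) = U1 * Q"
      unfolding QR using U1 chainR by (intro assoc_mult_mat) auto
    finally show ?thesis
      using PQ by simp
  qed
  have elem: "elementary (X j)" if "1 \<le> j" "j \<le> J" for j
  proof -
    have step: "elementary_step F s (e (Suc (j - 1))) (t (Suc (j - 1))) (e (j - 1)) (t (j - 1)) (R (j - 1))"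
      using R[of "j - 1"] that by simp
    have "coeffsupp (R (j - 1)) \<subseteq> {-1..1}"
      using step by (intro coeffsupp_subset) (auto simp: elementary_step_def)
    moreover have "paraunitary (R (j - 1))"
      using step by (auto simp: elementary_step_def paraunitary_iff)
    ultimately show ?thesis
      using that by (simp add: elementary_def X_def)
  qed
  \<comment> \<open>Neighbouring values share the row with index \<open>Suc j\<close> by
    construction, so a single value per factor is compatible on both sides.\<close>
  define S where "S j = mat_adj (trow s (E (Suc j)) (C (Suc j))) * trow s (E j) (C j)" for j
  have "mat_sym_value (X j) (S j)" if "j \<le> J + 1" for j
    unfolding S_def using X[of j] that E mat_sym_value_iff_msym[of "X j" s s "E (Suc j)" "E j"] by auto
  moreover have "mutually_compatible (S (j + 1)) (S j)" for j
  proof -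
    have "dim_row (S (j + 1)) = s" "dim_col (S (j + 1)) = s" "dim_col (S j) = s"
      by (simp_all add: S_def trow_def)
    then show ?thesis
      unfolding mutually_compatible_def using sym_row_zero[of s "E (Suc (Suc j))"] sym_row_zero[of s "E (Suc j)"]
        sym_row_zero[of s "E j"] E by (metis S_def Suc_eq_plus1)
  qed
  ultimately have "mutually_compatible_upto J X"
    unfolding mutually_compatible_upto_def by blast
  then show ?thesis
    unfolding symmetric_factorization_def reg
    using X PX elem bound by (intro exI[of _ J] exI[of _ X]) (auto simp: X_def D_def truncation_def)
qed

theorem theorem1p2:
  fixes F :: "complex set" and r s :: nat and P :: "laurent mat"
  assumes "complex_subfield F"
    and "\<And>x. x \<in> F \<Longrightarrow> cnj x \<in> F"
    and "\<And>y :: real. y > 0 \<Longrightarrow> complex_of_real y \<in> F \<Longrightarrow> complex_of_real (sqrt y) \<in> F"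
    and "1 \<le> r" and "r \<le> s"
    and "P \<in> carrier_mat r s" and "coeffs_in F P"
  shows
    "(paraunitary P \<and> (\<exists>\<theta>\<^sub>1 T\<^sub>1 \<theta>\<^sub>2 T\<^sub>2. compatible_via P \<theta>\<^sub>1 T\<^sub>1 \<theta>\<^sub>2 T\<^sub>2) \<longleftrightarrow>
       (\<exists>\<theta>\<^sub>1 T\<^sub>1 \<theta>\<^sub>2 T\<^sub>2. sym_row r \<theta>\<^sub>1 T\<^sub>1 \<and> sym_row s \<theta>\<^sub>2 T\<^sub>2 \<and>
          symmetric_factorization F r s P T\<^sub>1 T\<^sub>2)) \<and>
     (\<forall>\<theta>\<^sub>1 T\<^sub>1 \<theta>\<^sub>2 T\<^sub>2. paraunitary P \<and> compatible_via P \<theta>\<^sub>1 T\<^sub>1 \<theta>\<^sub>2 T\<^sub>2 \<longrightarrow>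
       symmetric_factorization F r s P T\<^sub>1 T\<^sub>2)"
proof -
  interpret conj_sqrt_field F
    by unfold_locales (fact assms)+
  have exists: "symmetric_factorization F r s P T1 T2"
    if "paraunitary P" "compatible_via P \<theta>1 T1 \<theta>2 T2" for \<theta>1 T1 \<theta>2 T2
    using symmetric_factorization_exists[OF assms(4-7) that] .
  have rows: "sym_row r \<theta>1 T1" "sym_row s \<theta>2 T2" if "compatible_via P \<theta>1 T1 \<theta>2 T2" for \<theta>1 T1 \<theta>2 T2
    using that assms(6) by (auto simp: compatible_via_def)
  show ?thesis
  proof (intro conjI iffI allI impI)
    assume "paraunitary P \<and> (\<exists>\<theta>1 T1 \<theta>2 T2. compatible_via P \<theta>1 T1 \<theta>2 T2)"
    then show "\<exists>\<theta>1 T1 \<theta>2 T2. sym_row r \<theta>1 T1 \<and> sym_row s \<theta>2 T2 \<and> symmetric_factorization F r s P T1 T2"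
      using exists rows by blast
  qed (use exists symmetric_factorization_imp[OF assms(4-6)] in blast)+
qed

end
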